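(* Let $\sigma_n^2:=\mathrm{Var}(U_n)$ and $V(n)=\mathrm{Var}\{n^{-1}\sum_{i=1}^n h_{1,i}(X_i)\}$. Conditionally on $X_1,\dots,X_n$, let $\{h_{1,i}(X_i)\}^*$, $i\in[n]$, be i.i.d. draws from the empirical distribution of $\{h_{1,j}(X_j):1\le j\le n\}$, and let $P^*$ denote conditional probability given $X_1,\ldots,X_n$. Assume that for each $n$ there is a constant $M(n)>0$ depending only on $n$ with $$\max_{(i_1,\ldots,i_m)\in I_n^m}E\{h(X_{i_1},\ldots,X_{i_m})^{4}\}\le M(n),$$ and that $n^{-2}V(n)^{-3/2}A_{3,1}(n)M(n)^{3/4}\to 0$. In addition assume that for every $\epsilon>0$, as $n\to\infty$, $$\sup_{1\le i\le n}P\Big\{\Big|\frac{h_{1,i}(X_i)}{n\sigma_n}\Big|\ge\epsilon\Big\}\to 0,$$ $$\sum_{i=1}^n\Big[E\Big\{\frac{h_{1,i}(X_i)}{n\sigma_n}\mathbf 1\Big(\Big|\frac{h_{1,i}(X_i)}{n\sigma_n}\Big|\le\epsilon\Big)\Big\}\Big]^2\to 0 .$$ Then $$\sup_{t\in\mathbb R}\bigg|P^*\Big\{\sum_{i=1}^n\frac{\{h_{1,i}(X_i)\}^*}{n\sigma_n}-\sum_{i=1}^n\frac{h_{1,i}(X_i)}{n\sigma_n}\le t\Big\}-P\Big\{\sum_{i=1}^n\frac{h_{1,i}(X_i)}{n\sigma_n}\le t\Big\}\bigg|\stackrel{P}{\to}0 .$$ If, further, $n^{-2}V(n)^{-1}A_{2,2}(n)M(n)^{1/2}\to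 0$, then $$\sup_{t\in\mathbb R}\bigg|P^*\Big\{\sum_{i=1}^n\frac{\{h_{1,i}(X_i)\}^*}{n\sigma_n}-\sum_{i=1}^n\frac{h_{1,i}(X_i)}{n\sigma_n}\le t\Big\}-P\Big\{\mathrm{Var}(U_n)^{-1/2}\{U_n-E(U_n)\}\le t\Big\}\bigg|\stackrel{P}{\to}0 .$$
   Context: Fix an integer $m\ge 1$ (with $m\ge 2$ whenever $A_{2,2}(n)$ appears, since $A_{K,q}(n)$ below is defined for $0\le q\le m$). For each $n$ let $X_1,\dots,X_n$ (short for $X_{n,1},\dots,X_{n,n}$, a triangular array) be independent random variables with values in a measurable space $(\mathcal X,\mathcal B_{\mathcal X})$, $X_i$ having distribution $P_i=P_{n,i}$; the $P_i$ need not be equal and may change with $n$. Write $[n]=\{1,\dots,n\}$. The weight function $a=a_n:\mathbb Z^m\to\mathbb R$ and the (measurable) kernel $h=h_n:\mathcal X^m\to\mathbb R$ may depend on $n$ and need not be symmetric. Let $I_n^m$ be the set of $m$-tuples $(i_1,\dots,i_m)\in[n]^m$ with pairwise distinct entries, and $$U_n=\frac{(n-m)!}{n!}\sum_{I_n^m}a(i_1,\ldots,i_m)h(X_{i_1},\ldots,X_{i_m}).$$ Let $\theta(i_1,\ldots,i_m)=E\{h(X_{i_1},\ldots,X_{i_m})\}$ for $(i_1,\dots,i_m)\in I_n^m$. For $l\in[m]$ let $\pi_l(y;y_1,\ldots,y_{m-1})=(y_1,\ldots,y_{l-1},y,y_l,\ldots,y_{m-1})$ and define $a^{(l)}(i;i_1,\ldots,i_{m-1})=a\{\pi_l(i;i_1,\ldots,i_{m-1})\}$,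 $h^{(l)}(x;x_1,\ldots,x_{m-1})=h\{\pi_l(x;x_1,\ldots,x_{m-1})\}$, $\theta^{(l)}(i;i_1,\ldots,i_{m-1})=\theta\{\pi_l(i;i_1,\ldots,i_{m-1})\}$, and $$f^{(l)}_{i_1,\ldots,i_{m-1}}(x)=\int h^{(l)}(x;y_1,\ldots,y_{m-1})\,dP_{i_1}(y_1)\cdots dP_{i_{m-1}}(y_{m-1}).$$ Let $I_{n-1}^{m-1}(-i)$ be the set of $(m-1)$-tuples of pairwise distinct elements of $[n]\setminus\{i\}$, and $$h_{1,i}(x)=\frac{(n-m)!}{(n-1)!}\sum_{I_{n-1}^{m-1}(-i)}\sum_{l=1}^m a^{(l)}(i;i_1,\ldots,i_{m-1})\big\{f^{(l)}_{i_1,\ldots,i_{m-1}}(x)-\theta^{(l)}(i;i_1,\ldots,i_{m-1})\big\}.$$ For integers $K\ge 2$, $0\le q\le m$, let $(I_n^m)_{\ge q}^{\otimes K}$ be the set of $K$-tuples $(\boldsymbol i^{(1)},\dots,\boldsymbol i^{(K)})$ of elements $\boldsymbol i^{(k)}=(i^{(k)}_1,\dots,i^{(k)}_m)\in I_n^m$ with $\mathrm{card}\big(\bigcap_{k=1}^K\{i_1^{(k)},\ldots,i_m^{(k)}\}\big)\ge q$, and $$A_{K,q}(n)=\frac{1}{\mathrm{card}\{(I_n^m)_{\ge q}^{\otimes K}\}}\sum_{(I_n^m)_{\ge q}^{\otimes K}}\big|a(\boldsymbol i^{(1)})\cdots a(\boldsymbol i^{(K)})\big|.$$ $\mathbf 1(\cdot)$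 is the indicator function and $\stackrel{P}{\to}$ is convergence in probability. *)

theory Defs
  imports "HOL-Probability.Probability"
begin

text \<open>
  Conventions. All notions below are for one fixed row \<open>n\<close> of the triangular array: \<open>P\<close> is the
  underlying probability space, \<open>X i\<close> (\<open>1 \<le> i \<le> n\<close>) are the observations with values in \<open>N\<close>,
  \<open>a\<close> is the weight function and \<open>h\<close> the kernel. An \<open>m\<close>-tuple is an extensional function on
  \<open>{1..m}\<close>, so that \<open>m\<close>-tuples of points of \<open>N\<close> are the points of \<open>Pi\<^sub>M {1..m} (\<lambda>_. N)\<close>.
  Only the values of \<open>a\<close> at tuples of indices in \<open>{1..n}\<close> matter, hence tuples of natural numbers.
\<close>

text \<open>
  \<open>inj_tuples m {1..n}\<close> is the index set \<open>I\<^sub>n\<^sup>m\<close>; \<open>inj_tuples (m - 1) ({1..n} - {i})\<close> is the set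
  of \<open>(m - 1)\<close>-tuples of distinct indices other than \<open>i\<close>.
\<close>

definition inj_tuples :: "nat \<Rightarrow> nat set \<Rightarrow> (nat \<Rightarrow> nat) set" where
  "inj_tuples k S = {i \<in> {1..k} \<rightarrow>\<^sub>E S. inj_on i {1..k}}"

definition tuple_insert :: "nat \<Rightarrow> nat \<Rightarrow> 'b \<Rightarrow> (nat \<Rightarrow> 'b) \<Rightarrow> nat \<Rightarrow> 'b" where
  "tuple_insert m l y ys = (\<lambda>k\<in>{1..m}. if k < l then ys k else if k = l then y else ys (k - 1))"

definition kernel_at ::
  "nat \<Rightarrow> (nat \<Rightarrow> 'w \<Rightarrow> 'x) \<Rightarrow> ((nat \<Rightarrow> 'x) \<Rightarrow> real) \<Rightarrow> (nat \<Rightarrow> nat) \<Rightarrow> 'w \<Rightarrow> real" where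
  "kernel_at m X h i \<omega> = h (\<lambda>k\<in>{1..m}. X (i k) \<omega>)"

definition ustat ::
  "nat \<Rightarrow> nat \<Rightarrow> (nat \<Rightarrow> 'w \<Rightarrow> 'x) \<Rightarrow> ((nat \<Rightarrow> nat) \<Rightarrow> real) \<Rightarrow> ((nat \<Rightarrow> 'x) \<Rightarrow> real) \<Rightarrow> 'w \<Rightarrow> real" where
  "ustat m n X a h \<omega> =
     fact (n - m) / fact n * (\<Sum>i\<in>inj_tuples m {1..n}. a i * kernel_at m X h i \<omega>)"

definition kernel_mean ::
  "nat \<Rightarrow> 'w measure \<Rightarrow> (nat \<Rightarrow> 'w \<Rightarrow> 'x) \<Rightarrow> ((nat \<Rightarrow> 'x) \<Rightarrow> real) \<Rightarrow> (nat \<Rightarrow> nat) \<Rightarrow> real" where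
  "kernel_mean m P X h i = prob_space.expectation P (kernel_at m X h i)"

definition kernel_section ::
  "nat \<Rightarrow> 'w measure \<Rightarrow> 'x measure \<Rightarrow> (nat \<Rightarrow> 'w \<Rightarrow> 'x) \<Rightarrow> ((nat \<Rightarrow> 'x) \<Rightarrow> real)
    \<Rightarrow> nat \<Rightarrow> (nat \<Rightarrow> nat) \<Rightarrow> 'x \<Rightarrow> real" where
  "kernel_section m P N X h l i x =
     (\<integral>y. h (tuple_insert m l x y) \<partial>(\<Pi>\<^sub>M k\<in>{1..m - 1}. distr P N (X (i k))))"

definition hajek ::
  "nat \<Rightarrow> nat \<Rightarrow> 'w measure \<Rightarrow> 'x measure \<Rightarrow> (nat \<Rightarrow> 'w \<Rightarrow> 'x) \<Rightarrow> ((nat \<Rightarrow> nat) \<Rightarrow> real)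
    \<Rightarrow> ((nat \<Rightarrow> 'x) \<Rightarrow> real) \<Rightarrow> nat \<Rightarrow> 'x \<Rightarrow> real" where
  "hajek m n P N X a h i x =
     fact (n - m) / fact (n - 1) *
       (\<Sum>j\<in>inj_tuples (m - 1) ({1..n} - {i}). \<Sum>l=1..m.
          a (tuple_insert m l i j) *
            (kernel_section m P N X h l j x - kernel_mean m P X h (tuple_insert m l i j)))"

definition hajek_var ::
  "nat \<Rightarrow> nat \<Rightarrow> 'w measure \<Rightarrow> 'x measure \<Rightarrow> (nat \<Rightarrow> 'w \<Rightarrow> 'x) \<Rightarrow> ((nat \<Rightarrow> nat) \<Rightarrow> real)
    \<Rightarrow> ((nat \<Rightarrow> 'x) \<Rightarrow> real) \<Rightarrow> real" where
  "hajek_var m n P N X a h =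
     prob_space.variance P (\<lambda>\<omega>. (\<Sum>i=1..n. hajek m n P N X a h i (X i \<omega>)) / real n)"

definition ustat_sd ::
  "nat \<Rightarrow> nat \<Rightarrow> 'w measure \<Rightarrow> (nat \<Rightarrow> 'w \<Rightarrow> 'x) \<Rightarrow> ((nat \<Rightarrow> nat) \<Rightarrow> real)
    \<Rightarrow> ((nat \<Rightarrow> 'x) \<Rightarrow> real) \<Rightarrow> real" where
  "ustat_sd m n P X a h = sqrt (prob_space.variance P (ustat m n X a h))"

definition scaled_hajek ::
  "nat \<Rightarrow> nat \<Rightarrow> 'w measure \<Rightarrow> 'x measure \<Rightarrow> (nat \<Rightarrow> 'w \<Rightarrow> 'x) \<Rightarrow> ((nat \<Rightarrow> nat) \<Rightarrow> real)
    \<Rightarrow> ((nat \<Rightarrow> 'x) \<Rightarrow> real) \<Rightarrow> nat \<Rightarrow> 'w \<Rightarrow> real" where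
  "scaled_hajek m n P N X a h i \<omega> =
     hajek m n P N X a h i (X i \<omega>) / (real n * ustat_sd m n P X a h)"

definition overlap_tuples :: "nat \<Rightarrow> nat \<Rightarrow> nat \<Rightarrow> nat \<Rightarrow> (nat \<Rightarrow> nat \<Rightarrow> nat) set" where
  "overlap_tuples m n K q =
     {I \<in> {1..K} \<rightarrow>\<^sub>E inj_tuples m {1..n}. card (\<Inter>k\<in>{1..K}. I k ` {1..m}) \<ge> q}"

definition weight_avg :: "nat \<Rightarrow> nat \<Rightarrow> ((nat \<Rightarrow> nat) \<Rightarrow> real) \<Rightarrow> nat \<Rightarrow> nat \<Rightarrow> real" where
  "weight_avg m n a K q =
     1 / real (card (overlap_tuples m n K q)) *
       (\<Sum>I\<in>overlap_tuples m n K q. \<bar>\<Prod>k=1..K. a (I k)\<bar>)"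

definition empirical_pmf :: "nat \<Rightarrow> (nat \<Rightarrow> 'b) \<Rightarrow> 'b pmf" where
  "empirical_pmf n z = map_pmf z (pmf_of_set {1..n})"

text \<open>
  Given the data, i.e. for fixed \<open>\<omega>\<close>, the bootstrap sample \<open>y\<close> is a vector of \<open>n\<close> independent
  draws from the empirical distribution, so the conditional probability \<open>P\<^sup>*\<close> is computed
  under the \<open>n\<close>-fold product of that distribution. (The argument \<open>0\<close> of \<open>Pi_pmf\<close> is the
  irrelevant value of \<open>y\<close> outside \<open>{1..n}\<close>.)
\<close>

definition boot_cdf ::
  "nat \<Rightarrow> nat \<Rightarrow> 'w measure \<Rightarrow> 'x measure \<Rightarrow> (nat \<Rightarrow> 'w \<Rightarrow> 'x) \<Rightarrow> ((nat \<Rightarrow> nat) \<Rightarrow> real)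
    \<Rightarrow> ((nat \<Rightarrow> 'x) \<Rightarrow> real) \<Rightarrow> 'w \<Rightarrow> real \<Rightarrow> real" where
  "boot_cdf m n P N X a h \<omega> t =
     measure_pmf.prob
       (Pi_pmf {1..n} 0 (\<lambda>_. empirical_pmf n (\<lambda>j. hajek m n P N X a h j (X j \<omega>))))
       {y. (\<Sum>i=1..n. y i / (real n * ustat_sd m n P X a h))
             - (\<Sum>i=1..n. scaled_hajek m n P N X a h i \<omega>) \<le> t}"

text \<open>
  Convergence in probability to \<open>0\<close> of random variables \<open>Z n\<close> that may live on different
  probability spaces. Eventual measurability is part of the notion: \<^const>\<open>measure\<close> is \<open>0\<close> on
  non-measurable sets, so the limit alone would say nothing about a non-measurable \<open>Z n\<close>.
\<close>

definition tendsto_0_in_prob :: "(nat \<Rightarrow> 'w measure) \<Rightarrow> (nat \<Rightarrow> 'w \<Rightarrow> real) \<Rightarrow> bool" where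
  "tendsto_0_in_prob P Z \<longleftrightarrow>
     (\<forall>\<^sub>F n in sequentially. Z n \<in> borel_measurable (P n)) \<and>
     (\<forall>\<epsilon>>0. (\<lambda>n. measure (P n) {\<omega> \<in> space (P n). \<bar>Z n \<omega>\<bar> > \<epsilon>}) \<longlonglongrightarrow> 0)"

end

theory Submission
  imports Defs
begin

text \<open>
  Put \<open>Y i = h\<^sub>1\<^sub>,\<^sub>i (X i)\<close>. These variables are independent and centred, and the variances of
  \<open>Y 1, \<dots>, Y n\<close> add up to \<open>b\<^sup>2\<close> with \<open>b = n * sqrt V\<close>. Both distribution functions in each claim
  belong to a quantity divided by \<open>n * \<sigma>\<close>, and a supremum over all \<open>t\<close> is not changed by a common
  positive rescaling. So everything is compared with the standard normal law at the scale \<open>b\<close>, on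
  which the variance of the row sum is \<open>1\<close>. (If \<open>\<sigma> = 0\<close>, division yields \<open>0\<close> and both laws are the
  point mass at \<open>0\<close>.)

  The sum of \<open>Y 1, \<dots>, Y n\<close> is asymptotically normal by Lyapunov's condition. By Jensen's inequality
  a section of the kernel has no larger moments than the kernel itself, so \<open>E \<bar>Y i\<bar>\<^sup>3\<close> is at most a
  constant times \<open>M powr (3/4)\<close> times the cube of the averaged weight of the tuples through \<open>i\<close>.
  Expanding these cubes produces triples of tuples with a common index, and
  \<open>sum_cube_tuples_through_le_weight_avg\<close> bounds their sum by \<open>A\<^sub>3\<^sub>,\<^sub>1\<close>: the hypothesis on
  \<open>A\<^sub>3\<^sub>,\<^sub>1\<close> is just what makes the Lyapunov ratio tend to \<open>0\<close>.

  The bootstrap sum is, for fixed data, a sum of \<open>n\<close> independent identically distributed variables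
  whose total variance is \<open>\<Sum>Y\<^sup>2 - (\<Sum>Y)\<^sup>2 / n\<close> and whose third moments are at most \<open>8 * \<Sum>\<bar>Y\<bar>\<^sup>3\<close>.
  After division by the powers of \<open>b\<close> the first tends to \<open>1\<close> and the second to \<open>0\<close> in probability
  (\<open>sum_squares_concentration\<close> and Markov's inequality), so that, off an event of small
  probability, the data are such that the conditional law is close to normal. As the conditional law
  changes with the data, this needs a central limit theorem whose error bound depends on nothing but
  the variance and the third moments; this is \<open>uniform_clt\<close>.

  For the second claim, \<open>n * (U - E U)\<close> differs from the sum of the \<open>Y i\<close> by a weighted sum of
  kernels from which the mean and the projections onto single observations have been subtracted
  (\<open>centered_ustat_eq\<close>). Two such remainders are orthogonal unless their tuples share two indices
  (\<open>remainder_orthogonal\<close>). So the variance of the difference is governed by pairs of tuples with two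
  common indices, that is by \<open>A\<^sub>2\<^sub>,\<^sub>2\<close>, and is negligible compared with \<open>b\<^sup>2\<close>; such a
  perturbation does not affect asymptotic normality (\<open>asymp_normal_perturb\<close>).
\<close>

section \<open>A central limit theorem that is uniform over distributions\<close>

text \<open>
  Polya's theorem. A continuous limit has quantiles of every order \<open>j / r\<close>; convergence at these
  finitely many points controls all others by monotonicity.
\<close>

lemma polya_uniform_convergence:
  fixes M :: "nat \<Rightarrow> real measure" and L :: "real measure"
  assumes M: "\<And>n. real_distribution (M n)" and L: "real_distribution L"
    and conv: "weak_conv_m M L" and cont: "\<And>x. isCont (cdf L) x" and "\<epsilon> > 0"
  shows "\<forall>\<^sub>F n in sequentially. \<forall>x. \<bar>cdf (M n) x - cdf L x\<bar> \<le> \<epsilon>"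
proof -
  interpret L: real_distribution L by fact
  obtain r :: nat where r: "r > 0" "4 / real r < \<epsilon>"
  proof -
    obtain r :: nat where "4 / \<epsilon> < real r" using reals_Archimedean2 by blast
    moreover from this \<open>\<epsilon> > 0\<close> have "r > 0"
      by (metis divide_pos_pos less_le_trans of_nat_0 of_nat_0_less_iff order_less_trans zero_less_numeral)
    ultimately show ?thesis using that[of r] \<open>\<epsilon> > 0\<close> by (simp add: field_simps)
  qed
  have ex: "\<exists>x. cdf L x = p" if p: "0 < p" "p < 1" for p
  proof -
    obtain a where a: "cdf L a < p"
      using order_tendstoD(2)[OF L.cdf_lim_at_bot p(1)] by (metis eventually_at_bot_linorder order_refl)
    obtain b where b: "p < cdf L b"
      using order_tendstoD(1)[OF L.cdf_lim_at_top_prob p(2)] by (metis eventually_at_top_linorder order_refl)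
    have "a \<le> b" using a b L.cdf_nondecreasing[of b a] by linarith
    then show ?thesis
      using IVT[of "cdf L" a p b] a b cont by auto
  qed
  then have "\<forall>j\<in>{1..<r}. \<exists>x. cdf L x = real j / real r" by (intro ballI ex) auto
  then obtain g where g: "\<And>j. 1 \<le> j \<Longrightarrow> j < r \<Longrightarrow> cdf L (g j) = real j / real r"
    by (metis atLeastLessThan_iff)
  have "\<forall>j\<in>{1..<r}. \<forall>\<^sub>F n in sequentially. \<bar>cdf (M n) (g j) - cdf L (g j)\<bar> < \<epsilon> / 2"
  proof
    fix j
    have "(\<lambda>n. cdf (M n) (g j)) \<longlonglongrightarrow> cdf L (g j)"
      using conv cont by (auto simp: weak_conv_m_def weak_conv_def)
    then show "\<forall>\<^sub>F n in sequentially. \<bar>cdf (M n) (g j) - cdf L (g j)\<bar> < \<epsilon> / 2"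
      using \<open>\<epsilon> > 0\<close> unfolding tendsto_iff dist_real_def by (meson half_gt_zero)
  qed
  then have "\<forall>\<^sub>F n in sequentially. \<forall>j\<in>{1..<r}. \<bar>cdf (M n) (g j) - cdf L (g j)\<bar> < \<epsilon> / 2"
    by (simp add: eventually_ball_finite_distrib)
  then show ?thesis
  proof eventually_elim
    case (elim n)
    interpret Mn: real_distribution "M n" by fact
    have near: "cdf (M n) (g j) \<le> cdf L (g j) + \<epsilon> / 2" "cdf L (g j) - \<epsilon> / 2 \<le> cdf (M n) (g j)"
      if "1 \<le> j" "j < r" for j
    proof -
      have "\<bar>cdf (M n) (g j) - cdf L (g j)\<bar> < \<epsilon> / 2" using elim that by simp
      then show "cdf (M n) (g j) \<le> cdf L (g j) + \<epsilon> / 2" "cdf L (g j) - \<epsilon> / 2 \<le> cdf (M n) (g j)"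
        by arith+
    qed
    have r4: "1 / real r \<le> \<epsilon> / 4" using r by (simp add: field_simps)
    show ?case
    proof
      fix x
      \<comment> \<open>The quantiles of order \<open>(j - 1) / r\<close> and \<open>(j + 1) / r\<close> lie strictly on either side of \<open>x\<close>; the one of
        order \<open>j / r\<close> may lie to the right of \<open>x\<close> if \<open>L\<close> is flat there.\<close>
      define j where "j = nat \<lfloor>real r * cdf L x\<rfloor>"
      have j: "real j \<le> real r * cdf L x" "real r * cdf L x < real j + 1"
        using L.cdf_nonneg[of x] r(1) by (auto simp: j_def)
      have rr: "real j / real r \<le> cdf L x" "cdf L x < real j / real r + 1 / real r"
        using j r(1) by (auto simp: field_simps)
      have "cdf (M n) x \<le> cdf L x + \<epsilon>"
      proof (cases "j + 1 < r")
        case True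
        have 1: "cdf L (g (j+1)) = real j / real r + 1 / real r"
          using g[of "j+1"] True by (simp add: add_divide_distrib)
        then have "x < g (j+1)"
          using rr(2) L.cdf_nondecreasing[of "g (j+1)" x] by (smt (verit))
        then have "cdf (M n) x \<le> cdf (M n) (g (j+1))"
          by (intro Mn.cdf_nondecreasing) auto
        also have "\<dots> \<le> cdf L (g (j+1)) + \<epsilon> / 2" using near[of "j+1"] True by auto
        also have "\<dots> \<le> cdf L x + \<epsilon>" using 1 rr r4 \<open>0 < \<epsilon>\<close> by linarith
        finally show ?thesis .
      next
        case False
        then have "real r \<le> real j + 1" by linarith
        then have "1 \<le> real j / real r + 1 / real r" using r(1) by (simp add: field_simps)
        moreover have "cdf (M n) x \<le> 1" by (rule Mn.cdf_bounded_prob)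
        moreover have "1 / real r \<le> \<epsilon>" using r by (simp add: field_simps)
        ultimately show ?thesis using rr by linarith
      qed
      moreover have "cdf L x - \<epsilon> \<le> cdf (M n) x"
      proof (cases "j \<ge> 2")
        case True
        have "j - 1 < r"
        proof -
          have "real j \<le> real r" using j(1) L.cdf_bounded_prob[of x] r(1)
            by (smt (verit) mult_left_le of_nat_0_le_iff)
          then show ?thesis using True by linarith
        qed
        then have 1: "cdf L (g (j-1)) = real j / real r - 1 / real r"
          using g[of "j-1"] True by (simp add: diff_divide_distrib of_nat_diff)
        then have "g (j-1) < x"
          using rr(1) r(1) L.cdf_nondecreasing[of x "g (j-1)"]
          by (smt (verit) divide_pos_pos of_nat_0_less_iff)
        then have "cdf (M n) (g (j-1)) \<le> cdf (M n) x" by (intro Mn.cdf_nondecreasing) auto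
        moreover have "cdf L (g (j-1)) - \<epsilon> / 2 \<le> cdf (M n) (g (j-1))"
          using near True \<open>j - 1 < r\<close> by auto
        ultimately show ?thesis using 1 rr r4 by linarith
      next
        case False
        then have "real j / real r \<le> 1 / real r" using r(1) by (auto simp: field_simps)
        then have "cdf L x \<le> 2 / real r" using rr(2) by simp
        then show ?thesis using r(2) Mn.cdf_nonneg[of x] \<open>0 < \<epsilon>\<close> by (simp add: field_simps)
      qed
      ultimately show "\<bar>cdf (M n) x - cdf L x\<bar> \<le> \<epsilon>" by linarith
    qed
  qed
qed

abbreviation Phi :: "real \<Rightarrow> real" where
  "Phi \<equiv> cdf std_normal_distribution"

lemma isCont_Phi: "isCont Phi x"
proof -
  interpret real_distribution std_normal_distribution by (rule real_dist_normal_dist)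
  have "emeasure std_normal_distribution {x} = 0"
    by (subst emeasure_density) (auto intro!: nn_integral_0_iff_AE[THEN iffD2] AE_I'[of "{x}"])
  then show ?thesis unfolding isCont_cdf measure_def by simp
qed

text \<open>
  Otherwise there would be distributions violating the bound with \<open>\<eta> = 1 / k\<close> and \<open>T = k\<close> for
  every \<open>k\<close>, in contradiction to Levy's continuity theorem. The point of this form is that \<open>\<eta>\<close> and
  \<open>T\<close> serve all distributions at once.
\<close>

lemma cdf_close_to_normal_if_char_close:
  fixes \<epsilon> :: real
  assumes "\<epsilon> > 0"
  obtains \<eta> T :: real where "\<eta> > 0" "T > 0"
    "\<And>\<mu> x. real_distribution \<mu> \<Longrightarrow>
       (\<And>t. \<bar>t\<bar> \<le> T \<Longrightarrow> cmod (char \<mu> t - of_real (exp (- (t\<^sup>2) / 2))) \<le> \<eta>) \<Longrightarrow>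
       \<bar>cdf \<mu> x - Phi x\<bar> \<le> \<epsilon>"
proof -
  let ?N = std_normal_distribution
  have "\<exists>k::nat. \<forall>\<mu>. real_distribution \<mu> \<longrightarrow>
       (\<forall>t. \<bar>t\<bar> \<le> real (Suc k) \<longrightarrow> cmod (char \<mu> t - of_real (exp (- (t\<^sup>2) / 2))) \<le> 1 / real (Suc k)) \<longrightarrow>
       (\<forall>x. \<bar>cdf \<mu> x - cdf ?N x\<bar> \<le> \<epsilon>)"
  proof (rule ccontr)
    assume "\<not> ?thesis"
    then have "\<forall>k. \<exists>\<mu>. real_distribution \<mu> \<and>
       (\<forall>t. \<bar>t\<bar> \<le> real (Suc k) \<longrightarrow> cmod (char \<mu> t - of_real (exp (- (t\<^sup>2) / 2))) \<le> 1 / real (Suc k)) \<and>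
       (\<exists>x. \<not> \<bar>cdf \<mu> x - cdf ?N x\<bar> \<le> \<epsilon>)" by blast
    then obtain \<mu> where rd: "\<And>k. real_distribution (\<mu> k)"
      and ch: "\<And>k t. \<bar>t\<bar> \<le> real (Suc k) \<Longrightarrow>
            cmod (char (\<mu> k) t - of_real (exp (- (t\<^sup>2) / 2))) \<le> 1 / real (Suc k)"
      and bad: "\<And>k. \<exists>x. \<not> \<bar>cdf (\<mu> k) x - cdf ?N x\<bar> \<le> \<epsilon>" by metis
    have "weak_conv_m \<mu> ?N"
    proof (rule levy_continuity[OF rd real_dist_normal_dist])
      fix t :: real
      have "(\<lambda>k. char (\<mu> k) t) \<longlonglongrightarrow> of_real (exp (- (t\<^sup>2) / 2))"
      proof (rule LIM_zero_cancel, rule Lim_null_comparison)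
        obtain K :: nat where "\<bar>t\<bar> < real K" using reals_Archimedean2 by blast
        then show "\<forall>\<^sub>F k in sequentially.
             cmod (char (\<mu> k) t - of_real (exp (- (t\<^sup>2) / 2))) \<le> 1 / real (Suc k)"
          by (intro eventually_sequentiallyI[of K] ch) auto
        show "(\<lambda>k. 1 / real (Suc k)) \<longlonglongrightarrow> 0" using LIMSEQ_Suc[OF lim_1_over_n] by simp
      qed
      then show "(\<lambda>k. char (\<mu> k) t) \<longlonglongrightarrow> char ?N t" by (simp add: char_std_normal_distribution)
    qed
    from polya_uniform_convergence[OF rd real_dist_normal_dist this isCont_Phi \<open>\<epsilon> > 0\<close>]
    show False using bad eventually_happens[of _ sequentially] by fastforce
  qed
  then obtain k :: nat where "\<forall>\<mu>. real_distribution \<mu> \<longrightarrow>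
       (\<forall>t. \<bar>t\<bar> \<le> real (Suc k) \<longrightarrow> cmod (char \<mu> t - of_real (exp (- (t\<^sup>2) / 2))) \<le> 1 / real (Suc k)) \<longrightarrow>
       (\<forall>x. \<bar>cdf \<mu> x - cdf ?N x\<bar> \<le> \<epsilon>)" by blast
  then show ?thesis by (intro that[of "1 / real (Suc k)" "real (Suc k)"]) auto
qed

context prob_space
begin

lemma abs_power_integrable_mono:
  fixes Y :: "'a \<Rightarrow> real"
  assumes [measurable]: "Y \<in> borel_measurable M" and int: "integrable M (\<lambda>w. \<bar>Y w\<bar> ^ q)" and "p \<le> q"
  shows "integrable M (\<lambda>w. Y w ^ p)" "integrable M (\<lambda>w. \<bar>Y w\<bar> ^ p)"
proof -
  have bnd: "\<bar>y\<bar> ^ p \<le> 1 + \<bar>y\<bar> ^ q" for y :: real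
    by (cases "\<bar>y\<bar> \<le> 1")
       (auto intro: order_trans[OF power_le_one] order_trans[OF power_increasing[OF \<open>p \<le> q\<close>]])
  have i: "integrable M (\<lambda>w. 1 + \<bar>Y w\<bar> ^ q)" using int by simp
  show "integrable M (\<lambda>w. Y w ^ p)" "integrable M (\<lambda>w. \<bar>Y w\<bar> ^ p)"
    using bnd by (auto intro!: Bochner_Integration.integrable_bound[OF i] simp: power_abs)
qed

text \<open>
  Lyapunov's inequality \<open>v powr (3/2) \<le> E \<bar>Y\<bar>\<^sup>3\<close> for \<open>v = E Y\<^sup>2\<close>: integrate the tangent inequality
  \<open>3 * s * y\<^sup>2 \<le> 2 * y\<^sup>3 + s\<^sup>3\<close> at \<open>s = sqrt v\<close>.
\<close>

lemma second_moment_le_third_moment: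
  fixes Y :: "'a \<Rightarrow> real"
  assumes [measurable]: "Y \<in> borel_measurable M" and int: "integrable M (\<lambda>w. \<bar>Y w\<bar> ^ 3)"
  shows "expectation (\<lambda>w. (Y w)\<^sup>2) * sqrt (expectation (\<lambda>w. (Y w)\<^sup>2)) \<le> expectation (\<lambda>w. \<bar>Y w\<bar> ^ 3)"
proof (cases "expectation (\<lambda>w. (Y w)\<^sup>2) > 0")
  case True
  define v where "v = expectation (\<lambda>w. (Y w)\<^sup>2)"
  define s where "s = sqrt v"
  have s: "s > 0" "s\<^sup>2 = v" using True by (auto simp: s_def v_def)
  have pw: "3 * s * y\<^sup>2 \<le> 2 * \<bar>y\<bar> ^ 3 + s ^ 3" for y :: real
  proof -
    have "0 \<le> (\<bar>y\<bar> - s)\<^sup>2 * (2 * \<bar>y\<bar> + s)" using s by simp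
    also have "\<dots> = 2 * \<bar>y\<bar> ^ 3 + s ^ 3 - 3 * s * \<bar>y\<bar>\<^sup>2" by algebra
    finally show ?thesis by simp
  qed
  have "3 * s * v = expectation (\<lambda>w. 3 * s * (Y w)\<^sup>2)" by (simp add: v_def)
  also have "\<dots> \<le> expectation (\<lambda>w. 2 * \<bar>Y w\<bar> ^ 3 + s ^ 3)"
    using int abs_power_integrable_mono(1)[OF assms, of 2] by (intro integral_mono pw) auto
  also have "\<dots> = 2 * expectation (\<lambda>w. \<bar>Y w\<bar> ^ 3) + s ^ 3" using int by (simp add: prob_space)
  also have "s ^ 3 = s * v" using s(2) by (simp add: power3_eq_cube power2_eq_square algebra_simps)
  finally have "v * s \<le> expectation (\<lambda>w. \<bar>Y w\<bar> ^ 3)" by (simp add: algebra_simps)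
  then show ?thesis by (simp add: s_def v_def)
next
  case False
  moreover have "expectation (\<lambda>w. (Y w)\<^sup>2) \<ge> 0" by simp
  ultimately have "expectation (\<lambda>w. (Y w)\<^sup>2) = 0" by linarith
  then show ?thesis by simp
qed

text \<open>
  Each factor of the characteristic function is compared with its Gaussian counterpart through the
  common second-order Taylor polynomial. The error on the Gaussian side is of order \<open>t\<^sup>4 * v\<^sup>2\<close>, and
  \<open>v\<^sup>2\<close> is at most twice the third moment as soon as \<open>v \<le> 4\<close>.
\<close>

lemma char_sum_near_gaussian:
  fixes Y :: "'i \<Rightarrow> 'a \<Rightarrow> real"
  assumes indep: "indep_vars (\<lambda>_. borel) Y A"
    and int: "\<And>i. i \<in> A \<Longrightarrow> integrable M (\<lambda>w. \<bar>Y i w\<bar> ^ 3)"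
    and mean: "\<And>i. i \<in> A \<Longrightarrow> expectation (Y i) = 0"
    and var: "\<And>i. i \<in> A \<Longrightarrow> expectation (\<lambda>w. (Y i w)\<^sup>2) \<le> 4"
  shows "cmod (char (distr M borel (\<lambda>w. \<Sum>i\<in>A. Y i w)) t
           - of_real (exp (- (t\<^sup>2) / 2 * (\<Sum>i\<in>A. expectation (\<lambda>w. (Y i w)\<^sup>2)))))
         \<le> (\<bar>t\<bar> ^ 3 + t ^ 4) * (\<Sum>i\<in>A. expectation (\<lambda>w. \<bar>Y i w\<bar> ^ 3))"
proof (cases "finite A")
  case fin: True
  define v \<beta> where "v i = expectation (\<lambda>w. (Y i w)\<^sup>2)" and "\<beta> i = expectation (\<lambda>w. \<bar>Y i w\<bar> ^ 3)" for i
  have rv [measurable]: "Y i \<in> borel_measurable M" if "i \<in> A" for i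
    using indep that unfolding indep_vars_def by auto
  have v0: "v i \<ge> 0" for i by (simp add: v_def)
  have \<beta>0: "\<beta> i \<ge> 0" for i by (simp add: \<beta>_def)
  have each: "cmod (char (distr M borel (Y i)) t - of_real (exp (- (t\<^sup>2) / 2 * v i)))
                \<le> (\<bar>t\<bar> ^ 3 + t ^ 4) * \<beta> i" if i: "i \<in> A" for i
  proof -
    note [measurable] = rv[OF i]
    have i2: "integrable M (\<lambda>w. (Y i w)\<^sup>2)" and i1: "integrable M (Y i)"
      using abs_power_integrable_mono[OF rv[OF i] int[OF i], of 2]
        abs_power_integrable_mono[OF rv[OF i] int[OF i], of 1] by auto
    have "cmod (char (distr M borel (Y i)) t - (1 - t^2 * v i / 2)) \<le>
      (t^2 / 6) * expectation (\<lambda>x. min (6 * (Y i x)^2) (\<bar>t\<bar> * \<bar>Y i x\<bar>^3))"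
      by (rule char_approx3') (use i1 i2 mean[OF i] in \<open>auto simp: v_def rv i\<close>)
    also have "\<dots> \<le> (t^2 / 6) * expectation (\<lambda>x. \<bar>t\<bar> * \<bar>Y i x\<bar>^3)"
    proof (intro mult_left_mono integral_mono)
      show "integrable M (\<lambda>x. \<bar>t\<bar> * \<bar>Y i x\<bar> ^ 3)" using int[OF i] by simp
      then show "integrable M (\<lambda>x. min (6 * (Y i x)^2) (\<bar>t\<bar> * \<bar>Y i x\<bar>^3))"
        by (rule Bochner_Integration.integrable_bound) auto
    qed auto
    also have "\<dots> = \<bar>t\<bar>^3 / 6 * \<beta> i"
      by (simp add: \<beta>_def power3_eq_cube power2_eq_square)
    finally have 1: "cmod (char (distr M borel (Y i)) t - of_real (1 - t^2 * v i / 2)) \<le> \<bar>t\<bar>^3 / 6 * \<beta> i"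
      by simp
    define x where "x = t\<^sup>2 * v i / 2"
    have x0: "x \<ge> 0" using v0 by (simp add: x_def)
    have ex: "\<bar>1 - x - exp (- x)\<bar> \<le> x\<^sup>2 / 2"
    proof -
      obtain u where u: "exp (-x) = (\<Sum>k<2. (-x)^k / fact k) + exp u / fact 2 * (-x)^2" "\<bar>u\<bar> \<le> \<bar>-x\<bar>"
        "-x \<le> u" "u \<le> 0"
      proof (cases "x = 0")
        case True then show ?thesis using that[of 0] by (simp add: numeral_2_eq_2)
      next
        case False
        then show ?thesis
          using Maclaurin_minus[of "-x" 2 "\<lambda>_. exp" exp] x0 that
          by (force intro!: derivative_eq_intros)
      qed
      have "exp (-x) - (1 - x) = exp u * x\<^sup>2 / 2" using u(1) by (simp add: numeral_2_eq_2)
      moreover have "exp u * x\<^sup>2 \<le> 1 * x\<^sup>2" using u(4) by (intro mult_right_mono) auto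
      moreover have "0 \<le> exp u * x\<^sup>2" by simp
      ultimately show ?thesis by linarith
    qed
    have "v i * sqrt (v i) \<le> \<beta> i"
      unfolding v_def \<beta>_def by (rule second_moment_le_third_moment[OF rv[OF i] int[OF i]])
    moreover have "sqrt (v i) \<le> 2"
      using real_sqrt_le_mono[OF var[OF i]] real_sqrt_abs[of 2] by (simp add: v_def)
    ultimately have "(v i * sqrt (v i)) * sqrt (v i) \<le> \<beta> i * 2" using v0 \<beta>0 by (intro mult_mono) auto
    then have vsq: "(v i)\<^sup>2 \<le> 2 * \<beta> i" using v0[of i] by (simp add: power2_eq_square mult.assoc)
    have "x\<^sup>2 / 2 = t ^ 4 / 8 * (v i)\<^sup>2" by (simp add: x_def power_divide power_mult_distrib)
    also have "\<dots> \<le> t ^ 4 / 8 * (2 * \<beta> i)" by (intro mult_left_mono vsq) auto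
    finally have x2: "x\<^sup>2 / 2 \<le> t ^ 4 / 4 * \<beta> i" by (simp add: mult.commute)
    have "cmod (of_real (1 - x) - of_real (exp (- x))) \<le> t ^ 4 / 4 * \<beta> i"
      using ex x2 by (simp flip: of_real_diff) 
    then have "cmod (char (distr M borel (Y i)) t - of_real (exp (- x))) \<le> \<bar>t\<bar>^3 / 6 * \<beta> i + t ^ 4 / 4 * \<beta> i"
      using norm_triangle_le[OF add_mono[OF 1[folded x_def]]] by (metis (no_types, lifting) diff_add_cancel add_diff_eq)
    also have "\<dots> \<le> (\<bar>t\<bar> ^ 3 + t ^ 4) * \<beta> i"
      unfolding distrib_right using \<beta>0 by (intro add_mono mult_right_mono) auto
    finally show ?thesis by (simp add: x_def)
  qed
  have "char (distr M borel (\<lambda>w. \<Sum>i\<in>A. Y i w)) t = (\<Prod>i\<in>A. char (distr M borel (Y i)) t)"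
    by (rule char_distr_sum[OF indep])
  moreover have "complex_of_real (exp (- (t\<^sup>2) / 2 * (\<Sum>i\<in>A. v i))) = (\<Prod>i\<in>A. of_real (exp (- (t\<^sup>2) / 2 * v i)))"
    by (simp only: sum_distrib_left exp_sum[OF fin] of_real_prod)
  moreover have "cmod ((\<Prod>i\<in>A. char (distr M borel (Y i)) t) - (\<Prod>i\<in>A. complex_of_real (exp (- (t\<^sup>2) / 2 * v i))))
     \<le> (\<Sum>i\<in>A. cmod (char (distr M borel (Y i)) t - of_real (exp (- (t\<^sup>2) / 2 * v i))))"
    by (rule norm_prod_diff)
       (auto intro!: real_distribution.cmod_char_le_1 rv simp: v0)
  ultimately show ?thesis
    using order_trans[OF _ sum_mono[of A, OF each]]
    by (simp only: v_def[symmetric] \<beta>_def[symmetric] sum_distrib_left)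
next
  case False
  have "char (distr M borel (\<lambda>w. \<Sum>i\<in>A. Y i w)) t = 1"
    by (subst char_distr_sum[OF indep]) (simp add: False)
  then show ?thesis by (simp add: False)
qed

end

definition lyapunov_sum :: "real \<Rightarrow> 'a measure \<Rightarrow> ('i \<Rightarrow> 'a \<Rightarrow> real) \<Rightarrow> 'i set \<Rightarrow> bool" where
  "lyapunov_sum \<delta> M Y A \<longleftrightarrow> prob_space M \<and> finite A \<and> prob_space.indep_vars M (\<lambda>_. borel) Y A \<and>
     (\<forall>i\<in>A. integrable M (\<lambda>w. \<bar>Y i w\<bar> ^ 3) \<and> (\<integral>w. Y i w \<partial>M) = 0) \<and>
     \<bar>(\<Sum>i\<in>A. \<integral>w. (Y i w)\<^sup>2 \<partial>M) - 1\<bar> \<le> \<delta> \<and> (\<Sum>i\<in>A. \<integral>w. \<bar>Y i w\<bar> ^ 3 \<partial>M) \<le> \<delta>"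

text \<open>
  The central limit theorem in a form free of limits: \<open>\<delta>\<close> depends only on \<open>\<epsilon>\<close>, neither on the
  probability space nor on the number and the laws of the summands. It is applied to the data and, for
  each outcome of the data, to the bootstrap sample.
\<close>

lemma uniform_clt:
  fixes \<epsilon> :: real
  assumes "\<epsilon> > 0"
  obtains \<delta> where "\<delta> > 0"
    "\<And>(M :: 'a measure) (Y :: 'i \<Rightarrow> 'a \<Rightarrow> real) A x. lyapunov_sum \<delta> M Y A \<Longrightarrow>
      \<bar>measure M {w \<in> space M. (\<Sum>i\<in>A. Y i w) \<le> x} - Phi x\<bar> \<le> \<epsilon>"
proof -
  obtain \<eta> T :: real where T: "\<eta> > 0" "T > 0" and close:
    "\<And>\<mu> x. real_distribution \<mu> \<Longrightarrow>
       (\<And>t. \<bar>t\<bar> \<le> T \<Longrightarrow> cmod (char \<mu> t - of_real (exp (- (t\<^sup>2) / 2))) \<le> \<eta>) \<Longrightarrow>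
       \<bar>cdf \<mu> x - Phi x\<bar> \<le> \<epsilon>"
    using cdf_close_to_normal_if_char_close[OF assms] by blast
  \<comment> \<open>The bound \<open>3\<close> keeps all variances below \<open>4\<close>; the quotient makes the errors for \<open>\<bar>t\<bar> \<le> T\<close> at most \<open>\<eta>\<close>.\<close>
  define \<delta> where "\<delta> = min 3 (\<eta> / (T ^ 3 + T ^ 4 + T\<^sup>2))"
  have Tp: "T ^ 3 + T ^ 4 + T\<^sup>2 > 0" using T by (intro add_pos_pos) auto
  have \<delta>: "\<delta> > 0" "\<delta> \<le> 3" "(T ^ 3 + T ^ 4 + T\<^sup>2) * \<delta> \<le> \<eta>"
    using T Tp pos_le_divide_eq[OF Tp, of \<delta> \<eta>] unfolding \<delta>_def by (auto simp: mult.commute)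
  show ?thesis
  proof (rule that[OF \<delta>(1)])
    fix M :: "'a measure" and Y :: "'i \<Rightarrow> 'a \<Rightarrow> real" and A x
    assume "lyapunov_sum \<delta> M Y A"
    then have "prob_space M" and indep: "prob_space.indep_vars M (\<lambda>_. borel) Y A" and fin: "finite A"
      and int: "\<And>i. i \<in> A \<Longrightarrow> integrable M (\<lambda>w. \<bar>Y i w\<bar> ^ 3)"
      and mean: "\<And>i. i \<in> A \<Longrightarrow> (\<integral>w. Y i w \<partial>M) = 0"
      and v1: "\<bar>(\<Sum>i\<in>A. \<integral>w. (Y i w)\<^sup>2 \<partial>M) - 1\<bar> \<le> \<delta>"
      and \<beta>1: "(\<Sum>i\<in>A. \<integral>w. \<bar>Y i w\<bar> ^ 3 \<partial>M) \<le> \<delta>"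
      by (simp_all add: lyapunov_sum_def)
    interpret prob_space M by fact
    define v where "v = (\<Sum>i\<in>A. \<integral>w. (Y i w)\<^sup>2 \<partial>M)"
    have rv: "Y i \<in> borel_measurable M" if "i \<in> A" for i
      using indep that unfolding indep_vars_def by auto
    then have [measurable]: "(\<lambda>w. \<Sum>i\<in>A. Y i w) \<in> borel_measurable M" by simp
    have var: "(\<integral>w. (Y i w)\<^sup>2 \<partial>M) \<le> 4" if "i \<in> A" for i
    proof -
      have "(\<integral>w. (Y i w)\<^sup>2 \<partial>M) \<le> v"
        unfolding v_def using fin that by (intro member_le_sum) auto
      then show ?thesis using v1 \<delta>(2) unfolding v_def by linarith
    qed
    have "\<bar>cdf (distr M borel (\<lambda>w. \<Sum>i\<in>A. Y i w)) x - Phi x\<bar> \<le> \<epsilon>"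
    proof (rule close)
      fix t :: real assume t: "\<bar>t\<bar> \<le> T"
      let ?c = "char (distr M borel (\<lambda>w. \<Sum>i\<in>A. Y i w)) t"
      have "v \<ge> 0" by (simp add: v_def sum_nonneg)
      have "\<bar>exp (- (t\<^sup>2) / 2 * v) - exp (- (t\<^sup>2) / 2)\<bar> \<le> \<bar>- (t\<^sup>2) / 2 * v - - (t\<^sup>2) / 2\<bar>"
      proof -
        have lip: "\<bar>exp a - exp b\<bar> \<le> \<bar>a - b\<bar>" if "a \<le> 0" "b \<le> 0" for a b :: real
        proof -
          have *: "exp a - exp b \<le> a - b" if "b \<le> a" "a \<le> 0" for a b :: real
          proof -
            have "exp a * (1 + (b - a)) \<le> exp a * exp (b - a)"
              by (intro mult_left_mono exp_ge_add_one_self) auto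
            then have "exp a - exp b \<le> exp a * (a - b)" by (simp add: algebra_simps flip: exp_add)
            also have "\<dots> \<le> 1 * (a - b)" using that by (intro mult_right_mono) auto
            finally show ?thesis by simp
          qed
          show ?thesis
            using *[of a b] *[of b a] that by (cases "b \<le> a") (auto simp: abs_if)
        qed
        then show ?thesis using \<open>v \<ge> 0\<close> by (intro lip) (auto simp: mult_nonpos_nonneg)
      qed
      also have "\<dots> = t\<^sup>2 / 2 * \<bar>v - 1\<bar>"
      proof -
        have "- (t\<^sup>2) / 2 * v - - (t\<^sup>2) / 2 = - (t\<^sup>2 / 2 * (v - 1))" by (simp add: field_simps)
        then show ?thesis by (simp only: abs_minus_cancel abs_mult) simp
      qed
      also have "\<dots> \<le> T\<^sup>2 * \<delta>"
        proof (intro mult_mono)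
        have "t\<^sup>2 \<le> T\<^sup>2" using power_mono[OF t, of 2] by simp
        then show "t\<^sup>2 / 2 \<le> T\<^sup>2" using zero_le_power2[of t] by linarith
      qed (use v1 in \<open>auto simp: v_def\<close>)
      finally have 2: "cmod (of_real (exp (- (t\<^sup>2) / 2 * v)) - of_real (exp (- (t\<^sup>2) / 2))) \<le> T\<^sup>2 * \<delta>"
        by (simp flip: of_real_diff)
      have "cmod (?c - of_real (exp (- (t\<^sup>2) / 2 * v))) \<le> (\<bar>t\<bar> ^ 3 + t ^ 4) * (\<Sum>i\<in>A. \<integral>w. \<bar>Y i w\<bar> ^ 3 \<partial>M)"
        unfolding v_def by (rule char_sum_near_gaussian[OF indep int mean var])
      also have "\<dots> \<le> (T ^ 3 + T ^ 4) * \<delta>"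
        using \<beta>1 t power_mono[OF t, of 3] power_mono[OF t, of 4] T \<delta>(1)
        by (intro mult_mono add_mono) (auto intro!: sum_nonneg)
      finally have 1: "cmod (?c - of_real (exp (- (t\<^sup>2) / 2 * v))) \<le> (T ^ 3 + T ^ 4) * \<delta>" .
      have "cmod (?c - of_real (exp (- (t\<^sup>2) / 2))) \<le> (T ^ 3 + T ^ 4) * \<delta> + T\<^sup>2 * \<delta>"
        using norm_triangle_le[OF add_mono[OF 1 2]] by simp
      then show "cmod (?c - of_real (exp (- (t\<^sup>2) / 2))) \<le> \<eta>"
        using \<delta>(3) by (simp add: distrib_right)
    qed simp
    moreover have "cdf (distr M borel (\<lambda>w. \<Sum>i\<in>A. Y i w)) x = measure M {w \<in> space M. (\<Sum>i\<in>A. Y i w) \<le> x}"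
      unfolding cdf_def by (subst measure_distr) (auto intro!: arg_cong[where f="measure M"])
    ultimately show "\<bar>measure M {w \<in> space M. (\<Sum>i\<in>A. Y i w) \<le> x} - Phi x\<bar> \<le> \<epsilon>"
      by simp
  qed
qed

section \<open>Moments of sums\<close>

text \<open>
  Jensen's inequality for the cube, homogeneous in the weights: the tangent of the cube at the
  weighted mean \<open>s\<close> lies below the cube on the nonnegative half-line.
\<close>

lemma weighted_power_mean_3:
  fixes w x :: "'i \<Rightarrow> real"
  assumes w: "\<And>i. i \<in> A \<Longrightarrow> w i \<ge> 0" and x: "\<And>i. i \<in> A \<Longrightarrow> x i \<ge> 0"
  shows "(\<Sum>i\<in>A. w i * x i) ^ 3 \<le> (\<Sum>i\<in>A. w i)\<^sup>2 * (\<Sum>i\<in>A. w i * x i ^ 3)"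
proof -
  define S T where "S = (\<Sum>i\<in>A. w i)" and "T = (\<Sum>i\<in>A. w i * x i)"
  have S0: "S \<ge> 0" "T \<ge> 0" unfolding S_def T_def by (auto intro!: sum_nonneg mult_nonneg_nonneg w x)
  show ?thesis
  proof (cases "S = 0")
    case True
    have "w i * x i = 0" if "finite A" "i \<in> A" for i
      using sum_nonneg_eq_0_iff[of A w] True w that unfolding S_def by auto
    then have "T = 0" unfolding T_def by (cases "finite A") (auto intro!: sum.neutral)
    then show ?thesis
      using S0 by (auto simp: T_def[symmetric] S_def[symmetric] intro!: mult_nonneg_nonneg sum_nonneg w x)
  next
    case False
    define s where "s = T / S"
    have s: "s \<ge> 0" "S * s = T" using S0 False by (auto simp: s_def)
    have "w i * (s ^ 3 + 3 * s\<^sup>2 * (x i - s)) \<le> w i * x i ^ 3" if "i \<in> A" for i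
    proof (intro mult_left_mono w that)
      have "0 \<le> (x i - s)\<^sup>2 * (x i + 2 * s)" using x[OF that] s by simp
      also have "\<dots> = x i ^ 3 - (s ^ 3 + 3 * s\<^sup>2 * (x i - s))" by algebra
      finally show "s ^ 3 + 3 * s\<^sup>2 * (x i - s) \<le> x i ^ 3" by simp
    qed
    then have "(\<Sum>i\<in>A. w i * (s ^ 3 + 3 * s\<^sup>2 * (x i - s))) \<le> (\<Sum>i\<in>A. w i * x i ^ 3)"
      by (rule sum_mono)
    also have "(\<Sum>i\<in>A. w i * (s ^ 3 + 3 * s\<^sup>2 * (x i - s)))
        = (\<Sum>i\<in>A. w i * (s ^ 3 - 3 * s ^ 3) + (w i * x i) * (3 * s\<^sup>2))"
      by (intro sum.cong refl) algebra
    also have "\<dots> = S * (s ^ 3 - 3 * s ^ 3) + T * (3 * s\<^sup>2)"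
      by (simp only: S_def T_def sum.distrib sum_distrib_right)
    also have "\<dots> = S * s ^ 3"
      unfolding s(2)[symmetric] by algebra
    finally have "S\<^sup>2 * (S * s ^ 3) \<le> S\<^sup>2 * (\<Sum>i\<in>A. w i * x i ^ 3)" by (intro mult_left_mono) auto
    moreover have "S\<^sup>2 * (S * s ^ 3) = T ^ 3" unfolding s(2)[symmetric] by algebra
    ultimately show ?thesis by (simp add: S_def T_def)
  qed
qed

context prob_space
begin

lemma expectation_abs_le_sqrt:
  fixes X :: "'a \<Rightarrow> real"
  assumes [measurable]: "X \<in> borel_measurable M" and int: "integrable M (\<lambda>w. (X w)\<^sup>2)"
  shows "expectation (\<lambda>w. \<bar>X w\<bar>) \<le> sqrt (expectation (\<lambda>w. (X w)\<^sup>2))"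
proof -
  have i1: "integrable M X" using square_integrable_imp_integrable[OF assms] .
  define c where "c = expectation (\<lambda>w. \<bar>X w\<bar>)"
  have "0 \<le> expectation (\<lambda>w. (\<bar>X w\<bar> - c)\<^sup>2)" by simp
  also have "\<dots> = expectation (\<lambda>w. (X w)\<^sup>2 - 2 * c * \<bar>X w\<bar> + c\<^sup>2)"
    by (simp add: power2_diff algebra_simps)
  also have "\<dots> = expectation (\<lambda>w. (X w)\<^sup>2) - c\<^sup>2"
    using int i1 by (simp add: c_def[symmetric] prob_space power2_eq_square)
  finally show ?thesis unfolding c_def[symmetric] by (intro real_le_rsqrt) simp
qed

lemma product_of_square_integrable:
  fixes Y Y' :: "'a \<Rightarrow> real"
  assumes [measurable]: "Y \<in> borel_measurable M" "Y' \<in> borel_measurable M"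
    and "integrable M (\<lambda>w. (Y w)\<^sup>2)" "integrable M (\<lambda>w. (Y' w)\<^sup>2)"
  shows "integrable M (\<lambda>w. Y w * Y' w)"
    and "\<bar>expectation (\<lambda>w. Y w * Y' w)\<bar> \<le> (expectation (\<lambda>w. (Y w)\<^sup>2) + expectation (\<lambda>w. (Y' w)\<^sup>2)) / 2"
proof -
  have bnd: "\<bar>Y w * Y' w\<bar> \<le> ((Y w)\<^sup>2 + (Y' w)\<^sup>2) / 2" for w
    using sum_squares_bound[of "\<bar>Y w\<bar>" "\<bar>Y' w\<bar>"] by (simp add: abs_mult)
  have i: "integrable M (\<lambda>w. ((Y w)\<^sup>2 + (Y' w)\<^sup>2) / 2)" using assms by simp
  show int: "integrable M (\<lambda>w. Y w * Y' w)"
    by (rule Bochner_Integration.integrable_bound[OF i]) (use bnd in auto)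
  have "\<bar>expectation (\<lambda>w. Y w * Y' w)\<bar> \<le> expectation (\<lambda>w. \<bar>Y w * Y' w\<bar>)" by (rule integral_abs_bound)
  also have "\<dots> \<le> expectation (\<lambda>w. ((Y w)\<^sup>2 + (Y' w)\<^sup>2) / 2)"
    using int i bnd by (intro integral_mono) auto
  also have "\<dots> = (expectation (\<lambda>w. (Y w)\<^sup>2) + expectation (\<lambda>w. (Y' w)\<^sup>2)) / 2"
    using assms by simp
  finally show "\<bar>expectation (\<lambda>w. Y w * Y' w)\<bar> \<le> (expectation (\<lambda>w. (Y w)\<^sup>2) + expectation (\<lambda>w. (Y' w)\<^sup>2)) / 2" .
qed

lemma expectation_square_sum_indep:
  fixes Y :: "'i \<Rightarrow> 'a \<Rightarrow> real"
  assumes "finite A" and "indep_vars (\<lambda>_. borel) Y A"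
    and "\<And>i. i \<in> A \<Longrightarrow> integrable M (\<lambda>w. (Y i w)\<^sup>2)"
    and "\<And>i. i \<in> A \<Longrightarrow> expectation (Y i) = 0"
  shows "integrable M (\<lambda>w. (\<Sum>i\<in>A. Y i w)\<^sup>2)"
    and "expectation (\<lambda>w. (\<Sum>i\<in>A. Y i w)\<^sup>2) = (\<Sum>i\<in>A. expectation (\<lambda>w. (Y i w)\<^sup>2))"
proof -
  have "integrable M (\<lambda>w. (\<Sum>i\<in>A. Y i w)\<^sup>2) \<and>
     expectation (\<lambda>w. (\<Sum>i\<in>A. Y i w)\<^sup>2) = (\<Sum>i\<in>A. expectation (\<lambda>w. (Y i w)\<^sup>2))"
    using assms
  proof (induction A rule: finite_induct)
    case (insert a A)
    have rv: "Y i \<in> borel_measurable M" if "i \<in> insert a A" for i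
      using insert.prems(1) that unfolding indep_vars_def by auto
    have int1: "integrable M (Y i)" if "i \<in> insert a A" for i
      using square_integrable_imp_integrable[OF rv[OF that] insert.prems(2)[OF that]] .
    have IH: "integrable M (\<lambda>w. (\<Sum>i\<in>A. Y i w)\<^sup>2)"
     "expectation (\<lambda>w. (\<Sum>i\<in>A. Y i w)\<^sup>2) = (\<Sum>i\<in>A. expectation (\<lambda>w. (Y i w)\<^sup>2))"
      using insert.IH insert.prems indep_vars_subset[OF insert.prems(1), of A] by auto
    have ind: "indep_var borel (Y a) borel (\<lambda>w. \<Sum>i\<in>A. Y i w)"
      by (rule indep_vars_sum[OF insert.hyps insert.prems(1)])
    have intS: "integrable M (\<lambda>w. \<Sum>i\<in>A. Y i w)" using int1 by auto
    have inta: "integrable M (Y a)" using int1 by simp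
    note p = indep_var_integrable[OF ind inta intS] indep_var_lebesgue_integral[OF ind inta intS]
    have eq: "(\<Sum>i\<in>insert a A. Y i w)\<^sup>2 = (Y a w)\<^sup>2 + 2 * (Y a w * (\<Sum>i\<in>A. Y i w)) + (\<Sum>i\<in>A. Y i w)\<^sup>2" for w
      using insert.hyps by (simp add: power2_sum)
    show ?case
      unfolding eq using p IH insert.prems insert.hyps by auto
  qed simp
  then show "integrable M (\<lambda>w. (\<Sum>i\<in>A. Y i w)\<^sup>2)"
    "expectation (\<lambda>w. (\<Sum>i\<in>A. Y i w)\<^sup>2) = (\<Sum>i\<in>A. expectation (\<lambda>w. (Y i w)\<^sup>2))" by auto
qed

text \<open>
  A weak law of large numbers for the squares under third moments only. The squares themselves need
  not have a variance, so they are truncated at \<open>1\<close>: the truncated squares have variances at most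
  \<open>E \<bar>Y\<bar>\<^sup>3\<close>, and what the truncation removes has expectation at most \<open>E \<bar>Y\<bar>\<^sup>3\<close>.
\<close>

lemma sum_squares_concentration:
  fixes Y :: "'i \<Rightarrow> 'a \<Rightarrow> real"
  assumes fin: "finite A" and indep: "indep_vars (\<lambda>_. borel) Y A"
    and int: "\<And>i. i \<in> A \<Longrightarrow> integrable M (\<lambda>w. \<bar>Y i w\<bar> ^ 3)"
  defines "\<beta> \<equiv> \<Sum>i\<in>A. expectation (\<lambda>w. \<bar>Y i w\<bar> ^ 3)"
  shows "expectation (\<lambda>w. \<bar>(\<Sum>i\<in>A. (Y i w)\<^sup>2) - (\<Sum>i\<in>A. expectation (\<lambda>w. (Y i w)\<^sup>2))\<bar>) \<le> 2 * \<beta> + sqrt \<beta>"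
proof -
  have rv: "Y i \<in> borel_measurable M" if "i \<in> A" for i
    using indep that unfolding indep_vars_def by auto
  note i2 = abs_power_integrable_mono(1)[OF rv int, of _ 2, simplified]
  define \<zeta> where "\<zeta> i w = min ((Y i w)\<^sup>2) 1" for i w
  define e where "e i = expectation (\<zeta> i)" for i
  let ?R = "\<lambda>w. \<Sum>i\<in>A. (Y i w)\<^sup>2 - \<zeta> i w" and ?D = "\<lambda>w. \<Sum>i\<in>A. \<zeta> i w - e i"
    and ?X = "\<lambda>w. \<bar>(\<Sum>i\<in>A. (Y i w)\<^sup>2) - (\<Sum>i\<in>A. expectation (\<lambda>w. (Y i w)\<^sup>2))\<bar>"
  have \<zeta>rv [measurable]: "\<zeta> i \<in> borel_measurable M" if "i \<in> A" for i
    unfolding \<zeta>_def using rv[OF that] by measurable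
  have \<zeta>01: "0 \<le> \<zeta> i w" "\<zeta> i w \<le> 1" for i w by (auto simp: \<zeta>_def)
  have \<zeta>int: "integrable M (\<zeta> i)" if "i \<in> A" for i
    by (rule integrable_const_bound[of _ 1]) (auto simp: \<zeta>01 \<zeta>rv that)
  have \<zeta>int2: "integrable M (\<lambda>w. (\<zeta> i w)\<^sup>2)" if "i \<in> A" for i
    by (rule integrable_const_bound[of _ 1]) (use \<zeta>01 in \<open>auto simp: \<zeta>rv that power_le_one\<close>)
  have cube: "(\<zeta> i w)\<^sup>2 \<le> \<bar>Y i w\<bar> ^ 3" "0 \<le> (Y i w)\<^sup>2 - \<zeta> i w" "(Y i w)\<^sup>2 - \<zeta> i w \<le> \<bar>Y i w\<bar> ^ 3" for i w
  proof -
    define y where "y = \<bar>Y i w\<bar>"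
    have y: "y \<ge> 0" "(Y i w)\<^sup>2 = y\<^sup>2" by (auto simp: y_def)
    have "(min (y\<^sup>2) 1)\<^sup>2 \<le> y ^ 3 \<and> y\<^sup>2 - min (y\<^sup>2) 1 \<le> y ^ 3"
    proof (cases "y \<le> 1")
      case True
      then have "y\<^sup>2 \<le> 1" using y by (simp add: power_le_one)
      moreover have "(y\<^sup>2)\<^sup>2 \<le> y ^ 3"
        using power_decreasing[of 3 4 y] True y by simp
      ultimately show ?thesis using y by (simp add: min_def)
    next
      case False
      then have "1 \<le> y\<^sup>2" "1 \<le> y ^ 3" "y\<^sup>2 \<le> y ^ 3"
        using one_le_power[of y 2] one_le_power[of y 3] power_increasing[of 2 3 y] by auto
      then have "min (y\<^sup>2) 1 = 1" by linarith
      then show ?thesis using \<open>1 \<le> y ^ 3\<close> \<open>y\<^sup>2 \<le> y ^ 3\<close> by simp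
    qed
    then show "(\<zeta> i w)\<^sup>2 \<le> \<bar>Y i w\<bar> ^ 3" "0 \<le> (Y i w)\<^sup>2 - \<zeta> i w" "(Y i w)\<^sup>2 - \<zeta> i w \<le> \<bar>Y i w\<bar> ^ 3"
      unfolding \<zeta>_def y(2) by (auto simp: y_def)
  qed
  have ind\<zeta>: "indep_vars (\<lambda>_. borel) (\<lambda>i w. \<zeta> i w - e i) A"
    using indep_vars_compose2[OF indep, of "\<lambda>i y. min (y\<^sup>2) 1 - e i" "\<lambda>_. borel"]
    unfolding \<zeta>_def by (auto intro: borel_measurable_diff borel_measurable_min)
  have c2: "integrable M (\<lambda>w. (\<zeta> i w - e i)\<^sup>2)" "expectation (\<lambda>w. (\<zeta> i w - e i)\<^sup>2) \<le> expectation (\<lambda>w. \<bar>Y i w\<bar> ^ 3)"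
    if "i \<in> A" for i
  proof -
    note [simp] = \<zeta>int[OF that] \<zeta>int2[OF that]
    have eq: "(\<zeta> i w - e i)\<^sup>2 = (\<zeta> i w)\<^sup>2 - 2 * e i * \<zeta> i w + (e i)\<^sup>2" for w
      by (simp add: power2_diff algebra_simps)
    show "integrable M (\<lambda>w. (\<zeta> i w - e i)\<^sup>2)" unfolding eq by simp
    have "expectation (\<lambda>w. (\<zeta> i w - e i)\<^sup>2) = expectation (\<lambda>w. (\<zeta> i w)\<^sup>2) - (e i)\<^sup>2"
      unfolding eq by (simp add: e_def[symmetric] prob_space) (simp add: power2_eq_square)
    also have "\<dots> \<le> expectation (\<lambda>w. (\<zeta> i w)\<^sup>2)" by simp
    also have "\<dots> \<le> expectation (\<lambda>w. \<bar>Y i w\<bar> ^ 3)" by (intro integral_mono cube int that) simp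
    finally show "expectation (\<lambda>w. (\<zeta> i w - e i)\<^sup>2) \<le> expectation (\<lambda>w. \<bar>Y i w\<bar> ^ 3)" .
  qed
  have c0: "expectation (\<lambda>w. \<zeta> i w - e i) = 0" if "i \<in> A" for i
    using \<zeta>int[OF that] by (simp add: e_def prob_space)
  have sq: "integrable M (\<lambda>w. (?D w)\<^sup>2)"
    "expectation (\<lambda>w. (?D w)\<^sup>2) = (\<Sum>i\<in>A. expectation (\<lambda>w. (\<zeta> i w - e i)\<^sup>2))"
    by (intro expectation_square_sum_indep[OF fin ind\<zeta>] c2(1) c0; assumption)+
  have mS: "?D \<in> borel_measurable M" using \<zeta>rv by measurable
  have dev: "expectation (\<lambda>w. \<bar>?D w\<bar>) \<le> sqrt \<beta>"
  proof -
    have "expectation (\<lambda>w. \<bar>?D w\<bar>) \<le> sqrt (expectation (\<lambda>w. (?D w)\<^sup>2))"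
      by (rule expectation_abs_le_sqrt[OF mS sq(1)])
    also have "\<dots> \<le> sqrt \<beta>" unfolding sq(2) \<beta>_def by (intro real_sqrt_le_mono sum_mono c2)
    finally show ?thesis .
  qed
  have rest: "integrable M ?R"
    "expectation ?R \<le> \<beta>"
    "expectation ?R = (\<Sum>i\<in>A. expectation (\<lambda>w. (Y i w)\<^sup>2)) - (\<Sum>i\<in>A. e i)"
  proof -
    show i: "integrable M ?R" using i2 \<zeta>int by auto
    have "expectation ?R \<le> expectation (\<lambda>w. \<Sum>i\<in>A. \<bar>Y i w\<bar> ^ 3)"
      using i int by (intro integral_mono sum_mono cube) auto
    also have "\<dots> = \<beta>" unfolding \<beta>_def using int by (intro Bochner_Integration.integral_sum) auto
    finally show "expectation ?R \<le> \<beta>" .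
    have "expectation ?R = (\<Sum>i\<in>A. expectation (\<lambda>w. (Y i w)\<^sup>2 - \<zeta> i w))"
      using i2 \<zeta>int by (intro Bochner_Integration.integral_sum) auto
    also have "\<dots> = (\<Sum>i\<in>A. expectation (\<lambda>w. (Y i w)\<^sup>2) - e i)"
      using i2 \<zeta>int by (intro sum.cong refl) (auto simp: e_def)
    finally show "expectation ?R = (\<Sum>i\<in>A. expectation (\<lambda>w. (Y i w)\<^sup>2)) - (\<Sum>i\<in>A. e i)"
      by (simp add: sum_subtractf)
  qed
  have R0: "?R w \<ge> 0" for w by (intro sum_nonneg cube)
  have D1: "integrable M ?D" using \<zeta>int by auto
  have "expectation ?X
      \<le> expectation (\<lambda>w. ?R w + \<bar>?D w\<bar> + \<beta>)"
  proof (rule integral_mono)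
    show "integrable M ?X"
      using i2 by auto
    show "integrable M (\<lambda>w. ?R w + \<bar>?D w\<bar> + \<beta>)"
      using rest(1) D1 by auto
    fix w
    have "(\<Sum>i\<in>A. (Y i w)\<^sup>2) = ?R w + ?D w + (\<Sum>i\<in>A. e i)"
      by (simp add: sum_subtractf)
    moreover have "expectation ?R \<ge> 0" by (rule Bochner_Integration.integral_nonneg) (rule R0)
    ultimately show "\<bar>(\<Sum>i\<in>A. (Y i w)\<^sup>2) - (\<Sum>i\<in>A. expectation (\<lambda>w. (Y i w)\<^sup>2))\<bar> \<le> ?R w + \<bar>?D w\<bar> + \<beta>"
      using rest(2,3) R0[of w] by linarith
  qed
  also have "\<dots> = expectation ?R + expectation (\<lambda>w. \<bar>?D w\<bar>) + \<beta>"
    using rest(1) D1 by (simp add: prob_space)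
  also have "\<dots> \<le> 2 * \<beta> + sqrt \<beta>" using rest(2) dev by linarith
  finally show ?thesis .
qed

lemma markov_abs:
  fixes X :: "'a \<Rightarrow> real"
  assumes int: "integrable M X" and "c > 0"
  shows "prob {w \<in> space M. \<bar>X w\<bar> > c} \<le> expectation (\<lambda>w. \<bar>X w\<bar>) / c"
proof -
  have "prob {w \<in> space M. \<bar>X w\<bar> > c} \<le> prob {w \<in> space M. \<bar>X w\<bar> \<ge> c}"
    using int by (intro finite_measure_mono) auto
  also have "\<dots> \<le> expectation (\<lambda>w. \<bar>X w\<bar>) / c"
    using int \<open>c > 0\<close> by (intro integral_Markov_inequality_measure[of _ _ "{}"]) auto
  finally show ?thesis .
qed

end

section \<open>Suprema of differences of distribution functions\<close>

text \<open>
  By right continuity the supremum may be taken over the rationals.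
\<close>

lemma borel_measurable_SUP_right_continuous:
  fixes D :: "'a \<Rightarrow> real \<Rightarrow> real"
  assumes meas: "\<And>t. (\<lambda>w. D w t) \<in> borel_measurable M"
    and cont: "\<And>w t. continuous (at_right t) (D w)"
    and bd: "\<And>w t. \<bar>D w t\<bar> \<le> B"
  shows "(\<lambda>w. SUP t. D w t) \<in> borel_measurable M"
proof -
  have bdd: "bdd_above (D w ` S)" for w S
    using bd by (intro bdd_aboveI2[where M = B]) (auto simp: abs_le_iff)
  have "(SUP t. D w t) = (SUP q\<in>\<rat>. D w q)" for w
  proof (rule antisym)
    show "(SUP t. D w t) \<le> (SUP q\<in>\<rat>. D w q)"
    proof (rule cSUP_least)
      fix t
      show "D w t \<le> (SUP q\<in>\<rat>. D w q)"
      proof (rule field_le_epsilon)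
        fix e :: real assume "e > 0"
        have "(D w \<longlongrightarrow> D w t) (at_right t)" using cont[where w=w and t=t] by (simp add: continuous_within)
        then have "\<forall>\<^sub>F q in at_right t. D w q > D w t - e"
          by (rule order_tendstoD) (use \<open>e > 0\<close> in simp)
        then obtain b where b: "b > t" "\<And>q. t < q \<Longrightarrow> q < b \<Longrightarrow> D w q > D w t - e"
          unfolding eventually_at_right_field by blast
        obtain q where "q \<in> \<rat>" "t < q" "q < b" using Rats_dense_in_real[OF b(1)] by blast
        then have "D w t - e < D w q" "D w q \<le> (SUP q\<in>\<rat>. D w q)"
          using b(2) by (auto intro!: cSUP_upper bdd)
        then show "D w t \<le> (SUP q\<in>\<rat>. D w q) + e" by linarith
      qed
    qed simp
    show "(SUP q\<in>\<rat>. D w q) \<le> (SUP t. D w t)"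
      by (rule cSUP_subset_mono[OF _ bdd]) (use Rats_0 in auto)
  qed
  then show ?thesis
    by (simp only:) (intro borel_measurable_cSUP meas bdd countable_rat)
qed

lemma (in prob_space) tail_right_continuous:
  fixes T :: "'a \<Rightarrow> real"
  assumes [measurable]: "T \<in> borel_measurable M"
  shows "continuous (at_right t) (\<lambda>t. prob {w \<in> space M. T w \<le> t})"
proof -
  interpret d: real_distribution "distr M borel T" by simp
  have "prob {w \<in> space M. T w \<le> t} = cdf (distr M borel T) t" for t
    unfolding cdf_def by (subst measure_distr) (auto intro!: arg_cong[where f=prob])
  then show ?thesis using d.cdf_is_right_cont by simp
qed

section \<open>The bootstrap distribution\<close>

abbreviation boot_sample :: "nat \<Rightarrow> (nat \<Rightarrow> real) \<Rightarrow> (nat \<Rightarrow> real) pmf" where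
  "boot_sample n z \<equiv> Pi_pmf {1..n} 0 (\<lambda>_. empirical_pmf n z)"

text \<open>
  The scale \<open>c\<close> is kept apart from the data \<open>z\<close>: the normal approximation is proved at the natural
  scale of the data, and \<open>c\<close> only rescales the argument \<open>t\<close>.
\<close>

definition boot_prob :: "nat \<Rightarrow> (nat \<Rightarrow> real) \<Rightarrow> real \<Rightarrow> real \<Rightarrow> real" where
  "boot_prob n z c t =
     measure_pmf.prob (boot_sample n z)
       {y. (\<Sum>i=1..n. y i / c) - (\<Sum>i=1..n. z i / c) \<le> t}"

lemma boot_cdf_eq_boot_prob:
  "boot_cdf m n P N X a h w t =
     boot_prob n (\<lambda>j. hajek m n P N X a h j (X j w)) (real n * ustat_sd m n P X a h) t"
  by (simp add: boot_cdf_def boot_prob_def scaled_hajek_def)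

lemma boot_prob_le_1: "0 \<le> boot_prob n z c t" "boot_prob n z c t \<le> 1"
  by (auto simp: boot_prob_def)

lemma boot_prob_right_continuous: "continuous (at_right t) (boot_prob n z c)"
proof -
  let ?Q = "boot_sample n z"
  have "continuous (at_right t) (\<lambda>t. measure_pmf.prob ?Q
      {y \<in> space (measure_pmf ?Q). (\<Sum>i=1..n. y i / c) - (\<Sum>i=1..n. z i / c) \<le> t})"
    by (rule prob_space.tail_right_continuous) (auto intro: measure_pmf.prob_space_axioms)
  then show ?thesis by (simp add: boot_prob_def[abs_def])
qed

text \<open>
  Drawing values from the empirical distribution is drawing indices uniformly, with replacement.
  In this form the law of the resampled indices no longer depends on the data, so that the
  conditional probability is a finite sum of measurable functions of the data.
\<close>

lemma boot_prob_eq_resampled_indices: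
  "boot_prob n z c t = measure_pmf.prob (Pi_pmf {1..n} 0 (\<lambda>_. pmf_of_set {1..n}))
     {g. (\<Sum>i=1..n. z (g i) / c) - (\<Sum>i=1..n. z i / c) \<le> t}"
proof (cases "n = 0")
  case True
  then show ?thesis by (simp add: boot_prob_def)
next
  case False
  let ?Q = "Pi_pmf {1..n} 0 (\<lambda>_. pmf_of_set {1..n})"
  let ?B = "\<lambda>f. {g. (\<Sum>i=1..n. f (g i) / c) - (\<Sum>i=1..n. z i / c) \<le> t}"
  have sQ: "g i \<in> {1..n}" if "g \<in> set_pmf ?Q" "i \<in> {1..n}" for g i
    using that set_Pi_pmf_subset'[of "{1..n}" 0 "\<lambda>_. pmf_of_set {1..n}"] False
    by (auto simp: PiE_dflt_def o_def set_pmf_of_set)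
  \<comment> \<open>The index \<open>0\<close> is never drawn; the function is changed there to fit the default value.\<close>
  have "empirical_pmf n z = map_pmf (z(0 := 0)) (pmf_of_set {1..n})"
    unfolding empirical_pmf_def using False by (intro map_pmf_cong) (auto simp: set_pmf_of_set)
  then have "boot_sample n z = map_pmf (\<lambda>g. z(0 := 0) \<circ> g) ?Q"
    by (simp add: Pi_pmf_map[where dflt = 0])
  then have "boot_prob n z c t
      = measure_pmf.prob ?Q (?B (z(0 := 0)))"
    by (simp add: boot_prob_def vimage_def)
  also have "\<dots> = measure_pmf.prob ?Q (?B z)"
  proof (rule measure_pmf.finite_measure_eq_AE)
    show "AE g in ?Q. (g \<in> (?B (z(0 := 0))))
        = (g \<in> (?B z))"
    proof (intro AE_pmfI)
      fix g assume "g \<in> set_pmf ?Q"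
      then have "(\<Sum>i=1..n. (z(0 := 0)) (g i) / c) = (\<Sum>i=1..n. z (g i) / c)"
        using sQ[of g] by (intro sum.cong refl) force
      then show "(g \<in> (?B (z(0 := 0))))
        = (g \<in> (?B z))" by simp
    qed
  qed auto
  finally show ?thesis .
qed

lemma borel_measurable_boot_prob:
  assumes z: "\<And>j. j \<in> {1..n} \<Longrightarrow> (\<lambda>w. z j w) \<in> borel_measurable M"
  shows "(\<lambda>w. boot_prob n (\<lambda>j. z j w) c t) \<in> borel_measurable M"
proof (cases "n = 0")
  case True
  then show ?thesis by (simp add: boot_prob_def)
next
  case False
  let ?Q = "Pi_pmf {1..n} 0 (\<lambda>_. pmf_of_set {1..n})"
  have sub: "set_pmf ?Q \<subseteq> PiE_dflt {1..n} 0 (\<lambda>_. {1..n})"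
    using set_Pi_pmf_subset'[of "{1..n}" 0 "\<lambda>_. pmf_of_set {1..n}"] False
    by (simp add: o_def set_pmf_of_set)
  then have fin: "finite (set_pmf ?Q)" by (rule finite_subset) (auto intro: finite_PiE_dflt)
  have "boot_prob n (\<lambda>j. z j w) c t = (\<Sum>g\<in>set_pmf ?Q.
      if (\<Sum>i=1..n. z (g i) w / c) - (\<Sum>i=1..n. z i w / c) \<le> t then pmf ?Q g else 0)" for w
  proof -
    let ?S = "{g. (\<Sum>i=1..n. z (g i) w / c) - (\<Sum>i=1..n. z i w / c) \<le> t}"
    have "boot_prob n (\<lambda>j. z j w) c t = measure_pmf.prob ?Q (?S \<inter> set_pmf ?Q)"
      by (simp only: boot_prob_eq_resampled_indices measure_Int_set_pmf)
    also have "\<dots> = (\<Sum>g\<in>?S \<inter> set_pmf ?Q. pmf ?Q g)"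
      using fin by (intro measure_measure_pmf_finite) auto
    also have "\<dots> = (\<Sum>g\<in>set_pmf ?Q. if g \<in> ?S then pmf ?Q g else 0)"
      using fin by (subst sum.inter_restrict[symmetric]) (auto simp: Int_commute)
    finally show ?thesis by simp
  qed
  moreover have "(\<lambda>w. \<Sum>g\<in>set_pmf ?Q.
      if (\<Sum>i=1..n. z (g i) w / c) - (\<Sum>i=1..n. z i w / c) \<le> t then pmf ?Q g else 0) \<in> borel_measurable M"
  proof (rule borel_measurable_sum)
    fix g assume "g \<in> set_pmf ?Q"
    then have "g i \<in> {1..n}" if "i \<in> {1..n}" for i using sub that by (auto simp: PiE_dflt_def)
    then have [measurable]: "(\<lambda>w. \<Sum>i=1..n. z (g i) w / c) \<in> borel_measurable M"
      "(\<lambda>w. \<Sum>i=1..n. z i w / c) \<in> borel_measurable M"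
      using z by (auto intro!: borel_measurable_sum borel_measurable_divide)
    show "(\<lambda>w. if (\<Sum>i=1..n. z (g i) w / c) - (\<Sum>i=1..n. z i w / c) \<le> t then pmf ?Q g else 0) \<in> borel_measurable M"
      by measurable
  qed
  ultimately show ?thesis by simp
qed

lemma expectation_empirical_sample:
  fixes f :: "real \<Rightarrow> real"
  assumes "n > 0" "i \<in> {1..n}"
  shows "(\<integral>y. f (y i) \<partial>boot_sample n z) = (\<Sum>j=1..n. f (z j)) / real n"
proof -
  let ?Q = "boot_sample n z"
  have "(\<integral>y. f (y i) \<partial>?Q) = (\<integral>x. f x \<partial>map_pmf (\<lambda>y. y i) ?Q)" by simp
  also have "map_pmf (\<lambda>y. y i) ?Q = empirical_pmf n z" using assms by (subst Pi_pmf_component) auto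
  also have "(\<integral>x. f x \<partial>empirical_pmf n z) = (\<Sum>j=1..n. f (z j)) / real n"
    using assms by (simp add: empirical_pmf_def integral_pmf_of_set)
  finally show ?thesis .
qed

lemma integrable_empirical_sample:
  fixes f :: "(nat \<Rightarrow> real) \<Rightarrow> real"
  assumes "n > 0"
  shows "integrable (boot_sample n z) f"
proof (rule integrable_measure_pmf_finite)
  have "finite (set_pmf (empirical_pmf n z))" using assms by (simp add: empirical_pmf_def)
  then show "finite (set_pmf (boot_sample n z))"
    by (intro finite_subset[OF set_Pi_pmf_subset'] finite_PiE_dflt) auto
qed

text \<open>
  The variance of a draw is the empirical variance of the data, so the summands
  \<open>y i / b - e\<close>, where \<open>e\<close> is the mean of the data divided by \<open>b\<close>, have total variance
  \<open>\<Sum>(z i / b)\<^sup>2 - (\<Sum>z i / b)\<^sup>2 / n\<close>; centring at the mean costs at most a factor \<open>8\<close> in the third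
  moments.
\<close>

lemma boot_prob_near_normal:
  fixes \<epsilon> :: real
  assumes "\<epsilon> > 0"
  obtains \<delta> where "\<delta> > 0"
    "\<And>n z b c t. 0 < n \<Longrightarrow> 0 < b \<Longrightarrow> 0 < c \<Longrightarrow> \<bar>(\<Sum>i=1..n. (z i / b)\<^sup>2) - 1\<bar> \<le> \<delta> \<Longrightarrow>
       (\<Sum>i=1..n. z i / b)\<^sup>2 / real n \<le> \<delta> \<Longrightarrow> (\<Sum>i=1..n. \<bar>z i / b\<bar> ^ 3) \<le> \<delta> \<Longrightarrow>
       \<bar>boot_prob n z c t - Phi (t * c / b)\<bar> \<le> \<epsilon>"
proof -
  obtain \<delta> where \<delta>: "\<delta> > 0" and clt:
    "\<And>(M :: (nat \<Rightarrow> real) measure) (Y :: nat \<Rightarrow> (nat \<Rightarrow> real) \<Rightarrow> real) A x. lyapunov_sum \<delta> M Y A \<Longrightarrow>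
      \<bar>measure M {w \<in> space M. (\<Sum>i\<in>A. Y i w) \<le> x} - Phi x\<bar> \<le> \<epsilon>"
    using uniform_clt[OF assms, where 'a = "nat \<Rightarrow> real" and 'i = nat] by blast
  show ?thesis
  proof (rule that[of "\<delta> / 8"])
    fix n :: nat and z :: "nat \<Rightarrow> real" and b c t :: real
    assume n: "0 < n" and b: "0 < b" and c: "0 < c"
      and sq: "\<bar>(\<Sum>i=1..n. (z i / b)\<^sup>2) - 1\<bar> \<le> \<delta> / 8" and lin: "(\<Sum>i=1..n. z i / b)\<^sup>2 / real n \<le> \<delta> / 8"
      and cub: "(\<Sum>i=1..n. \<bar>z i / b\<bar> ^ 3) \<le> \<delta> / 8"
    let ?Q = "boot_sample n z"
    define \<xi> where "\<xi> j = z j / b" for j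
    define e where "e = (\<Sum>j=1..n. \<xi> j) / real n"
    define Y where "Y i y = y i / b - e" for i and y :: "nat \<Rightarrow> real"
    have sum\<xi>: "(\<Sum>j=1..n. \<xi> j) = real n * e" using n by (simp add: e_def)
    have indep: "prob_space.indep_vars ?Q (\<lambda>_. borel) Y {1..n}"
      unfolding Y_def
      by (rule prob_space.indep_vars_compose2[OF measure_pmf.prob_space_axioms indep_vars_Pi_pmf,
            where Y = "\<lambda>_ x. x / b - e"]) auto
    have mean: "(\<integral>y. Y i y \<partial>?Q) = 0" if "i \<in> {1..n}" for i
    proof -
      have "(\<integral>y. Y i y \<partial>?Q) = (\<Sum>j=1..n. \<xi> j - e) / real n"
        unfolding Y_def \<xi>_def by (rule expectation_empirical_sample[OF n that, where f = "\<lambda>x. x / b - e"])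
      then show ?thesis using sum\<xi> by (simp add: sum_subtractf)
    qed
    have "(\<integral>y. (Y i y)\<^sup>2 \<partial>?Q) = (\<Sum>j=1..n. (\<xi> j - e)\<^sup>2) / real n" if "i \<in> {1..n}" for i
      unfolding Y_def \<xi>_def by (rule expectation_empirical_sample[OF n that, where f = "\<lambda>x. (x / b - e)\<^sup>2"])
    then have "(\<Sum>i=1..n. \<integral>y. (Y i y)\<^sup>2 \<partial>?Q) = (\<Sum>j=1..n. (\<xi> j - e)\<^sup>2)" using n by simp
    also have "\<dots> = (\<Sum>j=1..n. (\<xi> j)\<^sup>2 - 2 * e * \<xi> j + e\<^sup>2)"
      by (intro sum.cong refl) (simp add: power2_diff)
    also have "\<dots> = (\<Sum>j=1..n. (\<xi> j)\<^sup>2) - 2 * e * (\<Sum>j=1..n. \<xi> j) + real n * e\<^sup>2"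
      by (simp add: sum.distrib sum_subtractf sum_distrib_left)
    also have "\<dots> = (\<Sum>j=1..n. (\<xi> j)\<^sup>2) - (\<Sum>j=1..n. \<xi> j)\<^sup>2 / real n"
      unfolding sum\<xi> using n by (simp add: power2_eq_square)
    finally have var: "\<bar>(\<Sum>i=1..n. \<integral>y. (Y i y)\<^sup>2 \<partial>?Q) - 1\<bar> \<le> \<delta>"
    proof -
      assume *: "(\<Sum>i=1..n. \<integral>y. (Y i y)\<^sup>2 \<partial>?Q) = (\<Sum>j=1..n. (\<xi> j)\<^sup>2) - (\<Sum>j=1..n. \<xi> j)\<^sup>2 / real n"
      have "0 \<le> (\<Sum>j=1..n. \<xi> j)\<^sup>2 / real n" by simp
      then show ?thesis using * sq lin \<delta> unfolding \<xi>_def by linarith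
    qed
    have ge: "real n * \<bar>e\<bar> ^ 3 \<le> (\<Sum>j=1..n. \<bar>\<xi> j\<bar> ^ 3)"
    proof -
      have "\<bar>e\<bar> \<le> (\<Sum>j=1..n. 1 / real n * \<bar>\<xi> j\<bar>)"
        using sum_abs[of \<xi> "{1..n}"] n by (simp add: e_def divide_right_mono flip: sum_divide_distrib)
      then have "\<bar>e\<bar> ^ 3 \<le> (\<Sum>j=1..n. 1 / real n * \<bar>\<xi> j\<bar>) ^ 3" by (intro power_mono) auto
      also have "\<dots> \<le> (\<Sum>j=1..n. 1 / real n)\<^sup>2 * (\<Sum>j=1..n. 1 / real n * \<bar>\<xi> j\<bar> ^ 3)"
        by (rule weighted_power_mean_3) auto
      also have "\<dots> = (\<Sum>j=1..n. \<bar>\<xi> j\<bar> ^ 3) / real n" using n by (simp flip: sum_divide_distrib)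
      finally show ?thesis using n by (simp add: field_simps)
    qed
    have "(\<integral>y. \<bar>Y i y\<bar> ^ 3 \<partial>?Q) = (\<Sum>j=1..n. \<bar>\<xi> j - e\<bar> ^ 3) / real n" if "i \<in> {1..n}" for i
      unfolding Y_def \<xi>_def by (rule expectation_empirical_sample[OF n that, where f = "\<lambda>x. \<bar>x / b - e\<bar> ^ 3"])
    then have "(\<Sum>i=1..n. \<integral>y. \<bar>Y i y\<bar> ^ 3 \<partial>?Q) = (\<Sum>j=1..n. \<bar>\<xi> j - e\<bar> ^ 3)" using n by simp
    also have "\<dots> \<le> (\<Sum>j=1..n. 4 * \<bar>\<xi> j\<bar> ^ 3 + 4 * \<bar>e\<bar> ^ 3)"
    proof (rule sum_mono)
      fix j
      have "\<bar>\<xi> j - e\<bar> ^ 3 \<le> (\<bar>\<xi> j\<bar> + \<bar>e\<bar>) ^ 3" by (intro power_mono) auto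
      also have "\<dots> \<le> 4 * \<bar>\<xi> j\<bar> ^ 3 + 4 * \<bar>e\<bar> ^ 3"
      proof -
        have "0 \<le> 3 * ((\<bar>\<xi> j\<bar> + \<bar>e\<bar>) * (\<bar>\<xi> j\<bar> - \<bar>e\<bar>)\<^sup>2)" by simp
        also have "\<dots> = 4 * \<bar>\<xi> j\<bar> ^ 3 + 4 * \<bar>e\<bar> ^ 3 - (\<bar>\<xi> j\<bar> + \<bar>e\<bar>) ^ 3" by algebra
        finally show ?thesis by simp
      qed
      finally show "\<bar>\<xi> j - e\<bar> ^ 3 \<le> 4 * \<bar>\<xi> j\<bar> ^ 3 + 4 * \<bar>e\<bar> ^ 3" .
    qed
    also have "\<dots> = 4 * (\<Sum>j=1..n. \<bar>\<xi> j\<bar> ^ 3) + 4 * (real n * \<bar>e\<bar> ^ 3)"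
      by (simp add: sum.distrib sum_distrib_left)
    also have "\<dots> \<le> \<delta>" using ge cub unfolding \<xi>_def by linarith
    finally have third: "(\<Sum>i=1..n. \<integral>y. \<bar>Y i y\<bar> ^ 3 \<partial>?Q) \<le> \<delta>" .
    have "\<bar>measure ?Q {y \<in> space ?Q. (\<Sum>i=1..n. Y i y) \<le> t * c / b}
        - Phi (t * c / b)\<bar> \<le> \<epsilon>"
      using clt[of ?Q Y "{1..n}"] n indep mean var third integrable_empirical_sample[OF n]
      by (simp add: lyapunov_sum_def measure_pmf.prob_space_axioms)
    moreover have "{y \<in> space ?Q. (\<Sum>i=1..n. Y i y) \<le> t * c / b}
        = {y. (\<Sum>i=1..n. y i / c) - (\<Sum>i=1..n. z i / c) \<le> t}"
    proof -
      have "(\<Sum>i=1..n. Y i y) = ((\<Sum>i=1..n. y i) - (\<Sum>i=1..n. z i)) / b" for y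
        using sum\<xi> by (simp add: Y_def sum_subtractf \<xi>_def diff_divide_distrib flip: sum_divide_distrib)
      moreover have "(\<Sum>i=1..n. y i / c) - (\<Sum>i=1..n. z i / c) = ((\<Sum>i=1..n. y i) - (\<Sum>i=1..n. z i)) / c"
        for y :: "nat \<Rightarrow> real"
        by (simp add: diff_divide_distrib flip: sum_divide_distrib)
      moreover have "(D / b \<le> t * c / b) = (D / c \<le> t)" for D
        using b c by (simp add: field_simps)
      ultimately show ?thesis by (simp only: space_measure_pmf UNIV_I simp_thms)
    qed
    ultimately show "\<bar>boot_prob n z c t - Phi (t * c / b)\<bar> \<le> \<epsilon>"
      by (simp add: boot_prob_def)
  qed (use \<delta> in simp)
qed

section \<open>Consistency of the bootstrap under a Lyapunov condition\<close>

text \<open>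
  Uniformity in \<open>x\<close> is part of the notion, because the arguments at which it is used depend on
  \<open>n\<close>.
\<close>

definition asymp_normal :: "(nat \<Rightarrow> 'w measure) \<Rightarrow> (nat \<Rightarrow> 'w \<Rightarrow> real) \<Rightarrow> (nat \<Rightarrow> real) \<Rightarrow> bool" where
  "asymp_normal P T b \<longleftrightarrow> (\<forall>\<epsilon>>0. \<forall>\<^sub>F n in sequentially. \<forall>x.
     \<bar>measure (P n) {w \<in> space (P n). T n w \<le> x * b n} - Phi x\<bar> \<le> \<epsilon>)"

text \<open>
  Lyapunov's condition of order \<open>3\<close>, where \<open>b n\<close> is the standard deviation of the \<open>n\<close>-th row sum. The
  properties of a row are demanded only from some row on, because for \<open>n < m\<close> there are no tuples of distinct
  indices.
\<close>

definition lyapunov_array ::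
  "(nat \<Rightarrow> 'w measure) \<Rightarrow> (nat \<Rightarrow> nat \<Rightarrow> 'w \<Rightarrow> real) \<Rightarrow> (nat \<Rightarrow> real) \<Rightarrow> bool" where
  "lyapunov_array P Y b \<longleftrightarrow>
     (\<forall>\<^sub>F n in sequentially. prob_space (P n) \<and> b n > 0 \<and>
        prob_space.indep_vars (P n) (\<lambda>_. borel) (Y n) {1..n} \<and>
        (\<forall>i\<in>{1..n}. integrable (P n) (\<lambda>w. \<bar>Y n i w\<bar> ^ 3) \<and> (\<integral>w. Y n i w \<partial>P n) = 0) \<and>
        (\<Sum>i=1..n. \<integral>w. (Y n i w)\<^sup>2 \<partial>P n) = (b n)\<^sup>2) \<and>
     (\<lambda>n. (\<Sum>i=1..n. \<integral>w. \<bar>Y n i w\<bar> ^ 3 \<partial>P n) / b n ^ 3) \<longlonglongrightarrow> 0"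

lemma lyapunov_array_standardized:
  assumes "prob_space M" and b: "b > 0"
    and indep: "prob_space.indep_vars M (\<lambda>_. borel) Y {1..n::nat}"
    and int: "\<And>i. i \<in> {1..n} \<Longrightarrow> integrable M (\<lambda>w. \<bar>Y i w\<bar> ^ 3)"
    and mean: "\<And>i. i \<in> {1..n} \<Longrightarrow> (\<integral>w. Y i w \<partial>M) = 0"
    and var: "(\<Sum>i=1..n. \<integral>w. (Y i w)\<^sup>2 \<partial>M) = b\<^sup>2"
  defines "\<xi> \<equiv> \<lambda>i w. (Y i w :: real) / b"
  shows "prob_space.indep_vars M (\<lambda>_. borel) \<xi> {1..n}"
    and "\<And>i. i \<in> {1..n} \<Longrightarrow> integrable M (\<lambda>w. \<bar>\<xi> i w\<bar> ^ 3)"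
    and "\<And>i. i \<in> {1..n} \<Longrightarrow> (\<integral>w. \<xi> i w \<partial>M) = 0"
    and "(\<Sum>i=1..n. \<integral>w. (\<xi> i w)\<^sup>2 \<partial>M) = 1"
    and "(\<Sum>i=1..n. \<integral>w. \<bar>\<xi> i w\<bar> ^ 3 \<partial>M) = (\<Sum>i=1..n. \<integral>w. \<bar>Y i w\<bar> ^ 3 \<partial>M) / b ^ 3"
proof -
  interpret prob_space M by fact
  show "indep_vars (\<lambda>_. borel) \<xi> {1..n}"
    unfolding \<xi>_def by (rule indep_vars_compose2[OF indep, where Y = "\<lambda>_ y. y / b"]) auto
  have p: "\<bar>\<xi> i w\<bar> ^ 3 = \<bar>Y i w\<bar> ^ 3 / b ^ 3" "(\<xi> i w)\<^sup>2 = (Y i w)\<^sup>2 / b\<^sup>2" for i w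
    using b by (auto simp: \<xi>_def power_divide)
  show "\<And>i. i \<in> {1..n} \<Longrightarrow> integrable M (\<lambda>w. \<bar>\<xi> i w\<bar> ^ 3)" unfolding p using int by simp
  show "\<And>i. i \<in> {1..n} \<Longrightarrow> (\<integral>w. \<xi> i w \<partial>M) = 0" unfolding \<xi>_def using mean by simp
  show "(\<Sum>i=1..n. \<integral>w. (\<xi> i w)\<^sup>2 \<partial>M) = 1"
    unfolding p using var b by (simp flip: sum_divide_distrib)
  show "(\<Sum>i=1..n. \<integral>w. \<bar>\<xi> i w\<bar> ^ 3 \<partial>M) = (\<Sum>i=1..n. \<integral>w. \<bar>Y i w\<bar> ^ 3 \<partial>M) / b ^ 3"
    unfolding p by (simp flip: sum_divide_distrib)
qed

lemma lyapunov_array_asymp_normal: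
  assumes "lyapunov_array P Y b"
  shows "asymp_normal P (\<lambda>n w. \<Sum>i=1..n. Y n i w) b"
  unfolding asymp_normal_def
proof (intro allI impI)
  fix \<epsilon> :: real assume "\<epsilon> > 0"
  obtain \<delta> where \<delta>: "\<delta> > 0" and clt:
    "\<And>(M :: 'a measure) (Y :: nat \<Rightarrow> 'a \<Rightarrow> real) A x. lyapunov_sum \<delta> M Y A \<Longrightarrow>
      \<bar>measure M {w \<in> space M. (\<Sum>i\<in>A. Y i w) \<le> x} - Phi x\<bar> \<le> \<epsilon>"
    using uniform_clt[OF \<open>\<epsilon> > 0\<close>, where 'a = 'a and 'i = nat] by blast
  have "\<forall>\<^sub>F n in sequentially. (\<Sum>i=1..n. \<integral>w. \<bar>Y n i w\<bar> ^ 3 \<partial>P n) / b n ^ 3 < \<delta>"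
    using assms \<delta> unfolding lyapunov_array_def by (auto intro: order_tendstoD)
  moreover note assms[unfolded lyapunov_array_def, THEN conjunct1]
  ultimately show "\<forall>\<^sub>F n in sequentially. \<forall>x. \<bar>measure (P n) {w \<in> space (P n). (\<Sum>i=1..n. Y n i w) \<le> x * b n}
      - Phi x\<bar> \<le> \<epsilon>"
  proof eventually_elim
    case (elim n)
    then have ps: "prob_space (P n)" and bn: "b n > 0" by auto
    note std = lyapunov_array_standardized[of "P n" "b n" "Y n" n]
    show ?case
    proof
      fix x
      have "\<bar>measure (P n) {w \<in> space (P n). (\<Sum>i=1..n. Y n i w / b n) \<le> x}
          - Phi x\<bar> \<le> \<epsilon>"
        by (rule clt) (use elim std ps \<delta> in \<open>auto simp: lyapunov_sum_def\<close>)
      moreover have "((\<Sum>i=1..n. Y n i w / b n) \<le> x) = ((\<Sum>i=1..n. Y n i w) \<le> x * b n)" for w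
        using bn by (simp add: field_simps flip: sum_divide_distrib)
      ultimately show "\<bar>measure (P n) {w \<in> space (P n). (\<Sum>i=1..n. Y n i w) \<le> x * b n}
          - Phi x\<bar> \<le> \<epsilon>" by simp
    qed
  qed
qed

text \<open>
  Off the event that one of the three empirical quantities in \<open>boot_prob_near_normal\<close> is far from its
  limit, both distribution functions are close to the same normal one. Markov's inequality bounds the
  probability of this event: \<open>sum_squares_concentration\<close> for the squares, while the square of the
  standardized row sum has expectation \<open>1\<close> and is divided by \<open>n\<close>.
\<close>

lemma bootstrap_consistency:
  assumes ly: "lyapunov_array P Y b"
    and T: "asymp_normal P T b"
    and Tm: "\<forall>\<^sub>F n in sequentially. T n \<in> borel_measurable (P n)"
    and c: "\<And>n. c n \<ge> 0"
  shows "tendsto_0_in_prob P (\<lambda>n w. SUP t. \<bar>boot_prob n (\<lambda>j. Y n j w) (c n) t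
           - measure (P n) {w' \<in> space (P n). T n w' / c n \<le> t}\<bar>)"
  unfolding tendsto_0_in_prob_def
proof (intro conjI allI impI)
  let ?D = "\<lambda>n w t. \<bar>boot_prob n (\<lambda>j. Y n j w) (c n) t
           - measure (P n) {w' \<in> space (P n). T n w' / c n \<le> t}\<bar>"
  note row = ly[unfolded lyapunov_array_def, THEN conjunct1]
  show meas: "\<forall>\<^sub>F n in sequentially. (\<lambda>w. SUP t. ?D n w t) \<in> borel_measurable (P n)"
    using row Tm
  proof eventually_elim
    case (elim n)
    then interpret prob_space "P n" by simp
    have Y: "Y n i \<in> borel_measurable (P n)" if "i \<in> {1..n}" for i
      using elim that unfolding indep_vars_def by auto
    note [measurable] = elim(2)
    show ?case
    proof (rule borel_measurable_SUP_right_continuous)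
      show "(\<lambda>w. ?D n w t) \<in> borel_measurable (P n)" for t
        using borel_measurable_boot_prob[of n "Y n" "P n"] Y by measurable
      show "continuous (at_right t) (?D n w)" for w t
        by (intro continuous_intros boot_prob_right_continuous tail_right_continuous) measurable
      show "\<bar>?D n w t\<bar> \<le> 1" for w t
      proof -
        have "0 \<le> measure (P n) {w' \<in> space (P n). T n w' / c n \<le> t}" 
          "measure (P n) {w' \<in> space (P n). T n w' / c n \<le> t} \<le> 1" by auto
        then show ?thesis using boot_prob_le_1[of n "\<lambda>j. Y n j w" "c n" t] by linarith
      qed
    qed
  qed
  fix \<epsilon> :: real assume "\<epsilon> > 0"
  then have "\<epsilon> / 2 > 0" by simp
  let ?S = "\<lambda>n. {w \<in> space (P n). \<bar>SUP t. ?D n w t\<bar> > \<epsilon>}"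
  obtain \<delta> where \<delta>: "\<delta> > 0" and near:
    "\<And>n z b c t. 0 < n \<Longrightarrow> 0 < b \<Longrightarrow> 0 < c \<Longrightarrow> \<bar>(\<Sum>i=1..n. (z i / b)\<^sup>2) - 1\<bar> \<le> \<delta> \<Longrightarrow>
       (\<Sum>i=1..n. z i / b)\<^sup>2 / real n \<le> \<delta> \<Longrightarrow> (\<Sum>i=1..n. \<bar>z i / b\<bar> ^ 3) \<le> \<delta> \<Longrightarrow>
       \<bar>boot_prob n z c t - Phi (t * c / b)\<bar> \<le> \<epsilon> / 2"
    using boot_prob_near_normal[OF \<open>\<epsilon> / 2 > 0\<close>] by blast
  define \<beta> where "\<beta> n = (\<Sum>i=1..n. \<integral>w. \<bar>Y n i w\<bar> ^ 3 \<partial>P n) / b n ^ 3" for n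
  have \<beta>: "\<beta> \<longlonglongrightarrow> 0" using ly unfolding lyapunov_array_def \<beta>_def by simp
  have Tn: "\<forall>\<^sub>F n in sequentially. \<forall>x. \<bar>measure (P n) {w \<in> space (P n). T n w \<le> x * b n}
     - Phi x\<bar> \<le> \<epsilon> / 2"
    using T \<open>\<epsilon> / 2 > 0\<close> unfolding asymp_normal_def by blast
  have "\<forall>\<^sub>F n in sequentially. measure (P n) (?S n)
      \<le> (2 * \<beta> n + sqrt (\<beta> n)) / \<delta> + (1 / real n) / \<delta> + \<beta> n / \<delta>"
    using row Tn eventually_gt_at_top[of 0]
  proof eventually_elim
    case (elim n)
    then interpret prob_space "P n" by simp
    from elim have b: "b n > 0" and n: "n > 0" by auto
    define \<xi> where "\<xi> i w = Y n i w / b n" for i w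
    note std = lyapunov_array_standardized[of "P n" "b n" "Y n" n, folded \<xi>_def \<beta>_def]
    have ind: "indep_vars (\<lambda>_. borel) \<xi> {1..n}"
      and int: "\<And>i. i \<in> {1..n} \<Longrightarrow> integrable (P n) (\<lambda>w. \<bar>\<xi> i w\<bar> ^ 3)"
      and mean: "\<And>i. i \<in> {1..n} \<Longrightarrow> expectation (\<xi> i) = 0"
      and var: "(\<Sum>i=1..n. expectation (\<lambda>w. (\<xi> i w)\<^sup>2)) = 1"
      and third: "(\<Sum>i=1..n. expectation (\<lambda>w. \<bar>\<xi> i w\<bar> ^ 3)) = \<beta> n"
      using std elim by auto
    have rv: "\<xi> i \<in> borel_measurable (P n)" if "i \<in> {1..n}" for i
      using ind that unfolding indep_vars_def by auto
    have int2: "integrable (P n) (\<lambda>w. (\<xi> i w)\<^sup>2)" if "i \<in> {1..n}" for i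
      using abs_power_integrable_mono(1)[OF rv[OF that] int[OF that], of 2] by simp
    let ?A = "\<lambda>w. (\<Sum>i=1..n. (\<xi> i w)\<^sup>2) - 1" and ?B = "\<lambda>w. (\<Sum>i=1..n. \<xi> i w)\<^sup>2 / real n"
      and ?C = "\<lambda>w. \<Sum>i=1..n. \<bar>\<xi> i w\<bar> ^ 3"
    have sq: "integrable (P n) (\<lambda>w. (\<Sum>i=1..n. \<xi> i w)\<^sup>2)"
      "expectation (\<lambda>w. (\<Sum>i=1..n. \<xi> i w)\<^sup>2) = (\<Sum>i=1..n. expectation (\<lambda>w. (\<xi> i w)\<^sup>2))"
      by (intro expectation_square_sum_indep[OF finite_atLeastAtMost ind] int2 mean; assumption)+
    have iA: "integrable (P n) ?A" and iB: "integrable (P n) ?B" and iC: "integrable (P n) ?C"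
      using int2 int sq(1) by (auto intro!: Bochner_Integration.integrable_diff Bochner_Integration.integrable_sum)
    have A: "prob {w \<in> space (P n). \<bar>?A w\<bar> > \<delta>} \<le> (2 * \<beta> n + sqrt (\<beta> n)) / \<delta>"
    proof -
      have "expectation (\<lambda>w. \<bar>?A w\<bar>) \<le> 2 * \<beta> n + sqrt (\<beta> n)"
        using sum_squares_concentration[OF _ ind int] unfolding var third by simp
      then show ?thesis
        using order_trans[OF markov_abs[OF iA \<delta>] divide_right_mono] \<delta> by (meson less_imp_le)
    qed
    have B: "prob {w \<in> space (P n). \<bar>?B w\<bar> > \<delta>} \<le> (1 / real n) / \<delta>"
    proof -
      have "expectation (\<lambda>w. \<bar>?B w\<bar>) = 1 / real n"
        using sq(2) unfolding var by simp
      then show ?thesis using markov_abs[OF iB \<delta>] by (simp only:)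
    qed
    have C: "prob {w \<in> space (P n). \<bar>?C w\<bar> > \<delta>} \<le> \<beta> n / \<delta>"
    proof -
      have "expectation (\<lambda>w. \<bar>?C w\<bar>) = \<beta> n"
        using int by (simp add: third[symmetric] sum_nonneg)
      then show ?thesis using markov_abs[OF iC \<delta>] by (simp only:)
    qed
    have small: "\<bar>SUP t. ?D n w t\<bar> \<le> \<epsilon>" if "\<bar>?A w\<bar> \<le> \<delta>" "\<bar>?B w\<bar> \<le> \<delta>" "\<bar>?C w\<bar> \<le> \<delta>" for w
    proof -
      have each: "?D n w t \<le> \<epsilon>" for t
      proof (cases "c n = 0")
        case True
        \<comment> \<open>Division by \<open>0\<close> yields \<open>0\<close>: both distributions are concentrated at \<open>0\<close>.\<close>
        then have "boot_prob n (\<lambda>j. Y n j w) (c n) t = (if 0 \<le> t then 1 else 0)"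
          by (simp add: boot_prob_def)
        moreover have "prob {w' \<in> space (P n). T n w' / c n \<le> t} = (if 0 \<le> t then 1 else 0)"
          using True by (simp add: prob_space)
        ultimately show ?thesis using \<open>\<epsilon> > 0\<close> by simp
      next
        case False
        then have cn: "c n > 0" using c[of n] by simp
        have "\<bar>boot_prob n (\<lambda>j. Y n j w) (c n) t - Phi (t * c n / b n)\<bar> \<le> \<epsilon> / 2"
          by (rule near[OF n b cn]) (use that in \<open>auto simp: \<xi>_def abs_le_iff\<close>)
        moreover have "{w' \<in> space (P n). T n w' / c n \<le> t}
            = {w' \<in> space (P n). T n w' \<le> (t * c n / b n) * b n}"
          using cn b by (auto simp: field_simps)
        then have "\<bar>prob {w' \<in> space (P n). T n w' / c n \<le> t} - Phi (t * c n / b n)\<bar> \<le> \<epsilon> / 2"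
          using elim(2) by metis
        ultimately show ?thesis by linarith
      qed
      have bdd: "bdd_above (range (?D n w))" using each by (intro bdd_aboveI2)
      have "(SUP t. ?D n w t) \<le> \<epsilon>" using each by (intro cSUP_least) auto
      moreover have "?D n w 0 \<le> (SUP t. ?D n w t)" by (intro cSUP_upper bdd) simp
      ultimately show ?thesis by linarith
    qed
    let ?EA = "{w \<in> space (P n). \<bar>?A w\<bar> > \<delta>}" and ?EB = "{w \<in> space (P n). \<bar>?B w\<bar> > \<delta>}"
      and ?EC = "{w \<in> space (P n). \<bar>?C w\<bar> > \<delta>}"
    have ev: "?EA \<in> events" "?EB \<in> events" "?EC \<in> events"
      using iA iB iC by (auto intro!: measurable_sets_Collect borel_measurable_abs dest!: borel_measurable_integrable)
    have "prob (?S n) \<le> prob (?EA \<union> ?EB \<union> ?EC)"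
    proof (rule finite_measure_mono)
      show "(?S n) \<subseteq> ?EA \<union> ?EB \<union> ?EC"
      proof
        fix w assume "w \<in> (?S n)"
        then have w: "w \<in> space (P n)" "\<not> \<bar>SUP t. ?D n w t\<bar> \<le> \<epsilon>" by (simp_all only: mem_Collect_eq not_le)
        then have "\<not> (\<bar>?A w\<bar> \<le> \<delta> \<and> \<bar>?B w\<bar> \<le> \<delta> \<and> \<bar>?C w\<bar> \<le> \<delta>)" using small[of w] by blast
        then show "w \<in> ?EA \<union> ?EB \<union> ?EC" using w(1) by (simp only: Un_iff mem_Collect_eq not_le de_Morgan_conj) blast
      qed
    qed (use ev in auto)
    also have "\<dots> \<le> prob ?EA + prob ?EB + prob ?EC"
      using measure_Un_le[OF sets.Un[OF ev(1,2)] ev(3)] measure_Un_le[OF ev(1,2)] by linarith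
    finally show ?case using A B C by linarith
  qed
  moreover have "(\<lambda>n. (2 * \<beta> n + sqrt (\<beta> n)) / \<delta> + (1 / real n) / \<delta> + \<beta> n / \<delta>) \<longlonglongrightarrow> (2 * 0 + sqrt 0) / \<delta> + 0 / \<delta> + 0 / \<delta>"
    using \<delta> by (intro tendsto_intros \<beta> lim_1_over_n) (simp_all only: less_imp_neq[symmetric] less_numeral_extra not_False_eq_True)
  then have "(\<lambda>n. (2 * \<beta> n + sqrt (\<beta> n)) / \<delta> + (1 / real n) / \<delta> + \<beta> n / \<delta>) \<longlonglongrightarrow> 0"
    by (simp only: real_sqrt_zero mult_zero_right add_0 div_0)
  ultimately show "(\<lambda>n. measure (P n) (?S n)) \<longlonglongrightarrow> 0"
    by (rule tendsto_sandwich[OF always_eventually[OF allI[OF measure_nonneg]] _ tendsto_const])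
qed

lemma tendsto_0_in_prob_cong:
  assumes "tendsto_0_in_prob P Z" and "\<forall>\<^sub>F n in sequentially. Z n = Z' n"
  shows "tendsto_0_in_prob P Z'"
  unfolding tendsto_0_in_prob_def
proof (intro conjI allI impI)
  show "\<forall>\<^sub>F n in sequentially. Z' n \<in> borel_measurable (P n)"
    using assms(1)[unfolded tendsto_0_in_prob_def, THEN conjunct1] assms(2) by eventually_elim simp
  fix \<epsilon> :: real assume "\<epsilon> > 0"
  then have "(\<lambda>n. measure (P n) {\<omega> \<in> space (P n). \<bar>Z n \<omega>\<bar> > \<epsilon>}) \<longlonglongrightarrow> 0"
    using assms(1) unfolding tendsto_0_in_prob_def by blast
  moreover have "\<forall>\<^sub>F n in sequentially. measure (P n) {\<omega> \<in> space (P n). \<bar>Z n \<omega>\<bar> > \<epsilon>}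
      = measure (P n) {\<omega> \<in> space (P n). \<bar>Z' n \<omega>\<bar> > \<epsilon>}"
    using assms(2) by eventually_elim simp
  ultimately show "(\<lambda>n. measure (P n) {\<omega> \<in> space (P n). \<bar>Z' n \<omega>\<bar> > \<epsilon>}) \<longlonglongrightarrow> 0"
    by (rule Lim_transform_eventually)
qed

text \<open>
  The density is at most \<open>1 / sqrt (2 * pi)\<close>, which is less than \<open>1\<close>.
\<close>

lemma Phi_Lipschitz:
  assumes "x \<le> y"
  shows "Phi y - Phi x \<le> y - x"
proof (cases "x = y")
  case False
  then have "x < y" using assms by simp
  interpret real_distribution std_normal_distribution by (rule real_dist_normal_dist)
  have le1: "std_normal_density z \<le> 1" for z
  proof -
    have "1 \<le> sqrt (2 * pi)" using pi_gt3 by (intro real_le_rsqrt) simp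
    then have "1 / sqrt (2 * pi) * exp (- z\<^sup>2 / 2) \<le> 1 * 1" by (intro mult_mono) auto
    then show ?thesis by (simp add: normal_density_def)
  qed
  have "emeasure std_normal_distribution {x<..y} = (\<integral>\<^sup>+z. ennreal (std_normal_density z) * indicator {x<..y} z \<partial>lborel)"
    by (simp add: emeasure_density)
  also have "\<dots> \<le> (\<integral>\<^sup>+z. 1 * indicator {x<..y} z \<partial>lborel)"
    by (intro nn_integral_mono mult_right_mono) (use le1 in auto)
  also have "\<dots> = ennreal (y - x)" using assms by simp
  finally have "prob {x<..y} \<le> y - x"
    using assms by (simp add: emeasure_eq_measure)
  then show ?thesis using cdf_diff_eq[OF \<open>x < y\<close>] by simp
qed simp

text \<open>
  Slutsky's lemma with a perturbation that is negligible in mean square. Shifting the argument by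
  \<open>\<delta>\<close> changes the normal distribution function by at most \<open>\<delta>\<close>.
\<close>

lemma asymp_normal_perturb:
  assumes S: "asymp_normal P S b"
    and ps: "\<forall>\<^sub>F n in sequentially. prob_space (P n) \<and> b n > 0 \<and>
       S n \<in> borel_measurable (P n) \<and> T n \<in> borel_measurable (P n) \<and>
       integrable (P n) (\<lambda>w. (T n w - S n w)\<^sup>2)"
    and R: "(\<lambda>n. (\<integral>w. (T n w - S n w)\<^sup>2 \<partial>P n) / (b n)\<^sup>2) \<longlonglongrightarrow> 0"
  shows "asymp_normal P T b"
  unfolding asymp_normal_def
proof (intro allI impI)
  fix \<epsilon> :: real assume "\<epsilon> > 0"
  \<comment> \<open>One third each for the shift, for the exceptional event and for the approximation of \<open>S\<close>. By
    Chebyshev's inequality a mean square below \<open>\<delta>\<^sup>3\<close> gives an exceptional event of probability at most \<open>\<delta>\<close>.\<close>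
  define \<delta> where "\<delta> = \<epsilon> / 3"
  have \<delta>: "\<delta> > 0" using \<open>\<epsilon> > 0\<close> by (simp add: \<delta>_def)
  have "\<forall>\<^sub>F n in sequentially. (\<integral>w. (T n w - S n w)\<^sup>2 \<partial>P n) / (b n)\<^sup>2 < \<delta> ^ 3"
    using order_tendstoD(2)[OF R, of "\<delta> ^ 3"] \<delta> by simp
  moreover have "\<forall>\<^sub>F n in sequentially. \<forall>x. \<bar>measure (P n) {w \<in> space (P n). S n w \<le> x * b n}
      - Phi x\<bar> \<le> \<delta>"
    using S \<delta> unfolding asymp_normal_def by blast
  ultimately show "\<forall>\<^sub>F n in sequentially. \<forall>x. \<bar>measure (P n) {w \<in> space (P n). T n w \<le> x * b n}
      - Phi x\<bar> \<le> \<epsilon>"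
    using ps
  proof eventually_elim
    case (elim n)
    then interpret prob_space "P n" by simp
    have b: "b n > 0" and [measurable]: "S n \<in> borel_measurable (P n)" "T n \<in> borel_measurable (P n)"
      and int: "integrable (P n) (\<lambda>w. (T n w - S n w)\<^sup>2)" using elim by auto
    let ?B = "{w \<in> space (P n). \<bar>(T n w - S n w)\<^sup>2\<bar> > (\<delta> * b n)\<^sup>2}"
    have "prob ?B \<le> expectation (\<lambda>w. \<bar>(T n w - S n w)\<^sup>2\<bar>) / (\<delta> * b n)\<^sup>2"
      by (rule markov_abs[OF int]) (use \<delta> b in simp)
    also have "\<dots> = expectation (\<lambda>w. (T n w - S n w)\<^sup>2) / (b n)\<^sup>2 / \<delta>\<^sup>2"
      by (simp add: power_mult_distrib)
    also have "\<dots> \<le> \<delta> ^ 3 / \<delta>\<^sup>2" using elim by (intro divide_right_mono) auto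
    also have "\<dots> = \<delta>" using \<delta> by (simp add: power3_eq_cube power2_eq_square)
    finally have B: "prob ?B \<le> \<delta>" .
    have close: "\<bar>T n w - S n w\<bar> \<le> \<delta> * b n" if "w \<in> space (P n)" "w \<notin> ?B" for w
    proof -
      have "\<bar>T n w - S n w\<bar>\<^sup>2 \<le> (\<delta> * b n)\<^sup>2" using that by auto
      then show ?thesis by (rule power2_le_imp_le) (use \<delta> b in simp)
    qed
    let ?F = "Phi"
    show ?case
    proof
      fix x
      have "prob {w \<in> space (P n). T n w \<le> x * b n} \<le> prob ({w \<in> space (P n). S n w \<le> (x + \<delta>) * b n} \<union> ?B)"
        by (rule finite_measure_mono) (use close in \<open>fastforce simp: distrib_right\<close>)+
      also have "\<dots> \<le> prob {w \<in> space (P n). S n w \<le> (x + \<delta>) * b n} + prob ?B"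
        by (rule measure_Un_le) auto
      finally have "prob {w \<in> space (P n). T n w \<le> x * b n} \<le> ?F (x + \<delta>) + \<delta> + \<delta>"
        using elim(2)[rule_format, of "x + \<delta>"] B by linarith
      moreover have "prob {w \<in> space (P n). S n w \<le> (x - \<delta>) * b n} \<le> prob ({w \<in> space (P n). T n w \<le> x * b n} \<union> ?B)"
        by (rule finite_measure_mono) (use close in \<open>fastforce simp: left_diff_distrib\<close>)+
      then have "prob {w \<in> space (P n). S n w \<le> (x - \<delta>) * b n} \<le> prob {w \<in> space (P n). T n w \<le> x * b n} + prob ?B"
        by (rule order_trans) (rule measure_Un_le; auto)
      then have "?F (x - \<delta>) - \<delta> - \<delta> \<le> prob {w \<in> space (P n). T n w \<le> x * b n}"
        using elim(2)[rule_format, of "x - \<delta>"] B by linarith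
      moreover have "?F (x + \<delta>) - ?F x \<le> \<delta>" "?F x - ?F (x - \<delta>) \<le> \<delta>"
        using Phi_Lipschitz[of x "x + \<delta>"] Phi_Lipschitz[of "x - \<delta>" x] \<delta> by auto
      ultimately show "\<bar>prob {w \<in> space (P n). T n w \<le> x * b n} - ?F x\<bar> \<le> \<epsilon>"
        unfolding \<delta>_def by linarith
    qed
  qed
qed

section \<open>Tuples of distinct indices\<close>

text \<open>
  The inverse of \<open>tuple_insert m l\<close>, as a map from \<open>m\<close>-tuples to the remaining \<open>(m - 1)\<close>-tuples. It
  allows the projections of the kernel to be indexed by full tuples.
\<close>

definition tuple_delete :: "nat \<Rightarrow> nat \<Rightarrow> (nat \<Rightarrow> 'b) \<Rightarrow> nat \<Rightarrow> 'b" where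
  "tuple_delete m l I = (\<lambda>k\<in>{1..m - 1}. if k < l then I k else I (k + 1))"

lemma tuple_insert_at: "l \<in> {1..m} \<Longrightarrow> tuple_insert m l y ys l = y"
  by (simp add: tuple_insert_def)

lemma tuple_insert_delete:
  assumes "I \<in> extensional {1..m}" "l \<in> {1..m}"
  shows "tuple_insert m l (I l) (tuple_delete m l I) = I"
proof
  fix k
  show "tuple_insert m l (I l) (tuple_delete m l I) k = I k"
    using assms by (cases "k \<in> {1..m}") (auto simp: tuple_insert_def tuple_delete_def extensional_def)
qed

lemma tuple_delete_insert:
  assumes "J \<in> extensional {1..m - 1}" "l \<in> {1..m}"
  shows "tuple_delete m l (tuple_insert m l y J) = J"
proof
  fix k
  show "tuple_delete m l (tuple_insert m l y J) k = J k"
    using assms by (cases "k \<in> {1..m - 1}") (auto simp: tuple_insert_def tuple_delete_def extensional_def)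
qed

lemma tuple_delete_image:
  assumes "l \<in> {1..m}"
  shows "tuple_delete m l I ` {1..m - 1} = I ` ({1..m} - {l})"
proof (intro equalityI subsetI)
  fix x assume "x \<in> I ` ({1..m} - {l})"
  then obtain k where "x = I k" "k \<in> {1..m} - {l}" by (rule imageE)
  then have k: "k \<in> {1..m}" "k \<noteq> l" "x = I k" by auto
  show "x \<in> tuple_delete m l I ` {1..m - 1}"
  proof (cases "k < l")
    case True
    then show ?thesis using k assms by (intro image_eqI[of _ _ k]) (auto simp: tuple_delete_def)
  next
    case False
    then show ?thesis using k assms by (intro image_eqI[of _ _ "k - 1"]) (auto simp: tuple_delete_def)
  qed
qed (use assms in \<open>auto simp: tuple_delete_def\<close>)

lemma finite_inj_tuples: "finite S \<Longrightarrow> finite (inj_tuples m S)"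
  unfolding inj_tuples_def by (intro finite_subset[OF _ finite_PiE[of "{1..m}" "\<lambda>_. S"]]) auto

lemma inj_tuplesD:
  assumes "I \<in> inj_tuples m S"
  shows "I \<in> extensional {1..m}" "\<And>k. k \<in> {1..m} \<Longrightarrow> I k \<in> S" "inj_on I {1..m}"
  using assms by (auto simp: inj_tuples_def PiE_iff)

lemma tuple_delete_inj_tuples:
  assumes I: "I \<in> inj_tuples m S" and l: "l \<in> {1..m}"
  shows "tuple_delete m l I \<in> inj_tuples (m - 1) (S - {I l})"
proof -
  define r where "r k = (if k < l then k else k + 1)" for k
  have r: "r k \<in> {1..m}" "tuple_delete m l I k = I (r k)" if "k \<in> {1..m - 1}" for k
    using that l by (auto simp: r_def tuple_delete_def)
  have "inj_on (tuple_delete m l I) {1..m - 1}"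
  proof (rule inj_onI)
    fix k k' assume k: "k \<in> {1..m - 1}" "k' \<in> {1..m - 1}" "tuple_delete m l I k = tuple_delete m l I k'"
    then have "r k = r k'" using r inj_onD[OF inj_tuplesD(3)[OF I]] by metis
    then show "k = k'" by (auto simp: r_def split: if_splits)
  qed
  moreover have "I k \<noteq> I l" if "k \<in> {1..m}" "k \<noteq> l" for k
    using inj_onD[OF inj_tuplesD(3)[OF I] _ that(1) l] that by blast
  then have "tuple_delete m l I k \<in> S - {I l}" if "k \<in> {1..m - 1}" for k
    using inj_tuplesD(2)[OF I] that l by (auto simp: tuple_delete_def)
  ultimately show ?thesis
    by (auto simp: inj_tuples_def PiE_iff tuple_delete_def extensional_def)
qed

lemma tuple_insert_inj_tuples:
  assumes J: "J \<in> inj_tuples (m - 1) (S - {s})" and l: "l \<in> {1..m}" and s: "s \<in> S"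
  shows "tuple_insert m l s J \<in> inj_tuples m S"
proof -
  have JS: "J k \<in> S" "J k \<noteq> s" if "k \<in> {1..m - 1}" for k using inj_tuplesD(2)[OF J that] by auto
  have Jinj: "J k = J k' \<Longrightarrow> k = k'" if "k \<in> {1..m - 1}" "k' \<in> {1..m - 1}" for k k'
    using inj_tuplesD(3)[OF J] that by (auto simp: inj_on_def)
  define q where "q k = (if k < l then k else k - 1)" for k
  have qm: "q k \<in> {1..m - 1}" "tuple_insert m l s J k = J (q k)" if "k \<in> {1..m}" "k \<noteq> l" for k
    using that l by (auto simp: q_def tuple_insert_def)
  have at: "tuple_insert m l s J l = s" by (rule tuple_insert_at[OF l])
  have "inj_on (tuple_insert m l s J) {1..m}"
  proof (rule inj_onI)
    fix k k' assume k: "k \<in> {1..m}" "k' \<in> {1..m}" and eq: "tuple_insert m l s J k = tuple_insert m l s J k'"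
    consider "k = l" "k' = l" | "k = l" "k' \<noteq> l" | "k \<noteq> l" "k' = l" | "k \<noteq> l" "k' \<noteq> l" by blast
    then show "k = k'"
    proof cases
      case 2
      then show ?thesis using eq at qm[OF k(2)] JS(2) by metis
    next
      case 3
      then show ?thesis using eq at qm[OF k(1)] JS(2) by metis
    next
      case 4
      then have "q k = q k'" using eq qm k Jinj by metis
      then show ?thesis using 4 by (auto simp: q_def split: if_splits)
    qed simp
  qed
  moreover have "tuple_insert m l s J k \<in> S" if "k \<in> {1..m}" for k
    using that s JS(1) qm at by (cases "k = l") auto
  ultimately show ?thesis
    by (auto simp: inj_tuples_def PiE_iff tuple_insert_def extensional_def)
qed

text \<open>
  All counting below and the rearrangement of the sum that defines the Hajek projection rest on this
  correspondence.
\<close>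

lemma bij_betw_tuple_insert:
  assumes l: "l \<in> {1..m}" and s: "s \<in> S"
  shows "bij_betw (tuple_insert m l s) (inj_tuples (m - 1) (S - {s})) {I \<in> inj_tuples m S. I l = s}"
proof (rule bij_betw_byWitness[where f' = "tuple_delete m l"])
  show "\<forall>J\<in>inj_tuples (m - 1) (S - {s}). tuple_delete m l (tuple_insert m l s J) = J"
    by (auto intro: tuple_delete_insert[OF inj_tuplesD(1) l])
  show "\<forall>I\<in>{I \<in> inj_tuples m S. I l = s}. tuple_insert m l s (tuple_delete m l I) = I"
  proof
    fix I assume "I \<in> {I \<in> inj_tuples m S. I l = s}"
    then show "tuple_insert m l s (tuple_delete m l I) = I"
      using tuple_insert_delete[OF inj_tuplesD(1) l, of I S] by auto
  qed
  show "tuple_insert m l s ` inj_tuples (m - 1) (S - {s}) \<subseteq> {I \<in> inj_tuples m S. I l = s}"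
    by (auto simp: tuple_insert_at[OF l] intro: tuple_insert_inj_tuples[OF _ l s])
  show "tuple_delete m l ` {I \<in> inj_tuples m S. I l = s} \<subseteq> inj_tuples (m - 1) (S - {s})"
    using tuple_delete_inj_tuples[OF _ l] by auto
qed

lemma card_inj_tuples:
  assumes "finite S" "k \<le> card S"
  shows "real (card (inj_tuples k S)) = fact (card S) / fact (card S - k)"
  using assms
proof (induction k arbitrary: S)
  case 0
  have "inj_tuples 0 S = {\<lambda>_. undefined}" by (auto simp: inj_tuples_def)
  then show ?case by simp
next
  case (Suc k)
  have "inj_tuples (Suc k) S = (\<Union>s\<in>S. {I \<in> inj_tuples (Suc k) S. I (Suc k) = s})"
    using inj_tuplesD(2)[of _ "Suc k" S "Suc k"] by auto
  then have "card (inj_tuples (Suc k) S) = (\<Sum>s\<in>S. card {I \<in> inj_tuples (Suc k) S. I (Suc k) = s})"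
    using Suc.prems finite_inj_tuples[of S "Suc k"] card_UN_disjoint[of S "\<lambda>s. {I \<in> inj_tuples (Suc k) S. I (Suc k) = s}"]
    by auto
  also have "\<dots> = (\<Sum>s\<in>S. card (inj_tuples k (S - {s})))"
    using bij_betw_same_card[OF bij_betw_tuple_insert[of "Suc k" "Suc k" _ S]] by (intro sum.cong refl) simp
  finally have "real (card (inj_tuples (Suc k) S)) = (\<Sum>s\<in>S. real (card (inj_tuples k (S - {s}))))" by simp
  also have "\<dots> = (\<Sum>s\<in>S. fact (card S - 1) / fact (card S - 1 - k))"
    using Suc.prems by (intro sum.cong refl) (subst Suc.IH, auto simp: card_Diff_singleton)
  also have "\<dots> = fact (card S) / fact (card S - Suc k)"
    using Suc.prems by (cases "card S") auto
  finally show ?case .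
qed

lemma card_inj_tuples_cong:
  assumes "finite S" "finite S'" "card S = card S'"
  shows "card (inj_tuples k S) = card (inj_tuples k S')"
proof (cases "k \<le> card S")
  case True
  then show ?thesis using card_inj_tuples[of S k] card_inj_tuples[of S' k] assms by simp
next
  case False
  have "inj_tuples k R = {}" if "finite R" "card R < k" for R :: "nat set"
    using that card_inj_on_le[of _ "{1..k}" R] by (fastforce simp: inj_tuples_def PiE_iff)
  then show ?thesis using False assms by simp
qed

lemma card_tuples_through:
  assumes fin: "finite S" and s: "s \<in> S"
  shows "card {I \<in> inj_tuples m S. s \<in> I ` {1..m}} \<le> m * card (inj_tuples (m - 1) (S - {s}))"
proof -
  have "{I \<in> inj_tuples m S. s \<in> I ` {1..m}} = (\<Union>l\<in>{1..m}. {I \<in> inj_tuples m S. I l = s})" by auto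
  then have "card {I \<in> inj_tuples m S. s \<in> I ` {1..m}} \<le> (\<Sum>l\<in>{1..m}. card {I \<in> inj_tuples m S. I l = s})"
    by (simp only:) (intro card_UN_le, simp)
  also have "\<dots> = (\<Sum>l\<in>{1..m}. card (inj_tuples (m - 1) (S - {s})))"
    using bij_betw_same_card[OF bij_betw_tuple_insert[OF _ s]] by (intro sum.cong refl) simp
  finally show ?thesis by simp
qed

lemma card_tuples_through_two:
  assumes fin: "finite S" and s: "s \<in> S" and t: "t \<in> S" and st: "s \<noteq> t"
  shows "card {I \<in> inj_tuples m S. s \<in> I ` {1..m} \<and> t \<in> I ` {1..m}}
           \<le> m * ((m - 1) * card (inj_tuples (m - 2) (S - {s} - {t})))"
proof -
  have "{I \<in> inj_tuples m S. s \<in> I ` {1..m} \<and> t \<in> I ` {1..m}}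
      = (\<Union>l\<in>{1..m}. {I \<in> inj_tuples m S. I l = s \<and> t \<in> I ` {1..m}})" by auto
  then have "card {I \<in> inj_tuples m S. s \<in> I ` {1..m} \<and> t \<in> I ` {1..m}}
      \<le> (\<Sum>l\<in>{1..m}. card {I \<in> inj_tuples m S. I l = s \<and> t \<in> I ` {1..m}})"
    by (simp only:) (intro card_UN_le, simp)
  also have "\<dots> \<le> (\<Sum>l\<in>{1..m}. card {J \<in> inj_tuples (m - 1) (S - {s}). t \<in> J ` {1..m - 1}})"
  proof (rule sum_mono)
    fix l assume l: "l \<in> {1..m}"
    show "card {I \<in> inj_tuples m S. I l = s \<and> t \<in> I ` {1..m}}
        \<le> card {J \<in> inj_tuples (m - 1) (S - {s}). t \<in> J ` {1..m - 1}}"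
    proof (rule card_inj_on_le[where f = "tuple_delete m l"])
      show "inj_on (tuple_delete m l) {I \<in> inj_tuples m S. I l = s \<and> t \<in> I ` {1..m}}"
        using tuple_insert_delete[OF inj_tuplesD(1) l] by (intro inj_onI) (metis (mono_tags, lifting) mem_Collect_eq)
      show "tuple_delete m l ` {I \<in> inj_tuples m S. I l = s \<and> t \<in> I ` {1..m}}
          \<subseteq> {J \<in> inj_tuples (m - 1) (S - {s}). t \<in> J ` {1..m - 1}}"
      proof (rule image_subsetI)
        fix I assume I: "I \<in> {I \<in> inj_tuples m S. I l = s \<and> t \<in> I ` {1..m}}"
        then have "tuple_delete m l I \<in> inj_tuples (m - 1) (S - {s})"
          using tuple_delete_inj_tuples[OF _ l, of I S] by auto
        moreover have "t \<in> tuple_delete m l I ` {1..m - 1}"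
          unfolding tuple_delete_image[OF l] using I st by auto
        ultimately show "tuple_delete m l I \<in> {J \<in> inj_tuples (m - 1) (S - {s}). t \<in> J ` {1..m - 1}}"
          by simp
      qed
      show "finite {J \<in> inj_tuples (m - 1) (S - {s}). t \<in> J ` {1..m - 1}}"
        using fin finite_inj_tuples[of "S - {s}" "m - 1"] by auto
    qed
  qed
  also have "\<dots> \<le> (\<Sum>l\<in>{1..m}. (m - 1) * card (inj_tuples (m - 1 - 1) (S - {s} - {t})))"
    using fin t st by (intro sum_mono card_tuples_through) auto
  finally show ?thesis by (simp add: numeral_2_eq_2)
qed

lemma finite_overlap_tuples: "finite (overlap_tuples m n K q)"
  unfolding overlap_tuples_def
  by (intro finite_subset[OF _ finite_PiE[of "{1..K}" "\<lambda>_. inj_tuples m {1..n}"]]) (auto intro: finite_inj_tuples)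

lemma sum_overlap_eq_weight_avg:
  "(\<Sum>I\<in>overlap_tuples m n K q. \<Prod>k=1..K. \<bar>a (I k)\<bar>) = real (card (overlap_tuples m n K q)) * weight_avg m n a K q"
  using finite_overlap_tuples[of m n K q]
  by (cases "overlap_tuples m n K q = {}") (auto simp: weight_avg_def abs_prod)

lemma weight_avg_nonneg: "weight_avg m n a K q \<ge> 0"
  by (auto simp: weight_avg_def intro!: divide_nonneg_nonneg sum_nonneg)

text \<open>
  Expanding the power on the left counts a family of tuples once for each index that its members
  share, hence at most \<open>m\<close> times.
\<close>

lemma sum_power_tuples_through_le:
  fixes w :: "(nat \<Rightarrow> nat) \<Rightarrow> real"
  assumes w: "\<And>I. w I \<ge> 0" and K: "K \<ge> 1"
  shows "(\<Sum>s=1..n. (\<Sum>I | I \<in> inj_tuples m {1..n} \<and> s \<in> I ` {1..m}. w I) ^ K)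
           \<le> real m * (\<Sum>I\<in>overlap_tuples m n K 1. \<Prod>k=1..K. w (I k))"
proof -
  let ?T = "inj_tuples m {1..n}"
  let ?P = "PiE {1..K} (\<lambda>_. ?T)"
  let ?c = "\<lambda>g s. if \<forall>k\<in>{1..K}. s \<in> g k ` {1..m} then (\<Prod>k=1..K. w (g k)) else 0"
  have finT: "finite ?T" by (simp add: finite_inj_tuples)
  have finP: "finite ?P" using finT by (intro finite_PiE) auto
  have "(\<Sum>I | I \<in> ?T \<and> s \<in> I ` {1..m}. w I) ^ K = (\<Sum>g\<in>?P. ?c g s)" for s
  proof -
    have "(\<Sum>I | I \<in> ?T \<and> s \<in> I ` {1..m}. w I) ^ K = (\<Prod>k=1..K. \<Sum>I | I \<in> ?T \<and> s \<in> I ` {1..m}. w I)"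
      by simp
    also have "\<dots> = (\<Sum>g\<in>PiE {1..K} (\<lambda>_. {I. I \<in> ?T \<and> s \<in> I ` {1..m}}). \<Prod>k=1..K. w (g k))"
      using finT by (intro prod_sum_PiE) auto
    also have "PiE {1..K} (\<lambda>_. {I. I \<in> ?T \<and> s \<in> I ` {1..m}}) = {g \<in> ?P. \<forall>k\<in>{1..K}. s \<in> g k ` {1..m}}"
      by (auto simp: PiE_iff extensional_def)
    finally show ?thesis by (simp only: sum.inter_filter[OF finP])
  qed
  then have "(\<Sum>s=1..n. (\<Sum>I | I \<in> ?T \<and> s \<in> I ` {1..m}. w I) ^ K) = (\<Sum>s=1..n. \<Sum>g\<in>?P. ?c g s)"
    by (simp only:)
  also have "\<dots> = (\<Sum>g\<in>?P. \<Sum>s=1..n. ?c g s)" by (rule sum.swap)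
  also have "\<dots> \<le> (\<Sum>g\<in>?P. if g \<in> overlap_tuples m n K 1 then real m * (\<Prod>k=1..K. w (g k)) else 0)"
  proof (rule sum_mono)
    fix g assume g: "g \<in> ?P"
    let ?S = "{s \<in> {1..n}. \<forall>k\<in>{1..K}. s \<in> g k ` {1..m}}"
    have "(\<Sum>s=1..n. ?c g s) = real (card ?S) * (\<Prod>k=1..K. w (g k))"
      by (subst sum.inter_filter[symmetric]) auto
    also have "\<dots> \<le> (if g \<in> overlap_tuples m n K 1 then real m * (\<Prod>k=1..K. w (g k)) else 0)"
    proof (cases "?S = {}")
      case True
      then show ?thesis unfolding True by (auto intro!: mult_nonneg_nonneg prod_nonneg w)
    next
      case False
      have sub: "?S \<subseteq> (\<Inter>k\<in>{1..K}. g k ` {1..m})" by auto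
      have finI: "finite (\<Inter>k\<in>{1..K}. g k ` {1..m})" using K by (intro finite_INT) auto
      have "0 < card (\<Inter>k\<in>{1..K}. g k ` {1..m})"
        using False sub finI by (auto simp: card_gt_0_iff)
      then have "g \<in> overlap_tuples m n K 1" using g by (simp add: overlap_tuples_def)
      moreover have "card ?S \<le> m"
      proof -
        have "?S \<subseteq> g 1 ` {1..m}" using K by auto
        then have "card ?S \<le> card (g 1 ` {1..m})" by (intro card_mono) auto
        also have "\<dots> \<le> m" using card_image_le[of "{1..m}" "g 1"] by simp
        finally show ?thesis .
      qed
      ultimately show ?thesis by (auto intro!: mult_right_mono prod_nonneg w)
    qed
    finally show "(\<Sum>s=1..n. ?c g s) \<le> (if g \<in> overlap_tuples m n K 1 then real m * (\<Prod>k=1..K. w (g k)) else 0)" .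
  qed
  also have "\<dots> = (\<Sum>g\<in>overlap_tuples m n K 1. real m * (\<Prod>k=1..K. w (g k)))"
  proof -
    have "{g \<in> ?P. g \<in> overlap_tuples m n K 1} = overlap_tuples m n K 1" by (auto simp: overlap_tuples_def)
    then show ?thesis by (simp only: sum.inter_filter[OF finP, symmetric])
  qed
  finally show ?thesis by (simp add: sum_distrib_left)
qed

lemma card_overlap_one:
  assumes K: "K \<ge> 1"
  shows "card (overlap_tuples m n K 1) \<le> n * (m * card (inj_tuples (m - 1) {1..n - 1})) ^ K"
proof -
  have cardeq: "card (inj_tuples (m - 1) ({1..n} - {s})) = card (inj_tuples (m - 1) {1..n - 1})"
    if "s \<in> {1..n}" for s
  proof -
    have "card ({1..n} - {s}) = card {1..n - 1}" using that by simp
    then show ?thesis using card_inj_tuples_cong[of "{1..n} - {s}" "{1..n - 1}"] by simp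
  qed
  let ?T = "\<lambda>s. {I \<in> inj_tuples m {1..n}. s \<in> I ` {1..m}}"
  let ?N = "m * card (inj_tuples (m - 1) {1..n - 1})"
  have "overlap_tuples m n K 1 \<subseteq> (\<Union>s\<in>{1..n}. PiE {1..K} (\<lambda>_. ?T s))"
  proof
    fix g assume g: "g \<in> overlap_tuples m n K 1"
    then have "(\<Inter>k\<in>{1..K}. g k ` {1..m}) \<noteq> {}" by (auto simp: overlap_tuples_def)
    then obtain s where s: "\<And>k. k \<in> {1..K} \<Longrightarrow> s \<in> g k ` {1..m}" by blast
    moreover have gT: "g \<in> {1..K} \<rightarrow>\<^sub>E inj_tuples m {1..n}" using g by (simp add: overlap_tuples_def)
    moreover have "s \<in> {1..n}" using s[of 1] K gT inj_tuplesD(2)[of "g 1" m "{1..n}"] by (auto simp: PiE_iff extensional_def)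
    ultimately have "s \<in> {1..n}" "g \<in> PiE {1..K} (\<lambda>_. ?T s)" by (auto simp: PiE_iff extensional_def)
    then show "g \<in> (\<Union>s\<in>{1..n}. PiE {1..K} (\<lambda>_. ?T s))" by blast
  qed
  then have "card (overlap_tuples m n K 1) \<le> card (\<Union>s\<in>{1..n}. PiE {1..K} (\<lambda>_. ?T s))"
    by (intro card_mono finite_UN_I finite_PiE) (auto simp: finite_inj_tuples)
  also have "\<dots> \<le> (\<Sum>s\<in>{1..n}. card (PiE {1..K} (\<lambda>_. ?T s)))" by (rule card_UN_le) simp
  also have "\<dots> \<le> (\<Sum>s\<in>{1..n}. ?N ^ K)"
  proof (rule sum_mono)
    fix s assume s: "s \<in> {1..n}"
    have "card (PiE {1..K} (\<lambda>_. ?T s)) = card (?T s) ^ K" by (simp add: card_PiE)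
    also have "\<dots> \<le> ?N ^ K"
      using card_tuples_through[OF _ s, of m] cardeq[OF s] by (intro power_mono) auto
    finally show "card (PiE {1..K} (\<lambda>_. ?T s)) \<le> ?N ^ K" .
  qed
  finally show ?thesis by simp
qed

lemma card_overlap_two:
  assumes K: "K \<ge> 1"
  shows "card (overlap_tuples m n K 2) \<le> n\<^sup>2 * (m * ((m - 1) * card (inj_tuples (m - 2) {1..n - 2}))) ^ K"
proof -
  let ?T = "\<lambda>s t. {I \<in> inj_tuples m {1..n}. s \<in> I ` {1..m} \<and> t \<in> I ` {1..m}}"
  let ?D = "{(s, t) \<in> {1..n} \<times> {1..n}. s \<noteq> t}"
  let ?N = "m * ((m - 1) * card (inj_tuples (m - 2) {1..n - 2}))"
  have finD: "finite ?D" by (rule finite_subset[of _ "{1..n} \<times> {1..n}"]) auto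
  have "overlap_tuples m n K 2 \<subseteq> (\<Union>(s, t)\<in>?D. PiE {1..K} (\<lambda>_. ?T s t))"
  proof
    fix g assume g: "g \<in> overlap_tuples m n K 2"
    let ?C = "\<Inter>k\<in>{1..K}. g k ` {1..m}"
    have "2 \<le> card ?C" using g by (simp add: overlap_tuples_def)
    obtain s t where st: "s \<in> ?C" "t \<in> ?C" "s \<noteq> t"
    proof -
      obtain B where "B \<subseteq> ?C" "card B = 2" using obtain_subset_with_card_n[OF \<open>2 \<le> card ?C\<close>] by metis
      then show thesis using that by (auto simp: card_2_iff)
    qed
    have gT: "g \<in> {1..K} \<rightarrow>\<^sub>E inj_tuples m {1..n}" using g by (simp add: overlap_tuples_def)
    have "x \<in> {1..n}" if "x \<in> ?C" for x
    proof -
      have "x \<in> g 1 ` {1..m}" using that K by auto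
      then show ?thesis using K gT inj_tuplesD(2)[of "g 1" m "{1..n}"] by (auto simp: PiE_iff extensional_def)
    qed
    then have "s \<in> {1..n}" "t \<in> {1..n}" using st(1,2) by blast+
    then have "(s, t) \<in> ?D" using st(3) by simp
    moreover have "g k \<in> ?T s t" if "k \<in> {1..K}" for k using PiE_mem[OF gT that] st(1,2) that by blast
    then have "g \<in> PiE {1..K} (\<lambda>_. ?T s t)" using PiE_E[OF gT] by (intro PiE_I) auto
    ultimately show "g \<in> (\<Union>(s, t)\<in>?D. PiE {1..K} (\<lambda>_. ?T s t))" by blast
  qed
  then have "card (overlap_tuples m n K 2) \<le> card (\<Union>(s, t)\<in>?D. PiE {1..K} (\<lambda>_. ?T s t))"
  proof (rule card_mono[rotated])
    have "finite (PiE {1..K} (\<lambda>_. ?T s t))" for s t by (rule finite_PiE) (auto simp: finite_inj_tuples)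
    then show "finite (\<Union>(s, t)\<in>?D. PiE {1..K} (\<lambda>_. ?T s t))" by (intro finite_UN_I[OF finD]) (simp split: prod.splits)
  qed
  also have "\<dots> \<le> (\<Sum>(s, t)\<in>?D. card (PiE {1..K} (\<lambda>_. ?T s t)))"
    using card_UN_le[OF finD, of "\<lambda>(s, t). PiE {1..K} (\<lambda>_. ?T s t)"] by (simp only: case_prod_unfold)
  also have "\<dots> \<le> (\<Sum>(s, t)\<in>?D. ?N ^ K)"
  proof (rule sum_mono, clarify)
    fix s t assume st: "s \<in> {1..n}" "t \<in> {1..n}" "s \<noteq> t"
    have "card ({1..n} - {s} - {t}) = card {1..n - 2}" using st by simp
    then have eq: "card (inj_tuples (m - 2) ({1..n} - {s} - {t})) = card (inj_tuples (m - 2) {1..n - 2})"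
      using card_inj_tuples_cong[of "{1..n} - {s} - {t}" "{1..n - 2}"] by simp
    have "card (PiE {1..K} (\<lambda>_. ?T s t)) = card (?T s t) ^ K" by (simp add: card_PiE)
    also have "\<dots> \<le> ?N ^ K"
      using card_tuples_through_two[OF _ st, of m] eq by (intro power_mono) auto
    finally show "card (PiE {1..K} (\<lambda>_. ?T s t)) \<le> ?N ^ K" .
  qed
  also have "\<dots> = card ?D * ?N ^ K"
    by (simp add: case_prod_unfold)
  also have "\<dots> \<le> n\<^sup>2 * ?N ^ K"
  proof (rule mult_right_mono)
    have "card ?D \<le> card ({1..n} \<times> {1..n})" by (intro card_mono) auto
    then show "card ?D \<le> n\<^sup>2" by (simp add: power2_eq_square)
  qed simp
  finally show ?thesis .
qed

text \<open>
  The normalizing factor is the reciprocal of the number of \<open>(m - 1)\<close>-tuples that avoid a given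
  index, and at most \<open>m\<close> times as many \<open>m\<close>-tuples pass through that index; so the normalized cubes
  and the average over overlapping triples differ by a factor of at most \<open>m\<^sup>4 * n\<close>.
\<close>

lemma sum_cube_tuples_through_le_weight_avg:
  assumes "m \<ge> 1" "m \<le> n"
  shows "(\<Sum>s=1..n. (fact (n - m) / fact (n - 1) *
             (\<Sum>I | I \<in> inj_tuples m {1..n} \<and> s \<in> I ` {1..m}. \<bar>a I\<bar>)) ^ 3)
           \<le> real m ^ 4 * real n * weight_avg m n a 3 1"
proof -
  define c :: real where "c = fact (n - m) / fact (n - 1)"
  let ?W = "\<lambda>s. \<Sum>I | I \<in> inj_tuples m {1..n} \<and> s \<in> I ` {1..m}. \<bar>a I\<bar>"
  have c: "c * real (card (inj_tuples (m - 1) {1..n - 1})) = 1"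
    using assms by (subst card_inj_tuples) (auto simp: c_def)
  have "c > 0" by (simp add: c_def)
  have "(\<Sum>s=1..n. (?W s) ^ 3) \<le> real m * (\<Sum>I\<in>overlap_tuples m n 3 1. \<Prod>k=1..3. \<bar>a (I k)\<bar>)"
    by (rule sum_power_tuples_through_le) auto
  also have "\<dots> = real m * (real (card (overlap_tuples m n 3 1)) * weight_avg m n a 3 1)"
    by (simp only: sum_overlap_eq_weight_avg)
  also have "\<dots> \<le> real m * (real (n * (m * card (inj_tuples (m - 1) {1..n - 1})) ^ 3) * weight_avg m n a 3 1)"
    by (intro mult_left_mono mult_right_mono weight_avg_nonneg of_nat_mono card_overlap_one) auto
  finally have "c ^ 3 * (\<Sum>s=1..n. (?W s) ^ 3)
      \<le> c ^ 3 * (real m * (real (n * (m * card (inj_tuples (m - 1) {1..n - 1})) ^ 3) * weight_avg m n a 3 1))"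
    using \<open>c > 0\<close> by (intro mult_left_mono) auto
  also have "\<dots> = real m ^ 4 * real n * weight_avg m n a 3 1 * (c * real (card (inj_tuples (m - 1) {1..n - 1}))) ^ 3"
    by (simp add: power_mult_distrib numeral_eq_Suc algebra_simps)
  finally show ?thesis
    unfolding c by (simp only: c_def[symmetric] power_mult_distrib sum_distrib_left[of "c ^ 3"] power_one mult_1_right)
qed

text \<open>
  The number of pairs of tuples with two common indices is at most a constant times \<open>1 / n\<^sup>2\<close> times
  the number of all pairs: for each of the at most \<open>n\<^sup>2\<close> choices of the two indices, the probability
  that a random tuple contains both is of order \<open>1 / n\<^sup>2\<close>.
\<close>

lemma sum_overlapping_pairs_le_weight_avg:
  assumes "m \<ge> 2" "m \<le> n"
  shows "(fact (n - m) / fact n)\<^sup>2 *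
           (\<Sum>(I, J) | I \<in> inj_tuples m {1..n} \<and> J \<in> inj_tuples m {1..n} \<and> 2 \<le> card (I ` {1..m} \<inter> J ` {1..m}).
              \<bar>a I\<bar> * \<bar>a J\<bar>)
           \<le> 4 * real m ^ 4 / (real n)\<^sup>2 * weight_avg m n a 2 2"
proof -
  define c :: real where "c = fact (n - m) / fact n"
  define N where "N = card (inj_tuples (m - 2) {1..n - 2})"
  let ?D = "{(I, J). I \<in> inj_tuples m {1..n} \<and> J \<in> inj_tuples m {1..n} \<and> 2 \<le> card (I ` {1..m} \<inter> J ` {1..m})}"
  have n: "n \<ge> 2" using assms by simp
  have cN: "c * real N * (real n * real (n - 1)) = 1"
  proof -
    have "real N = fact (n - 2) / fact (n - m)"
      unfolding N_def using assms by (subst card_inj_tuples) (auto simp: numeral_2_eq_2 intro!: arg_cong[where f = fact])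
    moreover have "(fact n :: real) = real n * (real (n - 1) * fact (n - 2))"
      proof -
      obtain k where "n = Suc (Suc k)" using n by (metis add_2_eq_Suc le_Suc_ex)
      then show ?thesis by (simp add: algebra_simps)
    qed
    ultimately show ?thesis using n by (simp add: c_def)
  qed
  have "bij_betw (\<lambda>g :: nat \<Rightarrow> nat \<Rightarrow> nat. (g 1, g 2)) (overlap_tuples m n 2 2) ?D"
  proof (rule bij_betw_byWitness[where f' = "\<lambda>(I, J). \<lambda>k\<in>{1..2::nat}. if k = 1 then I else J"])
    have 12: "{Suc 0..2} = {1, 2}" by auto
    show "\<forall>g\<in>overlap_tuples m n 2 2. (case (g 1, g 2) of (I, J) \<Rightarrow> \<lambda>k\<in>{1..2::nat}. if k = 1 then I else J) = g"
    proof
      fix g assume "g \<in> overlap_tuples m n 2 2"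
      then have "g \<in> extensional {1..2}" by (simp add: overlap_tuples_def PiE_iff)
      then have "(if k \<in> {1..2} then if k = 1 then g 1 else g 2 else undefined) = g k" for k
        by (cases "k = 1 \<or> k = 2") (auto simp: extensional_def)
      then show "(case (g 1, g 2) of (I, J) \<Rightarrow> \<lambda>k\<in>{1..2::nat}. if k = 1 then I else J) = g"
        by (simp only: restrict_def prod.case)
    qed
    show "\<forall>p\<in>?D. (\<lambda>g :: nat \<Rightarrow> nat \<Rightarrow> nat. (g 1, g 2)) (case p of (I, J) \<Rightarrow> \<lambda>k\<in>{1..2::nat}. if k = 1 then I else J) = p" by auto
    show "(\<lambda>g :: nat \<Rightarrow> nat \<Rightarrow> nat. (g 1, g 2)) ` overlap_tuples m n 2 2 \<subseteq> ?D"
      by (auto simp: overlap_tuples_def PiE_iff 12)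
    show "(\<lambda>(I, J). \<lambda>k\<in>{1..2::nat}. if k = 1 then I else J) ` ?D \<subseteq> overlap_tuples m n 2 2"
      by (auto simp: overlap_tuples_def PiE_iff 12)
  qed
  from sum.reindex_bij_betw[OF this, of "\<lambda>(I, J). \<bar>a I\<bar> * \<bar>a J\<bar>"]
  have "(\<Sum>(I, J)\<in>?D. \<bar>a I\<bar> * \<bar>a J\<bar>) = (\<Sum>g\<in>overlap_tuples m n 2 2. \<bar>a (g 1)\<bar> * \<bar>a (g 2)\<bar>)" by simp
  also have "\<dots> = (\<Sum>g\<in>overlap_tuples m n 2 2. \<Prod>k=1..2. \<bar>a (g k)\<bar>)" by (simp add: numeral_2_eq_2)
  also have "\<dots> = real (card (overlap_tuples m n 2 2)) * weight_avg m n a 2 2"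
    by (rule sum_overlap_eq_weight_avg)
  also have "\<dots> \<le> real (n\<^sup>2 * (m * ((m - 1) * N)) ^ 2) * weight_avg m n a 2 2"
    unfolding N_def by (intro mult_right_mono weight_avg_nonneg of_nat_mono card_overlap_two) auto
  also have "\<dots> \<le> real (n\<^sup>2 * (m * (m * N)) ^ 2) * weight_avg m n a 2 2"
    by (intro mult_right_mono weight_avg_nonneg of_nat_mono mult_left_mono power_mono) auto
  finally have "c\<^sup>2 * (\<Sum>(I, J)\<in>?D. \<bar>a I\<bar> * \<bar>a J\<bar>) \<le> c\<^sup>2 * (real (n\<^sup>2 * (m * (m * N)) ^ 2) * weight_avg m n a 2 2)"
    by (intro mult_left_mono) auto
  also have "\<dots> = real m ^ 4 * weight_avg m n a 2 2 * (c * real N * real n)\<^sup>2"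
    by (simp add: power_mult_distrib numeral_eq_Suc algebra_simps)
  also have "\<dots> \<le> real m ^ 4 * weight_avg m n a 2 2 * (2 / real n)\<^sup>2"
  proof (intro mult_left_mono power_mono)
    have "c * real N * real n = 1 / real (n - 1)" using cN n by (simp add: field_simps)
    also have "\<dots> \<le> 2 / real n" using n by (simp add: field_simps of_nat_diff)
    finally show "c * real N * real n \<le> 2 / real n" .
    show "0 \<le> c * real N * real n" by (simp add: c_def)
  qed (auto intro!: mult_nonneg_nonneg weight_avg_nonneg)
  also have "\<dots> = 4 * real m ^ 4 / (real n)\<^sup>2 * weight_avg m n a 2 2" by (simp add: power_divide)
  finally show ?thesis by (simp add: c_def)
qed

section \<open>Integrating out independent variables\<close>

context prob_space
begin

lemma indep_var_Fubini:
  fixes F :: "'b \<times> 'b \<Rightarrow> real" and G :: "'b \<times> 'b \<Rightarrow> ennreal"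
  assumes ind: "indep_var S U T W"
  shows "F \<in> borel_measurable (S \<Otimes>\<^sub>M T) \<Longrightarrow> integrable M (\<lambda>w. F (U w, W w)) \<Longrightarrow>
      expectation (\<lambda>w. F (U w, W w)) = expectation (\<lambda>w. \<integral>y. F (U w, y) \<partial>distr M T W)"
    and "G \<in> borel_measurable (S \<Otimes>\<^sub>M T) \<Longrightarrow>
      (\<integral>\<^sup>+w. G (U w, W w) \<partial>M) = (\<integral>\<^sup>+w. \<integral>\<^sup>+y. G (U w, y) \<partial>distr M T W \<partial>M)"
proof -
  let ?S = "distr M S U" and ?T = "distr M T W"
  have U: "U \<in> M \<rightarrow>\<^sub>M S" and W: "W \<in> M \<rightarrow>\<^sub>M T"
    and eq: "?S \<Otimes>\<^sub>M ?T = distr M (S \<Otimes>\<^sub>M T) (\<lambda>w. (U w, W w))"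
    using ind unfolding indep_var_distribution_eq by auto
  have UW: "(\<lambda>w. (U w, W w)) \<in> M \<rightarrow>\<^sub>M S \<Otimes>\<^sub>M T" using U W by measurable
  interpret U: prob_space ?S by (rule prob_space_distr[OF U])
  interpret W: prob_space ?T by (rule prob_space_distr[OF W])
  interpret pair_sigma_finite ?S ?T ..
  show "expectation (\<lambda>w. F (U w, W w)) = expectation (\<lambda>w. \<integral>y. F (U w, y) \<partial>?T)"
    if F: "F \<in> borel_measurable (S \<Otimes>\<^sub>M T)" and int: "integrable M (\<lambda>w. F (U w, W w))"
  proof -
    have i: "integrable (?S \<Otimes>\<^sub>M ?T) F"
      unfolding eq by (subst integrable_distr_eq[OF UW F]) (rule int)
    have F': "case_prod (\<lambda>u y. F (u, y)) \<in> borel_measurable (S \<Otimes>\<^sub>M ?T)"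
      using F by (simp cong: measurable_cong_sets)
    have "expectation (\<lambda>w. F (U w, W w)) = (\<integral>z. F z \<partial>(?S \<Otimes>\<^sub>M ?T))"
      unfolding eq by (subst integral_distr[OF UW F]) simp
    also have "\<dots> = (\<integral>u. \<integral>y. F (u, y) \<partial>?T \<partial>?S)" by (rule integral_fst'[symmetric, OF i])
    also have "\<dots> = expectation (\<lambda>w. \<integral>y. F (U w, y) \<partial>?T)"
      by (rule integral_distr[OF U W.borel_measurable_lebesgue_integral[OF F']])
    finally show ?thesis .
  qed
  show "(\<integral>\<^sup>+w. G (U w, W w) \<partial>M) = (\<integral>\<^sup>+w. \<integral>\<^sup>+y. G (U w, y) \<partial>?T \<partial>M)" if G: "G \<in> borel_measurable (S \<Otimes>\<^sub>M T)"
  proof -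
    have G1: "G \<in> borel_measurable (S \<Otimes>\<^sub>M ?T)" and G2: "G \<in> borel_measurable (?S \<Otimes>\<^sub>M ?T)"
      using G by (simp_all cong: measurable_cong_sets)
    have "(\<integral>\<^sup>+w. G (U w, W w) \<partial>M) = (\<integral>\<^sup>+z. G z \<partial>(?S \<Otimes>\<^sub>M ?T))"
      unfolding eq by (subst nn_integral_distr[OF UW]) (use G in simp_all)
    also have "\<dots> = (\<integral>\<^sup>+u. \<integral>\<^sup>+y. G (u, y) \<partial>?T \<partial>?S)"
      by (rule W.nn_integral_fst[symmetric, OF G2])
    also have "\<dots> = (\<integral>\<^sup>+w. \<integral>\<^sup>+y. G (U w, y) \<partial>?T \<partial>M)"
      by (subst nn_integral_distr[OF U]) (use W.borel_measurable_nn_integral_fst[OF G1] in simp_all)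
    finally show ?thesis .
  qed
qed

lemma square_expectation_le:
  fixes f :: "'a \<Rightarrow> real"
  assumes f: "f \<in> borel_measurable M" and i: "integrable M (\<lambda>x. (f x)\<^sup>2)"
  shows "(expectation f)\<^sup>2 \<le> expectation (\<lambda>x. (f x)\<^sup>2)"
proof -
  have "\<bar>expectation f\<bar> \<le> sqrt (expectation (\<lambda>x. (f x)\<^sup>2))"
    using integral_abs_bound[of M f] expectation_abs_le_sqrt[OF f i] by linarith
  then have "\<bar>expectation f\<bar>\<^sup>2 \<le> (sqrt (expectation (\<lambda>x. (f x)\<^sup>2)))\<^sup>2" by (intro power_mono) auto
  then show ?thesis by simp
qed

text \<open>
  The right-hand side is infinite if the fourth power is not integrable. In this form Jensen's
  inequality applies to the section of the kernel at every point.
\<close>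

lemma expectation_power4_le:
  fixes f :: "'a \<Rightarrow> real"
  assumes f [measurable]: "f \<in> borel_measurable M"
  shows "ennreal ((expectation f) ^ 4) \<le> (\<integral>\<^sup>+x. ennreal ((f x) ^ 4) \<partial>M)"
proof (cases "integrable M (\<lambda>x. (f x) ^ 4)")
  case True
  then have i4: "integrable M (\<lambda>x. \<bar>f x\<bar> ^ 4)" by simp
  have i2: "integrable M (\<lambda>x. (f x)\<^sup>2)" using abs_power_integrable_mono(1)[OF f i4, of 2] by simp
  have i22: "integrable M (\<lambda>x. ((f x)\<^sup>2)\<^sup>2)" using True by simp
  have "(expectation f) ^ 4 = ((expectation f)\<^sup>2)\<^sup>2" by simp
  also have "\<dots> \<le> (expectation (\<lambda>x. (f x)\<^sup>2))\<^sup>2"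
    by (intro power_mono square_expectation_le[OF f i2]) auto
  also have "\<dots> \<le> expectation (\<lambda>x. ((f x)\<^sup>2)\<^sup>2)"
    by (rule square_expectation_le[OF _ i22]) measurable
  also have "\<dots> = expectation (\<lambda>x. (f x) ^ 4)" by simp
  finally show ?thesis
    using True by (subst nn_integral_eq_integral) (auto intro!: ennreal_leI)
next
  case False
  then have "(\<integral>\<^sup>+x. ennreal ((f x) ^ 4) \<partial>M) = \<infinity>"
    by (simp add: integrable_iff_bounded) (simp add: less_top[symmetric])
  then show ?thesis by simp
qed

text \<open>
  Young's inequality with the right scale gives the exact bounds of Lyapunov's inequality, for
  instance \<open>4 * s * y\<^sup>3 \<le> 3 * y\<^sup>4 + s\<^sup>4\<close>.
\<close>

lemma moments_from_fourth:
  fixes Y :: "'a \<Rightarrow> real"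
  assumes Y [measurable]: "Y \<in> borel_measurable M" and int: "integrable M (\<lambda>w. Y w ^ 4)"
    and bound: "expectation (\<lambda>w. Y w ^ 4) \<le> s ^ 4" and s: "s > 0"
  shows "integrable M (\<lambda>w. \<bar>Y w\<bar> ^ 3)" "expectation (\<lambda>w. \<bar>Y w\<bar> ^ 3) \<le> s ^ 3"
    and "integrable M (\<lambda>w. (Y w)\<^sup>2)" "expectation (\<lambda>w. (Y w)\<^sup>2) \<le> s\<^sup>2"
    and "integrable M Y" "\<bar>expectation Y\<bar> \<le> s"
proof -
  have i4: "integrable M (\<lambda>w. \<bar>Y w\<bar> ^ 4)" using int by simp
  note i = abs_power_integrable_mono[OF Y i4]
  show i3: "integrable M (\<lambda>w. \<bar>Y w\<bar> ^ 3)" and i2: "integrable M (\<lambda>w. (Y w)\<^sup>2)" and i1: "integrable M Y"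
    using i(2)[of 3] i(1)[of 2] i(1)[of 1] by auto
  have "4 * s * expectation (\<lambda>w. \<bar>Y w\<bar> ^ 3) = expectation (\<lambda>w. 4 * s * \<bar>Y w\<bar> ^ 3)" by simp
  also have "\<dots> \<le> expectation (\<lambda>w. 3 * Y w ^ 4 + s ^ 4)"
  proof (rule integral_mono)
    fix w
    have "0 \<le> (\<bar>Y w\<bar> - s)\<^sup>2 * (3 * \<bar>Y w\<bar>\<^sup>2 + 2 * s * \<bar>Y w\<bar> + s\<^sup>2)" using s by (intro mult_nonneg_nonneg) auto
    also have "\<dots> = 3 * \<bar>Y w\<bar> ^ 4 + s ^ 4 - 4 * s * \<bar>Y w\<bar> ^ 3" by algebra
    finally show "4 * s * \<bar>Y w\<bar> ^ 3 \<le> 3 * Y w ^ 4 + s ^ 4" by simp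
  qed (use i3 int in auto)
  also have "\<dots> \<le> 4 * s * s ^ 3" using int bound by (simp add: prob_space numeral_eq_Suc)
  finally show "expectation (\<lambda>w. \<bar>Y w\<bar> ^ 3) \<le> s ^ 3" using s by (simp only: mult_le_cancel_left_pos mult_pos_pos zero_less_numeral)
  have "2 * s\<^sup>2 * expectation (\<lambda>w. (Y w)\<^sup>2) = expectation (\<lambda>w. 2 * s\<^sup>2 * (Y w)\<^sup>2)" by simp
  also have "\<dots> \<le> expectation (\<lambda>w. Y w ^ 4 + s ^ 4)"
  proof (rule integral_mono)
    fix w
    have "0 \<le> ((Y w)\<^sup>2 - s\<^sup>2)\<^sup>2" by simp
    also have "\<dots> = Y w ^ 4 + s ^ 4 - 2 * s\<^sup>2 * (Y w)\<^sup>2" by algebra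
    finally show "2 * s\<^sup>2 * (Y w)\<^sup>2 \<le> Y w ^ 4 + s ^ 4" by simp
  qed (use i2 int in auto)
  also have "\<dots> \<le> s ^ 4 + s ^ 4" using int bound by (simp add: prob_space)
  also have "\<dots> = 2 * s\<^sup>2 * s\<^sup>2" by algebra
  finally show m2: "expectation (\<lambda>w. (Y w)\<^sup>2) \<le> s\<^sup>2"
    using s by (simp only: mult_le_cancel_left_pos mult_pos_pos zero_less_numeral zero_less_power)
  have "\<bar>expectation Y\<bar>\<^sup>2 \<le> s\<^sup>2" using square_expectation_le[OF Y i2] m2 by simp
  then show "\<bar>expectation Y\<bar> \<le> s" by (rule power2_le_imp_le) (use s in simp)
qed

text \<open>
  The case \<open>r = 0\<close> is the kernel of one argument, for which nothing is integrated out.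
\<close>

lemma distr_tuple_eq_PiM:
  assumes ind: "indep_vars (\<lambda>_. N) X S" and J: "\<And>k. k \<in> {1..r} \<Longrightarrow> J k \<in> S" "inj_on J {1..r::nat}"
  shows "distr M (PiM {1..r} (\<lambda>_. N)) (\<lambda>w. \<lambda>k\<in>{1..r}. X (J k) w) = PiM {1..r} (\<lambda>k. distr M N (X (J k)))"
proof (cases "r = 0")
  case True
  show ?thesis
  proof (rule measure_eqI)
    fix A assume "A \<in> sets (distr M (PiM {1..r} (\<lambda>_. N)) (\<lambda>w. \<lambda>k\<in>{1..r}. X (J k) w))"
    then have "A = {} \<or> A = {\<lambda>_. undefined}" using True by (auto simp: PiM_empty)
    then show "emeasure (distr M (PiM {1..r} (\<lambda>_. N)) (\<lambda>w. \<lambda>k\<in>{1..r}. X (J k) w)) A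
       = emeasure (PiM {1..r} (\<lambda>k. distr M N (X (J k)))) A"
      using True by (auto simp: PiM_empty emeasure_distr emeasure_space_1 restrict_def)
  qed (simp add: True PiM_empty)
next
  case False
  have "indep_vars (\<lambda>k. PiM {J k} (\<lambda>_. N)) (\<lambda>k w. restrict (\<lambda>i. X i w) {J k}) {1..r}"
  proof (rule indep_vars_restrict[OF ind])
    show "{J k} \<subseteq> S" if "k \<in> {1..r}" for k using J(1)[OF that] by simp
    show "disjoint_family_on (\<lambda>k. {J k}) {1..r}"
      unfolding disjoint_family_on_def using inj_onD[OF J(2)] by blast
  qed
  then have "indep_vars (\<lambda>_. N) (\<lambda>k w. (restrict (\<lambda>i. X i w) {J k}) (J k)) {1..r}"
    by (rule indep_vars_compose2[where Y = "\<lambda>k f. f (J k)"]) (rule measurable_component_singleton, simp)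
  then have ind': "indep_vars (\<lambda>_. N) (\<lambda>k. X (J k)) {1..r}" by simp
  moreover have "X (J k) \<in> M \<rightarrow>\<^sub>M N" if "k \<in> {1..r}" for k
    using ind J(1)[OF that] unfolding indep_vars_def by auto
  ultimately show ?thesis
    using indep_vars_iff_distr_eq_PiM'[where I = "{1..r}" and M' = "\<lambda>_. N" and X = "\<lambda>k. X (J k)"] False by auto
qed

lemma indep_var_restrict_tuple:
  assumes ind: "indep_vars (\<lambda>_. N) X S" and A: "A \<subseteq> S"
    and J: "\<And>k. k \<in> {1..r} \<Longrightarrow> J k \<in> S - A"
  shows "indep_var (PiM A (\<lambda>_. N)) (\<lambda>w. restrict (\<lambda>i. X i w) A)
     (PiM {1..r::nat} (\<lambda>_. N)) (\<lambda>w. \<lambda>k\<in>{1..r}. X (J k) w)"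
proof -
  have "indep_var (PiM A (\<lambda>_. N)) (\<lambda>w. restrict (\<lambda>i. X i w) A)
      (PiM (S - A) (\<lambda>_. N)) (\<lambda>w. restrict (\<lambda>i. X i w) (S - A))"
    by (rule indep_var_restrict[OF ind]) (use A in auto)
  moreover have "(\<lambda>f. \<lambda>k\<in>{1..r}. f (J k)) \<in> PiM (S - A) (\<lambda>_. N) \<rightarrow>\<^sub>M PiM {1..r} (\<lambda>_. N)"
    by (intro measurable_restrict measurable_component_singleton J)
  ultimately have "indep_var (PiM A (\<lambda>_. N)) ((\<lambda>x. x) \<circ> (\<lambda>w. restrict (\<lambda>i. X i w) A))
      (PiM {1..r} (\<lambda>_. N)) ((\<lambda>f. \<lambda>k\<in>{1..r}. f (J k)) \<circ> (\<lambda>w. restrict (\<lambda>i. X i w) (S - A)))"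
    by (intro indep_var_compose) auto
  moreover have "(\<lambda>f. \<lambda>k\<in>{1..r}. f (J k)) \<circ> (\<lambda>w. restrict (\<lambda>i. X i w) (S - A)) = (\<lambda>w. \<lambda>k\<in>{1..r}. X (J k) w)"
    using J by (fastforce simp: fun_eq_iff restrict_def)
  ultimately show ?thesis by (simp add: o_def)
qed

end

section \<open>First-order projections of the kernel\<close>

text \<open>
  One row of the array. The number \<open>s\<close> stands for \<open>M powr (1/4)\<close>, so that the bounds on the moments
  of order \<open>p\<close> read \<open>s ^ p\<close>.
\<close>

locale ustat_row = prob_space P for P :: "'w measure" +
  fixes N :: "'x measure" and X :: "nat \<Rightarrow> 'w \<Rightarrow> 'x" and h :: "(nat \<Rightarrow> 'x) \<Rightarrow> real"
    and m n :: nat and s :: real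
  assumes m: "1 \<le> m" and mn: "m \<le> n"
    and indep: "indep_vars (\<lambda>_. N) X {1..n}"
    and h_meas: "h \<in> borel_measurable (PiM {1..m} (\<lambda>_. N))"
    and s: "s > 0"
    and moment: "\<And>i. i \<in> inj_tuples m {1..n} \<Longrightarrow>
      integrable P (\<lambda>w. kernel_at m X h i w ^ 4) \<and> expectation (\<lambda>w. kernel_at m X h i w ^ 4) \<le> s ^ 4"
begin

abbreviation rest_space :: "(nat \<Rightarrow> 'x) measure" where
  "rest_space \<equiv> PiM {1..m - 1} (\<lambda>_. N)"

abbreviation tuples :: "(nat \<Rightarrow> nat) set" where
  "tuples \<equiv> inj_tuples m {1..n}"

definition section_at :: "nat \<Rightarrow> (nat \<Rightarrow> nat) \<Rightarrow> 'x \<Rightarrow> real" where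
  "section_at l I = kernel_section m P N X h l (tuple_delete m l I)"

definition proj :: "nat \<Rightarrow> (nat \<Rightarrow> nat) \<Rightarrow> 'x \<Rightarrow> real" where
  "proj l I x = section_at l I x - kernel_mean m P X h I"

text \<open>
  The kernel minus its constant and first-order terms in the Hoeffding decomposition.
\<close>

definition remainder :: "(nat \<Rightarrow> nat) \<Rightarrow> 'w \<Rightarrow> real" where
  "remainder I w = kernel_at m X h I w - kernel_mean m P X h I - (\<Sum>l=1..m. proj l I (X (I l) w))"

lemma X_meas: "i \<in> {1..n} \<Longrightarrow> X i \<in> P \<rightarrow>\<^sub>M N"
  using indep unfolding indep_vars_def by auto

lemma index_in: "I \<in> tuples \<Longrightarrow> k \<in> {1..m} \<Longrightarrow> I k \<in> {1..n}"
  by (rule inj_tuplesD(2))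

lemma kernel_at_meas: "I \<in> tuples \<Longrightarrow> kernel_at m X h I \<in> borel_measurable P"
  unfolding kernel_at_def[abs_def]
  by (intro measurable_compose[OF _ h_meas] measurable_restrict X_meas index_in)

lemma kernel_moments:
  assumes I: "I \<in> tuples"
  shows "integrable P (\<lambda>w. (kernel_at m X h I w)\<^sup>2)" "expectation (\<lambda>w. (kernel_at m X h I w)\<^sup>2) \<le> s\<^sup>2"
    and "integrable P (kernel_at m X h I)" "\<bar>kernel_mean m P X h I\<bar> \<le> s"
  using moments_from_fourth[OF kernel_at_meas[OF I] _ _ s] moment[OF I] unfolding kernel_mean_def by auto

lemma tuple_insert_meas:
  assumes l: "l \<in> {1..m}"
  shows "(\<lambda>z. tuple_insert m l (fst z) (snd z)) \<in> N \<Otimes>\<^sub>M rest_space \<rightarrow>\<^sub>M PiM {1..m} (\<lambda>_. N)"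
  unfolding tuple_insert_def
proof (rule measurable_restrict)
  fix k assume k: "k \<in> {1..m}"
  have snd: "(\<lambda>z. snd z j) \<in> N \<Otimes>\<^sub>M rest_space \<rightarrow>\<^sub>M N" if "j \<in> {1..m - 1}" for j
    by (rule measurable_compose[OF measurable_snd measurable_component_singleton[OF that]])
  consider "k < l" | "k = l" | "l < k" by linarith
  then show "(\<lambda>z. if k < l then snd z k else if k = l then fst z else snd z (k - 1))
      \<in> N \<Otimes>\<^sub>M rest_space \<rightarrow>\<^sub>M N"
  proof cases
    case 1
    then show ?thesis using snd[of k] l k by simp
  next
    case 3
    then have "k - 1 \<in> {1..m - 1}" using l k by auto
    from snd[OF this] show ?thesis using 3 by simp
  qed simp
qed

context
  fixes I l
  assumes I: "I \<in> tuples" and l: "l \<in> {1..m}"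
begin

definition others :: "'w \<Rightarrow> nat \<Rightarrow> 'x" where
  "others w = (\<lambda>k\<in>{1..m - 1}. X (tuple_delete m l I k) w)"

lemma delete_in: "k \<in> {1..m - 1} \<Longrightarrow> tuple_delete m l I k \<in> {1..n} - {I l}"
  by (rule inj_tuplesD(2)[OF tuple_delete_inj_tuples[OF I l]])

lemma others_meas: "others \<in> P \<rightarrow>\<^sub>M rest_space"
  unfolding others_def[abs_def] using delete_in by (intro measurable_restrict X_meas) auto

lemma section_at_eq:
  "section_at l I x = (\<integral>y. h (tuple_insert m l x y) \<partial>distr P rest_space others)"
proof -
  have "distr P rest_space others = PiM {1..m - 1} (\<lambda>k. distr P N (X (tuple_delete m l I k)))"
    unfolding others_def[abs_def]
    using inj_tuplesD(2,3)[OF tuple_delete_inj_tuples[OF I l]] by (intro distr_tuple_eq_PiM[OF indep]) auto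
  then show ?thesis by (simp add: section_at_def kernel_section_def)
qed

lemma kernel_at_split: "kernel_at m X h I w = h (tuple_insert m l (X (I l) w) (others w))"
proof -
  have "(\<lambda>k\<in>{1..m}. X (I k) w) = tuple_insert m l (X (I l) w) (others w)"
  proof
    fix k
    show "(\<lambda>k\<in>{1..m}. X (I k) w) k = tuple_insert m l (X (I l) w) (others w) k"
      using l by (cases "k \<in> {1..m}") (auto simp: tuple_insert_def others_def tuple_delete_def)
  qed
  then show ?thesis by (simp add: kernel_at_def)
qed

lemma kernel_insert_meas:
  "(\<lambda>z. h (tuple_insert m l (fst z) (snd z))) \<in> borel_measurable (N \<Otimes>\<^sub>M rest_space)"
  by (rule measurable_compose[OF tuple_insert_meas[OF l] h_meas])

lemma section_at_meas: "section_at l I \<in> borel_measurable N"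
proof -
  interpret Q: prob_space "distr P rest_space others" by (rule prob_space_distr[OF others_meas])
  have "(\<lambda>x. \<integral>y. h (tuple_insert m l x y) \<partial>distr P rest_space others) \<in> borel_measurable N"
    using kernel_insert_meas
    by (intro Q.borel_measurable_lebesgue_integral) (simp add: case_prod_unfold cong: measurable_cong_sets)
  then show ?thesis by (simp add: section_at_eq[abs_def])
qed

lemma proj_meas: "proj l I \<in> borel_measurable N"
  unfolding proj_def[abs_def] using section_at_meas by measurable

lemma projX_meas: "(\<lambda>w. section_at l I (X (I l) w)) \<in> borel_measurable P" "(\<lambda>w. proj l I (X (I l) w)) \<in> borel_measurable P"
  using measurable_compose[OF X_meas[OF index_in[OF I l]]] section_at_meas proj_meas by auto

text \<open>
  The section of the kernel at the \<open>l\<close>-th argument is the conditional expectation of the kernel given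
  any set of observations that contains the \<open>l\<close>-th argument and none of the others.
\<close>

lemma expectation_times_kernel:
  assumes A: "A \<subseteq> {1..n}" "I l \<in> A" "A \<inter> I ` ({1..m} - {l}) = {}"
    and \<phi>: "\<phi> \<in> borel_measurable (PiM A (\<lambda>_. N))"
    and int: "integrable P (\<lambda>w. \<phi> (restrict (\<lambda>i. X i w) A) * kernel_at m X h I w)"
  shows "expectation (\<lambda>w. \<phi> (restrict (\<lambda>i. X i w) A) * kernel_at m X h I w)
       = expectation (\<lambda>w. \<phi> (restrict (\<lambda>i. X i w) A) * section_at l I (X (I l) w))"
proof -
  let ?U = "\<lambda>w. restrict (\<lambda>i. X i w) A"
  have dl: "tuple_delete m l I k \<in> {1..n} - A" if "k \<in> {1..m - 1}" for k
    using that delete_in[OF that] tuple_delete_image[OF l, of I] A(3) by blast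
  have ind: "indep_var (PiM A (\<lambda>_. N)) ?U rest_space others"
    unfolding others_def[abs_def] by (rule indep_var_restrict_tuple[OF indep A(1) dl])
  let ?F = "\<lambda>z. \<phi> (fst z) * h (tuple_insert m l (fst z (I l)) (snd z))"
  have "(\<lambda>z. (fst z (I l), snd z)) \<in> PiM A (\<lambda>_. N) \<Otimes>\<^sub>M rest_space \<rightarrow>\<^sub>M N \<Otimes>\<^sub>M rest_space"
    by (intro measurable_Pair measurable_snd measurable_compose[OF measurable_fst measurable_component_singleton[OF A(2)]])
  from measurable_compose[OF this kernel_insert_meas]
  have F: "?F \<in> borel_measurable (PiM A (\<lambda>_. N) \<Otimes>\<^sub>M rest_space)"
    using measurable_compose[OF measurable_fst \<phi>] by (intro borel_measurable_times) auto
  have eq: "?F (?U w, others w) = \<phi> (?U w) * kernel_at m X h I w" for w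
    using A(2) by (simp add: kernel_at_split)
  have "expectation (\<lambda>w. ?F (?U w, others w)) = expectation (\<lambda>w. \<integral>y. ?F (?U w, y) \<partial>distr P rest_space others)"
    by (rule indep_var_Fubini(1)[OF ind F]) (simp only: eq int)
  moreover have "(\<integral>y. ?F (?U w, y) \<partial>distr P rest_space others) = \<phi> (?U w) * section_at l I (X (I l) w)" for w
    using A(2) by (simp add: section_at_eq)
  ultimately show ?thesis by (simp only: eq)
qed

text \<open>
  Jensen's inequality for the inner integral, then Fubini's theorem. With extended nonnegative
  integrals the pointwise bound also holds where the section of the kernel fails to be integrable.
\<close>

lemma section_at_moment:
  "integrable P (\<lambda>w. section_at l I (X (I l) w) ^ 4)" (is ?int)
  "expectation (\<lambda>w. section_at l I (X (I l) w) ^ 4) \<le> s ^ 4" (is ?bnd)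
proof -
  let ?Q = "distr P rest_space others"
  interpret Q: prob_space ?Q by (rule prob_space_distr[OF others_meas])
  note meas = projX_meas(1)
  let ?U = "\<lambda>w. restrict (\<lambda>i. X i w) {I l}"
  have ind: "indep_var (PiM {I l} (\<lambda>_. N)) ?U rest_space others"
    unfolding others_def[abs_def]
    by (rule indep_var_restrict_tuple[OF indep]) (use index_in[OF I l] delete_in in auto)
  let ?F = "\<lambda>z. ennreal ((h (tuple_insert m l (fst z (I l)) (snd z))) ^ 4)"
  have "(\<lambda>z. (fst z (I l), snd z)) \<in> PiM {I l} (\<lambda>_. N) \<Otimes>\<^sub>M rest_space \<rightarrow>\<^sub>M N \<Otimes>\<^sub>M rest_space"
    by (intro measurable_Pair measurable_snd measurable_compose[OF measurable_fst measurable_component_singleton]) simp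
  from measurable_compose[OF this kernel_insert_meas]
  have F: "?F \<in> borel_measurable (PiM {I l} (\<lambda>_. N) \<Otimes>\<^sub>M rest_space)" by simp
  have "(\<integral>\<^sup>+w. ennreal (section_at l I (X (I l) w) ^ 4) \<partial>P)
      \<le> (\<integral>\<^sup>+w. \<integral>\<^sup>+y. ?F (?U w, y) \<partial>?Q \<partial>P)"
  proof (rule nn_integral_mono)
    fix w assume "w \<in> space P"
    then have x: "X (I l) w \<in> space N" using measurable_space[OF X_meas[OF index_in[OF I l]]] by blast
    have "(\<lambda>y. (X (I l) w, y)) \<in> rest_space \<rightarrow>\<^sub>M N \<Otimes>\<^sub>M rest_space"
      using x by simp
    from measurable_compose[OF this kernel_insert_meas]
    have "(\<lambda>y. h (tuple_insert m l (X (I l) w) y)) \<in> borel_measurable ?Q" by simp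
    from Q.expectation_power4_le[OF this]
    show "ennreal (section_at l I (X (I l) w) ^ 4) \<le> (\<integral>\<^sup>+y. ?F (?U w, y) \<partial>?Q)"
      by (simp add: section_at_eq)
  qed
  also have "\<dots> = (\<integral>\<^sup>+w. ?F (?U w, others w) \<partial>P)" by (rule indep_var_Fubini(2)[OF ind F, symmetric])
  also have "\<dots> = (\<integral>\<^sup>+w. ennreal (kernel_at m X h I w ^ 4) \<partial>P)" by (simp add: kernel_at_split)
  also have "\<dots> = ennreal (expectation (\<lambda>w. kernel_at m X h I w ^ 4))"
    using moment[OF I] by (intro nn_integral_eq_integral) auto
  also have "\<dots> \<le> ennreal (s ^ 4)" using moment[OF I] by (intro ennreal_leI) simp
  finally have le: "(\<integral>\<^sup>+w. ennreal (section_at l I (X (I l) w) ^ 4) \<partial>P) \<le> ennreal (s ^ 4)" .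
  show int: ?int
    using meas order.strict_trans1[OF le ennreal_less_top] by (simp add: integrable_iff_bounded)
  have "ennreal (expectation (\<lambda>w. section_at l I (X (I l) w) ^ 4)) \<le> ennreal (s ^ 4)"
    using le by (subst nn_integral_eq_integral[symmetric, OF int]) auto
  then show ?bnd using s by (simp add: ennreal_le_iff)
qed

lemma proj_mean: "expectation (\<lambda>w. proj l I (X (I l) w)) = 0"
proof -
  have "A \<inter> I ` ({1..m} - {l}) = {}" if "A = {I l}" for A
    using inj_onD[OF inj_tuplesD(3)[OF I]] l that by auto
  then have "kernel_mean m P X h I = expectation (\<lambda>w. section_at l I (X (I l) w))"
    using expectation_times_kernel[of "{I l}" "\<lambda>_. 1"] index_in[OF I l] kernel_moments(3)[OF I]
    by (simp add: kernel_mean_def)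
  moreover have "integrable P (\<lambda>w. section_at l I (X (I l) w))"
    by (rule moments_from_fourth(5)[OF projX_meas(1) section_at_moment s])
  ultimately show ?thesis unfolding proj_def by (simp add: prob_space)
qed

lemma proj_moment:
  "integrable P (\<lambda>w. proj l I (X (I l) w) ^ 4)"
  "expectation (\<lambda>w. proj l I (X (I l) w) ^ 4) \<le> (2 * s) ^ 4"
proof -
  let ?t = "kernel_mean m P X h I"
  have pw: "(f - t) ^ 4 \<le> 8 * f ^ 4 + 8 * t ^ 4" for f t :: real
  proof -
    have "(f - t)\<^sup>2 \<le> 2 * f\<^sup>2 + 2 * t\<^sup>2" using sum_squares_bound[of f "- t"] by (simp add: power2_diff)
    then have "((f - t)\<^sup>2)\<^sup>2 \<le> (2 * f\<^sup>2 + 2 * t\<^sup>2)\<^sup>2" by (intro power_mono) auto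
    also have "\<dots> \<le> 8 * (f\<^sup>2)\<^sup>2 + 8 * (t\<^sup>2)\<^sup>2"
      using sum_squares_bound[of "f\<^sup>2" "t\<^sup>2"] by (simp add: power2_sum power_mult_distrib)
    finally show ?thesis by simp
  qed
  have i: "integrable P (\<lambda>w. 8 * section_at l I (X (I l) w) ^ 4 + 8 * ?t ^ 4)"
    using section_at_moment(1) by simp
  show int: "integrable P (\<lambda>w. proj l I (X (I l) w) ^ 4)"
    by (rule Bochner_Integration.integrable_bound[OF i])
       (use projX_meas(2) pw[of _ ?t] in \<open>auto simp: proj_def\<close>)
  have "expectation (\<lambda>w. proj l I (X (I l) w) ^ 4) \<le> expectation (\<lambda>w. 8 * section_at l I (X (I l) w) ^ 4 + 8 * ?t ^ 4)"
    by (rule integral_mono[OF int i]) (simp add: proj_def pw)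
  also have "\<dots> = 8 * expectation (\<lambda>w. section_at l I (X (I l) w) ^ 4) + 8 * ?t ^ 4"
    using section_at_moment(1) by (simp add: prob_space)
  also have "?t ^ 4 \<le> s ^ 4" using power_mono[OF kernel_moments(4)[OF I], of 4] by simp
  finally show "expectation (\<lambda>w. proj l I (X (I l) w) ^ 4) \<le> (2 * s) ^ 4"
    using section_at_moment(2) by (simp add: power_mult_distrib)
qed

lemma proj_low_moments:
  "integrable P (\<lambda>w. \<bar>proj l I (X (I l) w)\<bar> ^ 3)" "expectation (\<lambda>w. \<bar>proj l I (X (I l) w)\<bar> ^ 3) \<le> (2 * s) ^ 3"
  "integrable P (\<lambda>w. (proj l I (X (I l) w))\<^sup>2)" "expectation (\<lambda>w. (proj l I (X (I l) w))\<^sup>2) \<le> (2 * s)\<^sup>2"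
  "integrable P (\<lambda>w. proj l I (X (I l) w))"
  using moments_from_fourth[OF projX_meas(2) proj_moment] s by auto

end

section \<open>The remainder of the projection\<close>

lemma remainder_meas: "I \<in> tuples \<Longrightarrow> remainder I \<in> borel_measurable P"
  unfolding remainder_def[abs_def]
  using kernel_at_meas[of I] projX_meas(2)[of I] by (intro borel_measurable_diff borel_measurable_sum) auto

lemma remainder_square:
  assumes I: "I \<in> tuples"
  shows "integrable P (\<lambda>w. (remainder I w)\<^sup>2)"
    and "expectation (\<lambda>w. (remainder I w)\<^sup>2) \<le> (8 + 8 * (real m)\<^sup>2) * s\<^sup>2"
proof -
  let ?p = "\<lambda>l w. proj l I (X (I l) w)" and ?t = "kernel_mean m P X h I"
  let ?B = "\<lambda>w. 4 * (kernel_at m X h I w)\<^sup>2 + 4 * ?t\<^sup>2 + 2 * real m * (\<Sum>l=1..m. (?p l w)\<^sup>2)"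
  have two: "(x - y)\<^sup>2 \<le> 2 * x\<^sup>2 + 2 * y\<^sup>2" for x y :: real
    using sum_squares_bound[of x "- y"] by (simp add: power2_diff)
  have bnd: "(remainder I w)\<^sup>2 \<le> ?B w" for w
  proof -
    have "(remainder I w)\<^sup>2 \<le> 2 * (kernel_at m X h I w - ?t)\<^sup>2 + 2 * (\<Sum>l=1..m. ?p l w)\<^sup>2"
      unfolding remainder_def by (rule two)
    also have "(\<Sum>l=1..m. ?p l w)\<^sup>2 \<le> real m * (\<Sum>l=1..m. (?p l w)\<^sup>2)"
      using sum_squared_le_sum_of_squares[of "\<lambda>l. ?p l w" "{1..m}"] by (simp add: mult.commute)
    also have "(kernel_at m X h I w - ?t)\<^sup>2 \<le> 2 * (kernel_at m X h I w)\<^sup>2 + 2 * ?t\<^sup>2" by (rule two)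
    finally show ?thesis by simp
  qed
  have ip: "integrable P (\<lambda>w. (?p l w)\<^sup>2)" if "l \<in> {1..m}" for l
    using proj_low_moments(3)[OF I that] .
  have isum: "integrable P (\<lambda>w. \<Sum>l=1..m. (?p l w)\<^sup>2)" by (intro Bochner_Integration.integrable_sum ip)
  have i: "integrable P ?B" using kernel_moments(1)[OF I] isum by simp
  show int: "integrable P (\<lambda>w. (remainder I w)\<^sup>2)"
    by (rule Bochner_Integration.integrable_bound[OF i]) (use remainder_meas[OF I] order_trans[OF bnd abs_ge_self] in auto)
  have "expectation (\<lambda>w. (remainder I w)\<^sup>2) \<le> expectation ?B"
    using bnd by (intro integral_mono int i)
  also have "\<dots> = 4 * expectation (\<lambda>w. (kernel_at m X h I w)\<^sup>2) + 4 * ?t\<^sup>2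
      + 2 * real m * (\<Sum>l=1..m. expectation (\<lambda>w. (?p l w)\<^sup>2))"
    using kernel_moments(1)[OF I] isum ip by (simp add: prob_space)
  also have "\<dots> \<le> 4 * s\<^sup>2 + 4 * s\<^sup>2 + 2 * real m * (\<Sum>l=1..m. (2 * s)\<^sup>2)"
  proof (intro add_mono mult_left_mono sum_mono)
    show "?t\<^sup>2 \<le> s\<^sup>2" using power_mono[OF kernel_moments(4)[OF I], of 2] by simp
  qed (use kernel_moments(2)[OF I] proj_low_moments(4)[OF I] in auto)
  also have "\<dots> = (8 + 8 * (real m)\<^sup>2) * s\<^sup>2"
    by (simp add: power2_eq_square algebra_simps)
  finally show "expectation (\<lambda>w. (remainder I w)\<^sup>2) \<le> (8 + 8 * (real m)\<^sup>2) * s\<^sup>2" .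
qed

text \<open>
  If the two tuples share at most the index \<open>I l\<close>, the remainder of \<open>J\<close> is a function of observations
  among which only \<open>X (I l)\<close> occurs in the remainder of \<open>I\<close>. So, in inner products with the remainder
  of \<open>J\<close>, the kernel at \<open>I\<close> may be replaced by its section at \<open>l\<close>, which cancels against the
  projection at \<open>l\<close> and the mean, while the projections at the other arguments are independent of the
  remainder of \<open>J\<close> and centred. Disjoint tuples are covered with any choice of \<open>l\<close>.
\<close>

lemma remainder_orthogonal:
  assumes I: "I \<in> tuples" and J: "J \<in> tuples"
    and ov: "card (I ` {1..m} \<inter> J ` {1..m}) \<le> 1"
  shows "expectation (\<lambda>w. remainder I w * remainder J w) = 0"
proof -
  obtain l where l: "l \<in> {1..m}" and sub: "I ` {1..m} \<inter> J ` {1..m} \<subseteq> {I l}"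
  proof (cases "I ` {1..m} \<inter> J ` {1..m} = {}")
    case True
    then show ?thesis using that[of 1] m by auto
  next
    case False
    then obtain x where "x \<in> I ` {1..m}" "x \<in> J ` {1..m}" by blast
    then obtain l where "l \<in> {1..m}" "I l \<in> J ` {1..m}" by blast
    moreover have "\<forall>x\<in>I ` {1..m} \<inter> J ` {1..m}. \<forall>y\<in>I ` {1..m} \<inter> J ` {1..m}. x = y"
      using ov by (subst card_le_Suc0_iff_eq[symmetric]) simp_all
    then have "I ` {1..m} \<inter> J ` {1..m} \<subseteq> {I l}"
      using \<open>l \<in> {1..m}\<close> \<open>I l \<in> J ` {1..m}\<close> by blast
    ultimately show ?thesis using that by blast
  qed
  define B where "B = I ` ({1..m} - {l})"
  define A where "A = {1..n} - B"
  have B: "B \<subseteq> {1..n}" using index_in[OF I] by (auto simp: B_def)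
  have IlB: "I l \<notin> B" using inj_onD[OF inj_tuplesD(3)[OF I]] l by (auto simp: B_def)
  have A: "A \<subseteq> {1..n}" "I l \<in> A" "A \<inter> I ` ({1..m} - {l}) = {}"
    using index_in[OF I l] IlB by (auto simp: A_def B_def)
  have JA: "J k \<in> A" if k: "k \<in> {1..m}" for k
  proof -
    have "J k \<notin> B"
    proof
      assume "J k \<in> B"
      then have "J k \<in> I ` {1..m} \<inter> J ` {1..m}" using k by (auto simp: B_def)
      then have "J k = I l" using sub by blast
      then show False using \<open>J k \<in> B\<close> IlB by simp
    qed
    then show ?thesis using index_in[OF J k] by (simp add: A_def)
  qed
  define \<phi> where "\<phi> u = h (\<lambda>k\<in>{1..m}. u (J k)) - kernel_mean m P X h J - (\<Sum>k=1..m. proj k J (u (J k)))" for u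
  let ?U = "\<lambda>w. restrict (\<lambda>i. X i w) A"
  have \<phi>U: "\<phi> (?U w) = remainder J w" for w
  proof -
    have "(\<lambda>k\<in>{1..m}. ?U w (J k)) = (\<lambda>k\<in>{1..m}. X (J k) w)"
      by (intro restrict_ext) (use JA in simp)
    moreover have "(\<Sum>k=1..m. proj k J (?U w (J k))) = (\<Sum>k=1..m. proj k J (X (J k) w))"
      by (intro sum.cong refl) (use JA in simp)
    ultimately show ?thesis by (simp only: \<phi>_def remainder_def kernel_at_def)
  qed
  have \<phi>: "\<phi> \<in> borel_measurable (PiM A (\<lambda>_. N))"
  proof -
    have "(\<lambda>u. \<lambda>k\<in>{1..m}. u (J k)) \<in> PiM A (\<lambda>_. N) \<rightarrow>\<^sub>M PiM {1..m} (\<lambda>_. N)"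
      by (intro measurable_restrict measurable_component_singleton JA)
    from measurable_compose[OF this h_meas]
    have "(\<lambda>u. h (\<lambda>k\<in>{1..m}. u (J k))) \<in> borel_measurable (PiM A (\<lambda>_. N))" .
    moreover have "(\<lambda>u. proj k J (u (J k))) \<in> borel_measurable (PiM A (\<lambda>_. N))" if k: "k \<in> {1..m}" for k
      by (rule measurable_compose[OF measurable_component_singleton[OF JA[OF k], where M = "\<lambda>_. N"] proj_meas[OF J k]])
    ultimately show ?thesis
      unfolding \<phi>_def by (intro borel_measurable_diff borel_measurable_sum borel_measurable_const) auto
  qed
  let ?R = "remainder J" and ?t = "kernel_mean m P X h I"
  let ?k = "\<lambda>w. ?R w * kernel_at m X h I w" and ?p = "\<lambda>k w. ?R w * proj k I (X (I k) w)"
  note Rm = remainder_meas[OF J] and R2 = remainder_square(1)[OF J]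
  have R1: "integrable P ?R" using square_integrable_imp_integrable[OF Rm R2] .
  have intk: "integrable P ?k"
    by (rule product_of_square_integrable(1)[OF Rm kernel_at_meas[OF I] R2 kernel_moments(1)[OF I]])
  have intp: "integrable P (?p k)" if "k \<in> {1..m}" for k
    by (rule product_of_square_integrable(1)[OF Rm projX_meas(2)[OF I that] R2 proj_low_moments(3)[OF I that]])
  \<comment> \<open>The kernel and its section at \<open>l\<close> have the same inner product with the other remainder.\<close>
  have main: "expectation (?p l)
      = expectation ?k - ?t * expectation ?R"
  proof -
    have "expectation ?k = expectation (\<lambda>w. ?R w * section_at l I (X (I l) w))"
      using expectation_times_kernel[OF I l A \<phi>] intk by (simp only: \<phi>U)
    also have "\<dots> = expectation (\<lambda>w. ?R w * proj l I (X (I l) w) + ?t * ?R w)"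
      by (simp add: proj_def algebra_simps)
    also have "\<dots> = expectation (?p l) + ?t * expectation ?R"
      using intp[OF l] R1 by simp
    finally show ?thesis by simp
  qed
  \<comment> \<open>The other arguments do not occur in the other remainder.\<close>
  have rest: "expectation (?p k) = 0" if k: "k \<in> {1..m} - {l}" for k
  proof -
    have "k \<in> {1..m}" using k by simp
    have "I k \<in> B" using k by (auto simp: B_def)
    have "indep_var (PiM A (\<lambda>_. N)) ?U (PiM B (\<lambda>_. N)) (\<lambda>w. restrict (\<lambda>i. X i w) B)"
      by (rule indep_var_restrict[OF indep]) (use A(1) B in \<open>auto simp: A_def\<close>)
    then have "indep_var borel (\<phi> \<circ> ?U) borel ((\<lambda>f. proj k I (f (I k))) \<circ> (\<lambda>w. restrict (\<lambda>i. X i w) B))"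
      by (rule indep_var_compose[OF _ \<phi> measurable_compose[OF
            measurable_component_singleton[OF \<open>I k \<in> B\<close>, where M = "\<lambda>_. N"] proj_meas[OF I \<open>k \<in> {1..m}\<close>]]])
    then have "indep_var borel ?R borel (\<lambda>w. proj k I (X (I k) w))"
      using \<open>I k \<in> B\<close> by (simp add: o_def \<phi>U)
    from indep_var_lebesgue_integral[OF this R1 proj_low_moments(5)[OF I \<open>k \<in> {1..m}\<close>]]
    show ?thesis using proj_mean[OF I \<open>k \<in> {1..m}\<close>] by simp
  qed
  have "expectation (\<lambda>w. remainder I w * ?R w)
      = expectation (\<lambda>w. ?R w * kernel_at m X h I w - ?t * ?R w - (\<Sum>k=1..m. ?R w * proj k I (X (I k) w)))"
    by (simp add: remainder_def[of I] algebra_simps sum_distrib_left)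
  also have "\<dots> = expectation ?k - ?t * expectation ?R
      - (\<Sum>k=1..m. expectation (?p k))"
  proof -
    have "integrable P (\<lambda>w. \<Sum>k=1..m. ?p k w)"
      by (intro Bochner_Integration.integrable_sum intp)
    moreover have "expectation (\<lambda>w. \<Sum>k=1..m. ?p k w)
        = (\<Sum>k=1..m. expectation (?p k))"
      by (intro Bochner_Integration.integral_sum intp)
    ultimately show ?thesis using intk R1 by simp
  qed
  also have "(\<Sum>k=1..m. expectation (?p k))
      = expectation (?p l)"
    using rest by (subst sum.remove[OF _ l]) auto
  finally show ?thesis using main by simp
qed

lemma weighted_remainder_square:
  fixes a :: "(nat \<Rightarrow> nat) \<Rightarrow> real"
  shows "integrable P (\<lambda>w. (\<Sum>I\<in>tuples. a I * remainder I w)\<^sup>2)"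
    and "expectation (\<lambda>w. (\<Sum>I\<in>tuples. a I * remainder I w)\<^sup>2)
      \<le> (8 + 8 * (real m)\<^sup>2) * s\<^sup>2 *
         (\<Sum>(I, J) | I \<in> tuples \<and> J \<in> tuples \<and> 2 \<le> card (I ` {1..m} \<inter> J ` {1..m}).
              \<bar>a I\<bar> * \<bar>a J\<bar>)"
proof -
  let ?T = "tuples"
  let ?D = "{(I, J). I \<in> ?T \<and> J \<in> ?T \<and> 2 \<le> card (I ` {1..m} \<inter> J ` {1..m})}"
  let ?K = "(8 + 8 * (real m)\<^sup>2) * s\<^sup>2"
  let ?e = "\<lambda>I J. expectation (\<lambda>w. remainder I w * remainder J w)"
  have finT: "finite ?T" by (simp add: finite_inj_tuples)
  have DT: "?D \<subseteq> ?T \<times> ?T" by auto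
  have eq: "(\<Sum>I\<in>?T. a I * remainder I w)\<^sup>2
      = (\<Sum>(I, J)\<in>?T \<times> ?T. a I * a J * (remainder I w * remainder J w))" for w
    by (simp add: power2_eq_square sum_product sum.cartesian_product algebra_simps)
  have ir: "integrable P (\<lambda>w. remainder I w * remainder J w)"
    and br: "\<bar>?e I J\<bar> \<le> ?K" if "I \<in> ?T" "J \<in> ?T" for I J
  proof -
    note rm = remainder_meas[OF that(1)] remainder_meas[OF that(2)]
      remainder_square(1)[OF that(1)] remainder_square(1)[OF that(2)]
    show "integrable P (\<lambda>w. remainder I w * remainder J w)" by (rule product_of_square_integrable(1)[OF rm])
    show "\<bar>?e I J\<bar> \<le> ?K"
    proof -
      have "\<bar>?e I J\<bar>
          \<le> (expectation (\<lambda>w. (remainder I w)\<^sup>2) + expectation (\<lambda>w. (remainder J w)\<^sup>2)) / 2"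
        by (rule product_of_square_integrable(2)[OF rm])
      also have "\<dots> \<le> (?K + ?K) / 2"
        by (intro divide_right_mono add_mono remainder_square(2) that) simp
      finally show ?thesis by (simp add: mult.commute)
    qed
  qed
  show "integrable P (\<lambda>w. (\<Sum>I\<in>?T. a I * remainder I w)\<^sup>2)"
    unfolding eq by (intro Bochner_Integration.integrable_sum) (auto intro!: integrable_mult_right ir split: prod.splits)
  have "expectation (\<lambda>w. (\<Sum>I\<in>?T. a I * remainder I w)\<^sup>2)
      = (\<Sum>z\<in>?T \<times> ?T. expectation (\<lambda>w. case z of (I, J) \<Rightarrow> a I * a J * (remainder I w * remainder J w)))"
    unfolding eq by (intro Bochner_Integration.integral_sum) (auto intro!: integrable_mult_right ir)
  also have "\<dots> = (\<Sum>(I, J)\<in>?T \<times> ?T. a I * a J * ?e I J)"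
    by (intro sum.cong refl) (auto simp: split_beta)
  also have "\<dots> = (\<Sum>(I, J)\<in>?D. a I * a J * ?e I J)"
  proof (rule sum.mono_neutral_right)
    show "\<forall>z\<in>?T \<times> ?T - ?D. (case z of (I, J) \<Rightarrow> a I * a J * ?e I J) = 0"
    proof
      fix z assume "z \<in> ?T \<times> ?T - ?D"
      then obtain I J where z: "z = (I, J)" "I \<in> ?T" "J \<in> ?T" "\<not> 2 \<le> card (I ` {1..m} \<inter> J ` {1..m})" by blast
      then have "card (I ` {1..m} \<inter> J ` {1..m}) \<le> 1" by linarith
      from remainder_orthogonal[OF z(2,3) this]
      show "(case z of (I, J) \<Rightarrow> a I * a J * ?e I J) = 0"
        by (simp add: z(1))
    qed
  qed (use finT DT in auto)
  also have "\<dots> \<le> (\<Sum>(I, J)\<in>?D. ?K * (\<bar>a I\<bar> * \<bar>a J\<bar>))"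
  proof (rule sum_mono, clarify)
    fix I J assume IJ: "I \<in> ?T" "J \<in> ?T"
    have "a I * a J * ?e I J
        \<le> \<bar>a I * a J\<bar> * \<bar>?e I J\<bar>"
      by (metis abs_ge_self abs_mult)
    also have "\<dots> \<le> \<bar>a I * a J\<bar> * ?K" by (intro mult_left_mono br IJ) auto
    finally show "a I * a J * ?e I J \<le> ?K * (\<bar>a I\<bar> * \<bar>a J\<bar>)"
      by (simp add: abs_mult mult.commute)
  qed
  also have "\<dots> = ?K * (\<Sum>(I, J)\<in>?D. \<bar>a I\<bar> * \<bar>a J\<bar>)"
    by (simp only: sum_distrib_left case_prod_unfold)
  finally show "expectation (\<lambda>w. (\<Sum>I\<in>?T. a I * remainder I w)\<^sup>2) \<le> ?K * (\<Sum>(I, J)\<in>?D. \<bar>a I\<bar> * \<bar>a J\<bar>)" .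
qed

section \<open>The Hajek projection\<close>

text \<open>
  Inserting \<open>i\<close> at position \<open>l\<close> of a tuple that avoids \<open>i\<close> yields the tuples with \<open>i\<close> at position
  \<open>l\<close>.
\<close>

lemma hajek_eq_sum_proj:
  assumes i: "i \<in> {1..n}"
  shows "hajek m n P N X a h i x = fact (n - m) / fact (n - 1) *
    (\<Sum>l=1..m. \<Sum>I | I \<in> tuples \<and> I l = i. a I * proj l I x)"
proof -
  have "(\<Sum>j\<in>inj_tuples (m - 1) ({1..n} - {i}). a (tuple_insert m l i j) *
          (kernel_section m P N X h l j x - kernel_mean m P X h (tuple_insert m l i j)))
      = (\<Sum>I | I \<in> tuples \<and> I l = i. a I * proj l I x)" if l: "l \<in> {1..m}" for l
  proof -
    have "(\<Sum>I | I \<in> tuples \<and> I l = i. a I * proj l I x)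
        = (\<Sum>j\<in>inj_tuples (m - 1) ({1..n} - {i}). a (tuple_insert m l i j) * proj l (tuple_insert m l i j) x)"
      by (rule sum.reindex_bij_betw[OF bij_betw_tuple_insert[OF l i], symmetric])
    also have "\<dots> = (\<Sum>j\<in>inj_tuples (m - 1) ({1..n} - {i}). a (tuple_insert m l i j) *
          (kernel_section m P N X h l j x - kernel_mean m P X h (tuple_insert m l i j)))"
      by (intro sum.cong refl) (simp add: proj_def section_at_def tuple_delete_insert[OF inj_tuplesD(1) l])
    finally show ?thesis by simp
  qed
  then show ?thesis unfolding hajek_def by (subst sum.swap) simp
qed

abbreviation hajek_term :: "((nat \<Rightarrow> nat) \<Rightarrow> real) \<Rightarrow> nat \<Rightarrow> 'w \<Rightarrow> real" where
  "hajek_term a i w \<equiv> hajek m n P N X a h i (X i w)"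

lemma hajek_term_eq:
  assumes i: "i \<in> {1..n}"
  shows "hajek_term a i w = fact (n - m) / fact (n - 1) *
    (\<Sum>l=1..m. \<Sum>I | I \<in> tuples \<and> I l = i. a I * proj l I (X (I l) w))"
  unfolding hajek_eq_sum_proj[OF i] by (intro arg_cong2[where f = "(*)"] sum.cong refl) auto

lemma hajek_meas: "i \<in> {1..n} \<Longrightarrow> hajek m n P N X a h i \<in> borel_measurable N"
  using proj_meas hajek_eq_sum_proj[of i a]
  by (subst measurable_cong[OF hajek_eq_sum_proj]) (auto intro!: borel_measurable_times borel_measurable_sum)

lemma hajek_term_indep: "indep_vars (\<lambda>_. borel) (hajek_term a) {1..n}"
  by (rule indep_vars_compose2[OF indep, where Y = "hajek m n P N X a h"]) (rule hajek_meas)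

lemma hajek_term_mean:
  assumes i: "i \<in> {1..n}"
  shows "expectation (hajek_term a i) = 0"
proof -
  have "expectation (hajek_term a i) = fact (n - m) / fact (n - 1) *
    (\<Sum>l=1..m. \<Sum>I | I \<in> tuples \<and> I l = i. a I * expectation (\<lambda>w. proj l I (X (I l) w)))"
  proof -
    have it: "integrable P (\<lambda>w. a I * proj l I (X (I l) w))"
      if "l \<in> {1..m}" "I \<in> {I. I \<in> tuples \<and> I l = i}" for l I
      using proj_low_moments(5)[of I l] that by simp
    have "expectation (\<lambda>w. \<Sum>l=1..m. \<Sum>I | I \<in> tuples \<and> I l = i. a I * proj l I (X (I l) w))
        = (\<Sum>l=1..m. \<Sum>I | I \<in> tuples \<and> I l = i. expectation (\<lambda>w. a I * proj l I (X (I l) w)))"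
      using it by (subst Bochner_Integration.integral_sum)
        (intro sum.cong refl Bochner_Integration.integrable_sum Bochner_Integration.integral_sum; blast)+
    then show ?thesis
      unfolding hajek_term_eq[OF i] by (simp only: integral_mult_right_zero)
  qed
  also have "\<dots> = 0" by (auto intro!: sum.neutral simp: proj_mean)
  finally show ?thesis .
qed

text \<open>
  The Hajek term is a weighted sum of projections, to which Jensen's inequality is applied with the
  absolute weights. Since the entries of a tuple are distinct, a tuple through \<open>i\<close> carries \<open>i\<close> at
  exactly one position, so the total weight is a sum over tuples.
\<close>

lemma hajek_term_cube:
  assumes i: "i \<in> {1..n}"
  shows "integrable P (\<lambda>w. \<bar>hajek_term a i w\<bar> ^ 3)"
    and "expectation (\<lambda>w. \<bar>hajek_term a i w\<bar> ^ 3) \<le> (2 * s) ^ 3 *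
      (fact (n - m) / fact (n - 1) * (\<Sum>I | I \<in> tuples \<and> i \<in> I ` {1..m}. \<bar>a I\<bar>)) ^ 3"
proof -
  define c :: real where "c = fact (n - m) / fact (n - 1)"
  let ?T = "tuples"
  define D where "D = (SIGMA l:{1..m}. {I. I \<in> ?T \<and> I l = i})"
  define v where "v z = c * \<bar>a (snd z)\<bar>" for z :: "nat \<times> (nat \<Rightarrow> nat)"
  define q where "q z w = proj (fst z) (snd z) (X (snd z (fst z)) w)" for z :: "nat \<times> (nat \<Rightarrow> nat)" and w
  have c0: "c > 0" by (simp add: c_def)
  have finT: "finite ?T" by (simp add: finite_inj_tuples)
  have v0: "v z \<ge> 0" for z using c0 by (simp add: v_def)
  have iq: "integrable P (\<lambda>w. \<bar>q z w\<bar> ^ 3)" "expectation (\<lambda>w. \<bar>q z w\<bar> ^ 3) \<le> (2 * s) ^ 3" if "z \<in> D" for z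
    using that proj_low_moments(1,2)[of "snd z" "fst z"] by (auto simp: q_def D_def)
  have W: "(\<Sum>z\<in>D. v z) = c * (\<Sum>I | I \<in> ?T \<and> i \<in> I ` {1..m}. \<bar>a I\<bar>)"
  proof -
    have "inj_on snd D"
    proof (rule inj_onI)
      fix z z' assume z: "z \<in> D" "z' \<in> D" "snd z = snd z'"
      have D: "fst z \<in> {1..m}" "snd z \<in> ?T" "snd z (fst z) = i" if "z \<in> D" for z
        using that unfolding D_def by auto
      have "snd z (fst z) = snd z (fst z')" using D(3)[OF z(1)] D(3)[OF z(2)] z(3) by simp
      then have "fst z = fst z'"
        by (rule inj_onD[OF inj_tuplesD(3)[OF D(2)[OF z(1)]] _ D(1)[OF z(1)] D(1)[OF z(2)]])
      then show "z = z'" using z(3) by (rule prod_eqI)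
    qed
    moreover have "snd ` D = {I. I \<in> ?T \<and> i \<in> I ` {1..m}}"
    proof (intro equalityI subsetI)
      fix I assume "I \<in> {I. I \<in> ?T \<and> i \<in> I ` {1..m}}"
      then obtain l where "I \<in> ?T" "l \<in> {1..m}" "I l = i" by blast
      then have "(l, I) \<in> D" by (simp add: D_def)
      then show "I \<in> snd ` D" by (rule rev_image_eqI) simp
    qed (auto simp: D_def)
    ultimately have "(\<Sum>I | I \<in> ?T \<and> i \<in> I ` {1..m}. \<bar>a I\<bar>) = (\<Sum>z\<in>D. \<bar>a (snd z)\<bar>)"
      using sum.reindex[of snd D "\<lambda>I. \<bar>a I\<bar>"] by (simp add: o_def)
    then show ?thesis by (simp add: v_def sum_distrib_left)
  qed
  let ?B = "\<lambda>w. (\<Sum>z\<in>D. v z)\<^sup>2 * (\<Sum>z\<in>D. v z * \<bar>q z w\<bar> ^ 3)"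
  have bnd: "\<bar>hajek_term a i w\<bar> ^ 3 \<le> ?B w" for w
  proof -
    have "hajek_term a i w = (\<Sum>z\<in>D. c * (a (snd z) * q z w))"
      unfolding hajek_term_eq[OF i] c_def[symmetric] q_def D_def
      using finT by (subst sum.Sigma) (auto simp: sum_distrib_left split_beta)
    also have "\<bar>\<dots>\<bar> \<le> (\<Sum>z\<in>D. v z * \<bar>q z w\<bar>)"
      using c0 by (intro order_trans[OF sum_abs] sum_mono) (auto simp: v_def abs_mult)
    finally have "\<bar>hajek_term a i w\<bar> ^ 3 \<le> (\<Sum>z\<in>D. v z * \<bar>q z w\<bar>) ^ 3" by (intro power_mono) auto
    also have "\<dots> \<le> ?B w" by (rule weighted_power_mean_3) (auto simp: v0)
    finally show ?thesis .
  qed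
  have iB: "integrable P ?B" by (intro integrable_mult_right Bochner_Integration.integrable_sum iq(1))
  have meas: "hajek_term a i \<in> borel_measurable P"
    by (rule measurable_compose[OF X_meas[OF i] hajek_meas[OF i]])
  show int: "integrable P (\<lambda>w. \<bar>hajek_term a i w\<bar> ^ 3)"
    by (rule Bochner_Integration.integrable_bound[OF iB]) (use meas order_trans[OF bnd abs_ge_self] in auto)
  have "expectation (\<lambda>w. \<bar>hajek_term a i w\<bar> ^ 3) \<le> expectation ?B" using bnd by (intro integral_mono int iB)
  also have "\<dots> = (\<Sum>z\<in>D. v z)\<^sup>2 * (\<Sum>z\<in>D. v z * expectation (\<lambda>w. \<bar>q z w\<bar> ^ 3))"
    using iq(1) by simp
  also have "\<dots> \<le> (\<Sum>z\<in>D. v z)\<^sup>2 * (\<Sum>z\<in>D. v z * (2 * s) ^ 3)"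
    by (intro mult_left_mono sum_mono iq v0) auto
  also have "\<dots> = (2 * s) ^ 3 * (\<Sum>z\<in>D. v z) ^ 3"
    by (simp add: sum_distrib_right[symmetric] power2_eq_square power3_eq_cube)
  finally show "expectation (\<lambda>w. \<bar>hajek_term a i w\<bar> ^ 3) \<le> (2 * s) ^ 3 *
      (fact (n - m) / fact (n - 1) * (\<Sum>I | I \<in> ?T \<and> i \<in> I ` {1..m}. \<bar>a I\<bar>)) ^ 3"
    by (simp only: W c_def)
qed

lemma sum_hajek_term_cube:
  "(\<Sum>i=1..n. expectation (\<lambda>w. \<bar>hajek_term a i w\<bar> ^ 3)) \<le> 8 * real m ^ 4 * s ^ 3 * real n * weight_avg m n a 3 1"
proof -
  have "(\<Sum>i=1..n. expectation (\<lambda>w. \<bar>hajek_term a i w\<bar> ^ 3)) \<le> (\<Sum>i=1..n. (2 * s) ^ 3 *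
      (fact (n - m) / fact (n - 1) * (\<Sum>I | I \<in> tuples \<and> i \<in> I ` {1..m}. \<bar>a I\<bar>)) ^ 3)"
    by (intro sum_mono hajek_term_cube(2))
  also have "\<dots> = (2 * s) ^ 3 * (\<Sum>i=1..n.
      (fact (n - m) / fact (n - 1) * (\<Sum>I | I \<in> tuples \<and> i \<in> I ` {1..m}. \<bar>a I\<bar>)) ^ 3)"
    by (rule sum_distrib_left[symmetric])
  also have "\<dots> \<le> (2 * s) ^ 3 * (real m ^ 4 * real n * weight_avg m n a 3 1)"
    by (intro mult_left_mono sum_cube_tuples_through_le_weight_avg m mn) (use s in simp)
  finally show ?thesis by (simp add: power_mult_distrib algebra_simps)
qed

lemma hajek_term_square_integrable:
  assumes i: "i \<in> {1..n}"
  shows "integrable P (\<lambda>w. (hajek_term a i w)\<^sup>2)"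
  using abs_power_integrable_mono(1)[OF measurable_compose[OF X_meas[OF i] hajek_meas[OF i]] hajek_term_cube(1)[OF i], of 2]
  by simp

lemma sum_hajek_term_square:
  "(\<Sum>i=1..n. expectation (\<lambda>w. (hajek_term a i w)\<^sup>2)) = (real n)\<^sup>2 * hajek_var m n P N X a h"
proof -
  have sq: "expectation (\<lambda>w. (\<Sum>i=1..n. hajek_term a i w)\<^sup>2) = (\<Sum>i=1..n. expectation (\<lambda>w. (hajek_term a i w)\<^sup>2))"
    by (intro expectation_square_sum_indep(2)[OF finite_atLeastAtMost hajek_term_indep]
          hajek_term_square_integrable hajek_term_mean; assumption)
  have i1: "integrable P (hajek_term a i)" if "i \<in> {1..n}" for i
    using square_integrable_imp_integrable[OF measurable_compose[OF X_meas[OF that] hajek_meas[OF that]]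
        hajek_term_square_integrable[OF that]] .
  have E0: "expectation (\<lambda>w. (\<Sum>i=1..n. hajek_term a i w) / real n) = 0"
    using i1 hajek_term_mean by simp
  have "hajek_var m n P N X a h = expectation (\<lambda>w. (\<Sum>i=1..n. hajek_term a i w)\<^sup>2) / (real n)\<^sup>2"
    unfolding hajek_var_def E0 by (simp only: diff_zero power_divide integral_divide_zero)
  then show "(\<Sum>i=1..n. expectation (\<lambda>w. (hajek_term a i w)\<^sup>2)) = (real n)\<^sup>2 * hajek_var m n P N X a h"
    using sq m mn by simp
qed

lemma ustat_meas: "ustat m n X a h \<in> borel_measurable P"
  unfolding ustat_def[abs_def] using kernel_at_meas
  by (intro borel_measurable_times borel_measurable_sum) auto

text \<open>
  Summing the projections \<open>proj l I (X (I l))\<close> over all tuples \<open>I\<close> and positions \<open>l\<close> amounts to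
  summing, over all indices \<open>i\<close>, those with \<open>I l = i\<close>, which is the sum of the Hajek terms.
\<close>

lemma centered_ustat_eq:
  "real n * (ustat m n X a h w - expectation (ustat m n X a h)) - (\<Sum>i=1..n. hajek_term a i w)
     = real n * (fact (n - m) / fact n) * (\<Sum>I\<in>tuples. a I * remainder I w)"
proof -
  let ?T = "tuples"
  define c :: real where "c = fact (n - m) / fact n"
  have cn: "fact (n - m) / fact (n - 1) = real n * c"
  proof -
    have "(fact n :: real) = real n * fact (n - 1)" using m mn by (metis One_nat_def fact_reduce le_trans zero_less_one less_le_trans)
    then show ?thesis using m mn by (simp add: c_def)
  qed
  have finT: "finite ?T" by (simp add: finite_inj_tuples)
  have E: "expectation (ustat m n X a h) = c * (\<Sum>I\<in>?T. a I * kernel_mean m P X h I)"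
    unfolding ustat_def[abs_def] c_def[symmetric] kernel_mean_def using kernel_moments(3) by simp
  have "(\<Sum>i=1..n. hajek_term a i w)
      = (\<Sum>i=1..n. real n * c * (\<Sum>l=1..m. \<Sum>I | I \<in> ?T \<and> I l = i. a I * proj l I (X (I l) w)))"
    by (intro sum.cong refl) (simp only: hajek_term_eq cn)
  also have "\<dots> = real n * c * (\<Sum>l=1..m. \<Sum>i=1..n. \<Sum>I | I \<in> ?T \<and> I l = i. a I * proj l I (X (I l) w))"
    unfolding sum_distrib_left[symmetric] by (subst sum.swap) (rule refl)
  also have "\<dots> = real n * c * (\<Sum>l=1..m. \<Sum>I\<in>?T. a I * proj l I (X (I l) w))"
  proof (intro arg_cong2[where f = "(*)"] sum.cong refl)
    fix l assume l: "l \<in> {1..m}"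
    show "(\<Sum>i=1..n. \<Sum>I | I \<in> ?T \<and> I l = i. a I * proj l I (X (I l) w)) = (\<Sum>I\<in>?T. a I * proj l I (X (I l) w))"
      by (rule sum.group[OF finT]) (use index_in[OF _ l] in auto)
  qed
  also have "\<dots> = real n * c * (\<Sum>I\<in>?T. a I * (\<Sum>l=1..m. proj l I (X (I l) w)))"
    by (subst sum.swap) (simp only: sum_distrib_left)
  finally have H: "(\<Sum>i=1..n. hajek_term a i w) = real n * c * (\<Sum>I\<in>?T. a I * (\<Sum>l=1..m. proj l I (X (I l) w)))" .
  have "(\<Sum>I\<in>?T. a I * remainder I w) = (\<Sum>I\<in>?T. a I * kernel_at m X h I w)
      - (\<Sum>I\<in>?T. a I * kernel_mean m P X h I) - (\<Sum>I\<in>?T. a I * (\<Sum>l=1..m. proj l I (X (I l) w)))"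
    by (simp only: remainder_def right_diff_distrib sum_subtractf)
  then show ?thesis
    unfolding E H ustat_def c_def[symmetric] by (simp add: right_diff_distrib mult.assoc)
qed

lemma centered_ustat_minus_hajek_square:
  fixes a :: "(nat \<Rightarrow> nat) \<Rightarrow> real"
  assumes m2: "m \<ge> 2"
  defines "R \<equiv> \<lambda>w. real n * (ustat m n X a h w - expectation (ustat m n X a h)) - (\<Sum>i=1..n. hajek_term a i w)"
  shows "integrable P (\<lambda>w. (R w)\<^sup>2)"
    and "expectation (\<lambda>w. (R w)\<^sup>2) \<le> 4 * real m ^ 4 * (8 + 8 * (real m)\<^sup>2) * s\<^sup>2 * weight_avg m n a 2 2"
proof -
  let ?S = "\<lambda>w. \<Sum>I\<in>tuples. a I * remainder I w"
  let ?D = "\<Sum>(I, J) | I \<in> tuples \<and> J \<in> tuples \<and> 2 \<le> card (I ` {1..m} \<inter> J ` {1..m}).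
              \<bar>a I\<bar> * \<bar>a J\<bar>"
  let ?K = "(8 + 8 * (real m)\<^sup>2) * s\<^sup>2"
  define c :: real where "c = fact (n - m) / fact n"
  have R: "(R w)\<^sup>2 = (real n)\<^sup>2 * c\<^sup>2 * (?S w)\<^sup>2" for w
    unfolding R_def centered_ustat_eq by (simp only: c_def power_mult_distrib)
  show "integrable P (\<lambda>w. (R w)\<^sup>2)"
    unfolding R using weighted_remainder_square(1)[of a] by simp
  have "expectation (\<lambda>w. (R w)\<^sup>2) = (real n)\<^sup>2 * c\<^sup>2 * expectation (\<lambda>w. (?S w)\<^sup>2)"
    unfolding R by simp
  also have "\<dots> \<le> (real n)\<^sup>2 * c\<^sup>2 * (?K * ?D)"
    by (intro mult_left_mono weighted_remainder_square(2)) auto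
  also have "\<dots> = (real n)\<^sup>2 * ?K * (c\<^sup>2 * ?D)" by (simp only: ac_simps)
  also have "\<dots> \<le> (real n)\<^sup>2 * ?K * (4 * real m ^ 4 / (real n)\<^sup>2 * weight_avg m n a 2 2)"
    unfolding c_def by (intro mult_left_mono sum_overlapping_pairs_le_weight_avg m2 mn) auto
  also have "\<dots> = 4 * real m ^ 4 * (8 + 8 * (real m)\<^sup>2) * s\<^sup>2 * weight_avg m n a 2 2"
    using m mn by (simp add: field_simps)
  finally show "expectation (\<lambda>w. (R w)\<^sup>2) \<le> 4 * real m ^ 4 * (8 + 8 * (real m)\<^sup>2) * s\<^sup>2 * weight_avg m n a 2 2" .
qed

end

section \<open>Bootstrapping the Hajek projection of a weighted U-statistic\<close>

theorem theorem2p4: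
  fixes m :: nat
    and P :: "nat \<Rightarrow> 'w measure"
    and N :: "'x measure"
    and X :: "nat \<Rightarrow> nat \<Rightarrow> 'w \<Rightarrow> 'x"
    and a :: "nat \<Rightarrow> (nat \<Rightarrow> nat) \<Rightarrow> real"
    and h :: "nat \<Rightarrow> (nat \<Rightarrow> 'x) \<Rightarrow> real"
    and M :: "nat \<Rightarrow> real"
  defines "V \<equiv> \<lambda>n. hajek_var m n (P n) N (X n) (a n) (h n)"
    and "Z \<equiv> \<lambda>n. scaled_hajek m n (P n) N (X n) (a n) (h n)"
  assumes "m \<ge> 1"
    and "\<And>n. n \<ge> m \<Longrightarrow> prob_space (P n)"
    and "\<And>n. n \<ge> m \<Longrightarrow> prob_space.indep_vars (P n) (\<lambda>_. N) (X n) {1..n}"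
    and "\<And>n. n \<ge> m \<Longrightarrow> h n \<in> borel_measurable (\<Pi>\<^sub>M k\<in>{1..m}. N)"
    and "\<And>n. n \<ge> m \<Longrightarrow> M n > 0"
    and "\<And>n i. n \<ge> m \<Longrightarrow> i \<in> inj_tuples m {1..n} \<Longrightarrow>
           integrable (P n) (\<lambda>\<omega>. kernel_at m (X n) (h n) i \<omega> ^ 4) \<and>
           prob_space.expectation (P n) (\<lambda>\<omega>. kernel_at m (X n) (h n) i \<omega> ^ 4) \<le> M n"
    and "\<forall>\<^sub>F n in sequentially. V n > 0"
    and "(\<lambda>n. real n powr (-2) * V n powr (-3/2) * weight_avg m n (a n) 3 1 * M n powr (3/4))
           \<longlonglongrightarrow> 0"
    and "\<And>\<epsilon>. \<epsilon> > 0 \<Longrightarrow>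
           (\<lambda>n. SUP i\<in>{1..n}. measure (P n) {\<omega> \<in> space (P n). \<bar>Z n i \<omega>\<bar> \<ge> \<epsilon>}) \<longlonglongrightarrow> 0"
    and "\<And>\<epsilon>. \<epsilon> > 0 \<Longrightarrow>
           (\<lambda>n. \<Sum>i=1..n. (prob_space.expectation (P n)
              (\<lambda>\<omega>. Z n i \<omega> * indicator {\<omega>. \<bar>Z n i \<omega>\<bar> \<le> \<epsilon>} \<omega>))\<^sup>2) \<longlonglongrightarrow> 0"
  shows "tendsto_0_in_prob P (\<lambda>n \<omega>. SUP t.
           \<bar>boot_cdf m n (P n) N (X n) (a n) (h n) \<omega> t
             - measure (P n) {\<omega>' \<in> space (P n). (\<Sum>i=1..n. Z n i \<omega>') \<le> t}\<bar>) \<and>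
         (m \<ge> 2 \<longrightarrow>
          (\<lambda>n. real n powr (-2) * V n powr (-1) * weight_avg m n (a n) 2 2 * M n powr (1/2))
            \<longlonglongrightarrow> 0 \<longrightarrow>
          tendsto_0_in_prob P (\<lambda>n \<omega>. SUP t.
            \<bar>boot_cdf m n (P n) N (X n) (a n) (h n) \<omega> t
              - measure (P n) {\<omega>' \<in> space (P n).
                  (ustat m n (X n) (a n) (h n) \<omega>'
                     - prob_space.expectation (P n) (ustat m n (X n) (a n) (h n)))
                    / ustat_sd m n (P n) (X n) (a n) (h n) \<le> t}\<bar>))"
proof -
  note m1 = assms(3) and ps = assms(4) and indep = assms(5) and hm = assms(6) and Mpos = assms(7)
    and mom = assms(8) and Vpos = assms(9) and A31 = assms(10)
  define s where "s n = M n powr (1 / 4)" for n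
  define Y where "Y n i w = hajek m n (P n) N (X n) (a n) (h n) i (X n i w)" for n i w
  define b where "b n = real n * sqrt (V n)" for n
  define sd where "sd n = ustat_sd m n (P n) (X n) (a n) (h n)" for n
  define c where "c n = real n * sd n" for n
  define U where "U n = ustat m n (X n) (a n) (h n)" for n
  define T where "T n w = real n * (U n w - (\<integral>w. U n w \<partial>P n))" for n w
  have row: "ustat_row (P n) N (X n) (h n) m n (s n)" if "n \<ge> m" for n
  proof -
    have s4: "s n ^ 4 = M n" using Mpos[OF that] by (simp add: s_def powr_power)
    show ?thesis
    proof (intro ustat_row.intro ustat_row_axioms.intro)
      show "s n > 0" using Mpos[OF that] by (simp add: s_def)
    qed (use mom[OF that] in \<open>simp_all only: s4 m1 that ps[OF that] indep[OF that] hm[OF that]\<close>)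
  qed
  have c0: "c n \<ge> 0" for n
    by (simp add: c_def sd_def ustat_sd_def)
  have good: "\<forall>\<^sub>F n in sequentially. n \<ge> m \<and> V n > 0"
    using eventually_ge_at_top[of m] Vpos by eventually_elim simp
  have powers: "s n ^ 3 = M n powr (3/4)" "(s n)\<^sup>2 = M n powr (1/2)" if "n \<ge> m" for n
    using Mpos[OF that] by (simp_all add: s_def powr_power)
  have ly: "lyapunov_array P Y b"
    unfolding lyapunov_array_def
  proof
    show "\<forall>\<^sub>F n in sequentially. prob_space (P n) \<and> b n > 0 \<and>
        prob_space.indep_vars (P n) (\<lambda>_. borel) (Y n) {1..n} \<and>
        (\<forall>i\<in>{1..n}. integrable (P n) (\<lambda>w. \<bar>Y n i w\<bar> ^ 3) \<and> (\<integral>w. Y n i w \<partial>P n) = 0) \<and>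
        (\<Sum>i=1..n. \<integral>w. (Y n i w)\<^sup>2 \<partial>P n) = (b n)\<^sup>2"
      using good
    proof eventually_elim
      case (elim n)
      interpret ustat_row "P n" N "X n" "h n" m n "s n" using row elim by simp
      have "b n > 0" using elim m1 by (simp add: b_def)
      moreover have "(\<Sum>i=1..n. \<integral>w. (Y n i w)\<^sup>2 \<partial>P n) = (b n)\<^sup>2"
        using sum_hajek_term_square[of "a n"] elim by (simp add: Y_def b_def V_def power_mult_distrib)
      moreover have "indep_vars (\<lambda>_. borel) (Y n) {1..n}"
        using hajek_term_indep[of "a n"] by (simp add: Y_def[abs_def])
      moreover have "integrable (P n) (\<lambda>w. \<bar>Y n i w\<bar> ^ 3)" "(\<integral>w. Y n i w \<partial>P n) = 0" if "i \<in> {1..n}" for i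
        using hajek_term_cube(1)[OF that, of "a n"] hajek_term_mean[OF that, of "a n"] by (simp_all add: Y_def)
      ultimately show ?case using prob_space_axioms by blast
    qed
    let ?A = "\<lambda>n. real n powr (-2) * V n powr (-3/2) * weight_avg m n (a n) 3 1 * M n powr (3/4)"
    let ?L = "\<lambda>n. (\<Sum>i=1..n. \<integral>w. \<bar>Y n i w\<bar> ^ 3 \<partial>P n) / b n ^ 3"
    show "(\<lambda>n. ?L n) \<longlonglongrightarrow> 0"
    proof (rule tendsto_sandwich[OF _ _ tendsto_const])
      show "(\<lambda>n. 8 * real m ^ 4 * ?A n) \<longlonglongrightarrow> 0"
        using tendsto_mult_right_zero[OF A31] by simp
      show "\<forall>\<^sub>F n in sequentially. 0 \<le> ?L n"
        using good by eventually_elim (auto simp: b_def intro!: divide_nonneg_nonneg sum_nonneg)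
      show "\<forall>\<^sub>F n in sequentially. ?L n \<le> 8 * real m ^ 4 * ?A n"
        using good
      proof eventually_elim
        case (elim n)
        interpret ustat_row "P n" N "X n" "h n" m n "s n" using row elim by simp
        have n: "n > 0" "V n > 0" using elim m1 by auto
        have b3: "b n ^ 3 > 0" using n by (simp add: b_def)
        have "V n powr (-3/2) = 1 / (sqrt (V n)) ^ 3"
        proof -
          have "(sqrt (V n)) ^ 3 = V n powr (3/2)"
            using n by (simp add: powr_half_sqrt[symmetric] powr_power)
          then show ?thesis by (simp add: powr_minus_divide)
        qed
        moreover have "real n powr (-2) = 1 / (real n)\<^sup>2" using n by (simp add: powr_minus_divide)
        ultimately have inv: "real n / b n ^ 3 = real n powr (-2) * V n powr (-3/2)"
          using n by (simp add: b_def power_mult_distrib power3_eq_cube power2_eq_square)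
        have "?L n \<le> (8 * real m ^ 4 * s n ^ 3 * real n * weight_avg m n (a n) 3 1) / b n ^ 3"
          using sum_hajek_term_cube[of "a n"] b3 unfolding Y_def by (intro divide_right_mono) auto
        also have "\<dots> = 8 * real m ^ 4 * (real n / b n ^ 3 * weight_avg m n (a n) 3 1 * s n ^ 3)" by simp
        also have "\<dots> = 8 * real m ^ 4 * ?A n"
          using elim by (simp only: inv powers)
        finally show ?case .
      qed
    qed
  qed
  have Ymeas: "Y n i \<in> borel_measurable (P n)" if "n \<ge> m" "i \<in> {1..n}" for n i
  proof -
    interpret ustat_row "P n" N "X n" "h n" m n "s n" by (rule row[OF that(1)])
    show ?thesis unfolding Y_def[abs_def] by (rule measurable_compose[OF X_meas[OF that(2)] hajek_meas[OF that(2)]])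
  qed
  have boot: "boot_cdf m n (P n) N (X n) (a n) (h n) w t = boot_prob n (\<lambda>j. Y n j w) (c n) t" for n w t
    by (simp add: boot_cdf_eq_boot_prob Y_def c_def sd_def)
  note clt = lyapunov_array_asymp_normal[OF ly]
  have sumY_meas: "\<forall>\<^sub>F n in sequentially. (\<lambda>w. \<Sum>i=1..n. Y n i w) \<in> borel_measurable (P n)"
    using good by eventually_elim (auto intro!: borel_measurable_sum Ymeas)
  have Zsum: "(\<Sum>i=1..n. Z n i w) = (\<Sum>i=1..n. Y n i w) / c n" for n w
    by (simp add: Z_def scaled_hajek_def Y_def c_def sd_def sum_divide_distrib)
  show ?thesis
  proof (intro conjI impI, goal_cases)
    case 1
    show ?case
      using bootstrap_consistency[OF ly clt sumY_meas c0] by (simp only: boot Zsum)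
  next
    case 2
    note m2 = 2(1) and A22 = 2(2)
    have Tm: "T n \<in> borel_measurable (P n)" if "n \<ge> m" for n
    proof -
      interpret ustat_row "P n" N "X n" "h n" m n "s n" by (rule row[OF that])
      show ?thesis unfolding T_def[abs_def] U_def using ustat_meas[of "a n"] by measurable
    qed
    have "asymp_normal P T b"
    proof (rule asymp_normal_perturb[OF clt])
      show "\<forall>\<^sub>F n in sequentially. prob_space (P n) \<and> b n > 0 \<and>
          (\<lambda>w. \<Sum>i=1..n. Y n i w) \<in> borel_measurable (P n) \<and> T n \<in> borel_measurable (P n) \<and>
          integrable (P n) (\<lambda>w. (T n w - (\<Sum>i=1..n. Y n i w))\<^sup>2)"
        using good sumY_meas
      proof eventually_elim
        case (elim n)
        interpret ustat_row "P n" N "X n" "h n" m n "s n" using row elim by simp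
        have "integrable (P n) (\<lambda>w. (T n w - (\<Sum>i=1..n. Y n i w))\<^sup>2)"
          unfolding T_def U_def Y_def by (rule centered_ustat_minus_hajek_square(1)[OF m2])
        moreover have "b n > 0" using elim m1 by (simp add: b_def)
        ultimately show ?case using prob_space_axioms elim Tm by blast
      qed
      let ?C = "4 * real m ^ 4 * (8 + 8 * (real m)\<^sup>2)"
      let ?A = "\<lambda>n. real n powr (-2) * V n powr (-1) * weight_avg m n (a n) 2 2 * M n powr (1/2)"
      let ?E = "\<lambda>n. (\<integral>w. (T n w - (\<Sum>i=1..n. Y n i w))\<^sup>2 \<partial>P n) / (b n)\<^sup>2"
      show "(\<lambda>n. ?E n) \<longlonglongrightarrow> 0"
      proof (rule tendsto_sandwich[OF _ _ tendsto_const])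
        show "(\<lambda>n. ?C * ?A n) \<longlonglongrightarrow> 0"
          using tendsto_mult_right_zero[OF A22] by simp
        show "\<forall>\<^sub>F n in sequentially. 0 \<le> ?E n"
          by simp
        show "\<forall>\<^sub>F n in sequentially. ?E n \<le> ?C * ?A n"
          using good
        proof eventually_elim
          case (elim n)
          interpret ustat_row "P n" N "X n" "h n" m n "s n" using row elim by simp
          have n: "n > 0" "V n > 0" using elim m1 by auto
          have inv: "1 / (b n)\<^sup>2 = real n powr (-2) * V n powr (-1)"
            using n by (simp add: b_def power_mult_distrib powr_minus_divide)
          have "?E n \<le> ?C * (s n)\<^sup>2 * weight_avg m n (a n) 2 2 / (b n)\<^sup>2"
            unfolding T_def U_def Y_def by (intro divide_right_mono centered_ustat_minus_hajek_square(2)[OF m2]) simp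
          also have "\<dots> = ?C * (1 / (b n)\<^sup>2 * weight_avg m n (a n) 2 2 * (s n)\<^sup>2)" by simp
          also have "\<dots> = ?C * ?A n"
            using elim by (simp only: inv powers)
          finally show ?case .
        qed
      qed
    qed
    moreover have "\<forall>\<^sub>F n in sequentially. T n \<in> borel_measurable (P n)"
      using good by eventually_elim (simp add: Tm)
    ultimately have "tendsto_0_in_prob P (\<lambda>n w. SUP t. \<bar>boot_prob n (\<lambda>j. Y n j w) (c n) t
           - measure (P n) {w' \<in> space (P n). T n w' / c n \<le> t}\<bar>)"
      by (intro bootstrap_consistency[OF ly _ _ c0])
    then show ?case
    proof (rule tendsto_0_in_prob_cong, goal_cases)
      case 1
      show ?case
        \<comment> \<open>For \<open>n > 0\<close> the factor \<open>n\<close> cancels, also if the standard deviation is \<open>0\<close>.\<close>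
        using eventually_gt_at_top[of 0]
      proof eventually_elim
        case (elim n)
        then have "T n w / c n = (U n w - (\<integral>w. U n w \<partial>P n)) / sd n" for w
          by (simp add: T_def c_def)
        then show ?case by (simp only: boot U_def sd_def)
      qed
    qed
  qed
qed

end
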